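(* Let $(M^n,g)$ be a Riemannian manifold and fix $k\in\mathbb{N}$ and $\lambda\in\mathbb{R}$. The operator $$\phi\mapsto\widetilde{\sigma}_{k,\phi}$$ is elliptic in the cone $\{\phi\in C^\infty(M):(\phi,\lambda)\in\Gamma_k^{\infty,-}\}$.
   Context: The weighted elementary symmetric polynomials $\sigma_k^\infty\colon\mathbb{R}\times\mathbb{R}^n\to\mathbb{R}$ are defined recursively by $\sigma_0^\infty=1$ and, for $k\ge1$, $$k\,\sigma_k^\infty(\mu_0;\mu)=\sigma_{k-1}^\infty(\mu_0;\mu)\sum_{j=0}^n\mu_j+\sum_{i=1}^{k-1}\sum_{j=1}^n(-1)^i\sigma_{k-1-i}^\infty(\mu_0;\mu)\,\mu_j^{i+1};$$ for a self-adjoint endomorphism $P$ with eigenvalues $\mu$, $\sigma_k^\infty(\mu_0;P):=\sigma_k^\infty(\mu_0;\mu)$. For $\phi\in C^\infty(M)$: $\widetilde{\operatorname{Ric}}_\phi:=\operatorname{Ric}+\nabla^2\phi-\lambda g$, $\widetilde{Y}_\phi:=-\frac12(R+|\nabla\phi|^2-2\lambda\phi)$, $\widetilde{\sigma}_{k,\phi}:=\sigma_k^\infty(\widetilde{Y}_\phi;\widetilde{\operatorname{Ric}}_\phi)$. The pair $(\phi,\lambda)$ lies in $\Gamma_k^{\infty,-}$ (the negative weighted elliptic $k$-cone) if $(-1)^j\widetilde{\sigma}_{j,\phi}>0$ at every point of $M$ for all $j\in\{1,\dots,k\}$. "Elliptic in the cone" means that at each $\phi$ in the cone the linearization $\psi\mapsto\frac{d}{dt}\big|_{t=0}\widetilde{\sigma}_{k,\phi+t\psi}$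 is an elliptic second-order linear differential operator (its principal symbol is a definite quadratic form at every point). *)

theory Defs
  imports "HOL-Analysis.Analysis"
begin

section \<open>Smooth functions on open subsets of Euclidean space\<close>

definition partial :: "'n::finite \<Rightarrow> (real^'n \<Rightarrow> 'b::real_normed_vector) \<Rightarrow> real^'n \<Rightarrow> 'b" where
  "partial i f u = frechet_derivative f (at u) (axis i 1)"

text \<open>Only meant for open \<open>S\<close>, since derivatives are taken in the ambient space.\<close>

primrec Ck_on :: "nat \<Rightarrow> (real^'n::finite) set \<Rightarrow> (real^'n \<Rightarrow> 'b::real_normed_vector) \<Rightarrow> bool" where
  "Ck_on 0 S f \<longleftrightarrow> continuous_on S f"
| "Ck_on (Suc r) S f \<longleftrightarrow> (\<forall>u\<in>S. f differentiable (at u)) \<and> (\<forall>i. Ck_on r S (partial i f))"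

definition smooth_on :: "(real^'n::finite) set \<Rightarrow> (real^'n \<Rightarrow> 'b::real_normed_vector) \<Rightarrow> bool" where
  "smooth_on S f \<longleftrightarrow> (\<forall>r. Ck_on r S f)"


section \<open>Riemannian manifolds\<close>

text \<open>A chart is a pair \<open>(U, x)\<close> of its domain and its coordinate map; values of \<open>x\<close> outside
  \<open>U\<close> are irrelevant.\<close>

type_synonym ('a, 'n) chart = "'a set \<times> ('a \<Rightarrow> real^'n)"

definition chart_im :: "('a, 'n::finite) chart \<Rightarrow> (real^'n) set" where
  "chart_im c = snd c ` fst c"

definition chart_inv :: "('a, 'n::finite) chart \<Rightarrow> real^'n \<Rightarrow> 'a" where
  "chart_inv c = inv_into (fst c) (snd c)"

definition is_chart :: "'a topology \<Rightarrow> ('a, 'n::finite) chart \<Rightarrow> bool" where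
  "is_chart M c \<longleftrightarrow> openin M (fst c) \<and> open (chart_im c) \<and>
     homeomorphic_map (subtopology M (fst c)) (top_of_set (chart_im c)) (snd c)"

definition transition :: "('a, 'n::finite) chart \<Rightarrow> ('a, 'n) chart \<Rightarrow> real^'n \<Rightarrow> real^'n" where
  "transition c d = snd d \<circ> chart_inv c"

definition smooth_manifold :: "'a topology \<Rightarrow> ('a, 'n::finite) chart set \<Rightarrow> bool" where
  "smooth_manifold M A \<longleftrightarrow>
     Hausdorff_space M \<and> second_countable M \<and>
     (\<forall>c\<in>A. is_chart M c) \<and> (\<Union>c\<in>A. fst c) = topspace M \<and>
     (\<forall>c\<in>A. \<forall>d\<in>A. smooth_on (snd c ` (fst c \<inter> fst d)) (transition c d))"

text \<open>\<open>C\<^sup>\<infinity>(M)\<close>; functions on \<open>M\<close> are total functions whose values off \<open>topspace M\<close> are irrelevant.\<close>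

definition smooth_functions :: "('a, 'n::finite) chart set \<Rightarrow> ('a \<Rightarrow> real) set" where
  "smooth_functions A = {f. \<forall>c\<in>A. smooth_on (chart_im c) (f \<circ> chart_inv c)}"

text \<open>A Riemannian metric is given by its component matrices \<open>g c u = (g\<^sub>i\<^sub>j(u))\<close> in every chart \<open>c\<close>,
  as functions of the coordinates \<open>u\<close>, subject to the transformation law of a covariant 2-tensor.\<close>

definition riemannian_metric ::
  "('a, 'n::finite) chart set \<Rightarrow> (('a, 'n) chart \<Rightarrow> real^'n \<Rightarrow> real^'n^'n) \<Rightarrow> bool" where
  "riemannian_metric A g \<longleftrightarrow>
     (\<forall>c\<in>A. smooth_on (chart_im c) (g c) \<and>
        (\<forall>u\<in>chart_im c. transpose (g c u) = g c u \<and> (\<forall>v. v \<noteq> 0 \<longrightarrow> v \<bullet> (g c u *v v) > 0))) \<and>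
     (\<forall>c\<in>A. \<forall>d\<in>A. \<forall>u\<in>snd c ` (fst c \<inter> fst d).
        let J = matrix (frechet_derivative (transition c d) (at u))
        in g c u = transpose J ** g d (transition c d u) ** J)"

definition riemannian_manifold ::
  "'a topology \<Rightarrow> ('a, 'n::finite) chart set \<Rightarrow> (('a, 'n) chart \<Rightarrow> real^'n \<Rightarrow> real^'n^'n) \<Rightarrow> bool" where
  "riemannian_manifold M A g \<longleftrightarrow> smooth_manifold M A \<and> riemannian_metric A g"


section \<open>Curvature and covariant derivatives in coordinates\<close>

text \<open>Throughout, \<open>G\<close> is the metric and \<open>f\<close> a function, both in the coordinates of one chart.
  \<open>christoffel G l i j\<close> is \<open>\<Gamma>\<^sup>l\<^sub>i\<^sub>j\<close>.\<close>

definition christoffel :: "(real^'n::finite \<Rightarrow> real^'n^'n) \<Rightarrow> 'n \<Rightarrow> 'n \<Rightarrow> 'n \<Rightarrow> real^'n \<Rightarrow> real" where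
  "christoffel G l i j u = (1/2) * (\<Sum>m\<in>UNIV. matrix_inv (G u) $ l $ m *
     (partial i (\<lambda>w. G w $ j $ m) u + partial j (\<lambda>w. G w $ i $ m) u - partial m (\<lambda>w. G w $ i $ j) u))"

text \<open>\<open>riemann G l k i j\<close> is the \<open>\<partial>\<^sub>l\<close>-component of
  \<open>\<nabla>\<^sub>i \<nabla>\<^sub>j \<partial>\<^sub>k - \<nabla>\<^sub>j \<nabla>\<^sub>i \<partial>\<^sub>k\<close>; with the contraction below, round spheres have positive
  Ricci curvature.\<close>

definition riemann :: "(real^'n::finite \<Rightarrow> real^'n^'n) \<Rightarrow> 'n \<Rightarrow> 'n \<Rightarrow> 'n \<Rightarrow> 'n \<Rightarrow> real^'n \<Rightarrow> real" where
  "riemann G l k i j u =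
     partial i (christoffel G l j k) u - partial j (christoffel G l i k) u +
     (\<Sum>m\<in>UNIV. christoffel G l i m u * christoffel G m j k u
              - christoffel G l j m u * christoffel G m i k u)"

definition ricci :: "(real^'n::finite \<Rightarrow> real^'n^'n) \<Rightarrow> real^'n \<Rightarrow> real^'n^'n" where
  "ricci G u = (\<chi> j k. \<Sum>i\<in>UNIV. riemann G i k i j u)"

definition scalar_curv :: "(real^'n::finite \<Rightarrow> real^'n^'n) \<Rightarrow> real^'n \<Rightarrow> real" where
  "scalar_curv G u = (\<Sum>i\<in>UNIV. \<Sum>j\<in>UNIV. matrix_inv (G u) $ i $ j * ricci G u $ i $ j)"

definition hessian :: "(real^'n::finite \<Rightarrow> real^'n^'n) \<Rightarrow> (real^'n \<Rightarrow> real) \<Rightarrow> real^'n \<Rightarrow> real^'n^'n" where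
  "hessian G f u = (\<chi> i j. partial i (partial j f) u - (\<Sum>l\<in>UNIV. christoffel G l i j u * partial l f u))"

definition grad_norm_sq :: "(real^'n::finite \<Rightarrow> real^'n^'n) \<Rightarrow> (real^'n \<Rightarrow> real) \<Rightarrow> real^'n \<Rightarrow> real" where
  "grad_norm_sq G f u = (\<Sum>i\<in>UNIV. \<Sum>j\<in>UNIV. matrix_inv (G u) $ i $ j * partial i f u * partial j f u)"


section \<open>Weighted elementary symmetric polynomials\<close>

fun wsigma :: "nat \<Rightarrow> real \<Rightarrow> real^'n::finite \<Rightarrow> real" where
  "wsigma 0 \<mu>0 \<mu> = 1"
| "wsigma (Suc k) \<mu>0 \<mu> =
     (wsigma k \<mu>0 \<mu> * (\<mu>0 + (\<Sum>j\<in>UNIV. \<mu> $ j)) +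
      (\<Sum>i=1..k. \<Sum>j\<in>UNIV. (-1)^i * wsigma (k - i) \<mu>0 \<mu> * (\<mu> $ j)^(i+1))) / real (Suc k)"

lemma wsigma_recursion:
  assumes "k \<ge> 1"
  shows "real k * wsigma k \<mu>0 \<mu> =
     wsigma (k - 1) \<mu>0 \<mu> * (\<mu>0 + (\<Sum>j\<in>UNIV. \<mu> $ j)) +
     (\<Sum>i=1..k-1. \<Sum>j\<in>UNIV. (-1)^i * wsigma (k - 1 - i) \<mu>0 \<mu> * (\<mu> $ j)^(i+1))"
  using assms by (cases k) (simp_all del: of_nat_Suc)

text \<open>\<open>\<mu>\<close> lists the eigenvalues of \<open>P\<close> with multiplicity: the characteristic polynomial of \<open>P\<close> splits
  over the reals with roots \<open>\<mu>\<close>. Such \<open>\<mu>\<close> is unique up to reordering, and \<open>wsigma\<close> is symmetric.\<close>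

definition eigenvalues :: "real^'n^'n::finite \<Rightarrow> real^'n \<Rightarrow> bool" where
  "eigenvalues P \<mu> \<longleftrightarrow> (\<forall>t. det (mat t - P) = (\<Prod>j\<in>UNIV. t - \<mu> $ j))"

definition wsigma_end :: "nat \<Rightarrow> real \<Rightarrow> real^'n^'n::finite \<Rightarrow> real" where
  "wsigma_end k \<mu>0 P = wsigma k \<mu>0 (SOME \<mu>. eigenvalues P \<mu>)"


section \<open>The operator and the negative cone\<close>

text \<open>\<open>Ric\<^sub>\<phi>\<close> as an endomorphism, i.e. with one index raised by the metric.\<close>

definition ric_tilde ::
  "(real^'n::finite \<Rightarrow> real^'n^'n) \<Rightarrow> real \<Rightarrow> (real^'n \<Rightarrow> real) \<Rightarrow> real^'n \<Rightarrow> real^'n^'n" where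
  "ric_tilde G lam f u = matrix_inv (G u) ** (ricci G u + hessian G f u - lam *\<^sub>R G u)"

definition Y_tilde ::
  "(real^'n::finite \<Rightarrow> real^'n^'n) \<Rightarrow> real \<Rightarrow> (real^'n \<Rightarrow> real) \<Rightarrow> real^'n \<Rightarrow> real" where
  "Y_tilde G lam f u = - (1/2) * (scalar_curv G u + grad_norm_sq G f u - 2 * lam * f u)"

text \<open>The value at \<open>p\<close> is computed in some chart around \<open>p\<close>; by tensoriality it does not depend on
  which one.\<close>

definition chart_at :: "('a, 'n::finite) chart set \<Rightarrow> 'a \<Rightarrow> ('a, 'n) chart" where
  "chart_at A p = (SOME c. c \<in> A \<and> p \<in> fst c)"

definition sigma_tilde ::
  "('a, 'n::finite) chart set \<Rightarrow> (('a, 'n) chart \<Rightarrow> real^'n \<Rightarrow> real^'n^'n) \<Rightarrow> real \<Rightarrow> nat \<Rightarrow>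
   ('a \<Rightarrow> real) \<Rightarrow> 'a \<Rightarrow> real" where
  "sigma_tilde A g lam k \<phi> p =
     (let c = chart_at A p; u = snd c p; f = \<phi> \<circ> chart_inv c
      in wsigma_end k (Y_tilde (g c) lam f u) (ric_tilde (g c) lam f u))"

definition neg_cone ::
  "'a topology \<Rightarrow> ('a, 'n::finite) chart set \<Rightarrow> (('a, 'n) chart \<Rightarrow> real^'n \<Rightarrow> real^'n^'n) \<Rightarrow> nat \<Rightarrow>
   (('a \<Rightarrow> real) \<times> real) set" where
  "neg_cone M A g k = {(\<phi>, lam). \<phi> \<in> smooth_functions A \<and>
     (\<forall>j\<in>{1..k}. \<forall>p\<in>topspace M. (-1)^j * sigma_tilde A g lam j \<phi> p > 0)}"


section \<open>Ellipticity\<close>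

text \<open>\<open>L\<close> has, in the chart \<open>c\<close>, the form
  \<open>\<Sum> a\<^sub>i\<^sub>j \<partial>\<^sub>i \<partial>\<^sub>j + \<Sum> b\<^sub>i \<partial>\<^sub>i + e\<close> with smooth coefficients and symmetric \<open>a\<close>. The principal
  symbol at \<open>u\<close> is the quadratic form \<open>\<xi> \<mapsto> \<Sum> a\<^sub>i\<^sub>j(u) \<xi>\<^sub>i \<xi>\<^sub>j\<close>.\<close>

definition diff_op2_in_chart ::
  "('a, 'n::finite) chart set \<Rightarrow> (('a \<Rightarrow> real) \<Rightarrow> 'a \<Rightarrow> real) \<Rightarrow> ('a, 'n) chart \<Rightarrow>
   (real^'n \<Rightarrow> real^'n^'n) \<Rightarrow> (real^'n \<Rightarrow> real^'n) \<Rightarrow> (real^'n \<Rightarrow> real) \<Rightarrow> bool" where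
  "diff_op2_in_chart A L c a b e \<longleftrightarrow>
     smooth_on (chart_im c) a \<and> smooth_on (chart_im c) b \<and> smooth_on (chart_im c) e \<and>
     (\<forall>u\<in>chart_im c. transpose (a u) = a u) \<and>
     (\<forall>\<psi>\<in>smooth_functions A. \<forall>u\<in>chart_im c.
        let f = \<psi> \<circ> chart_inv c in
        L \<psi> (chart_inv c u) =
          (\<Sum>i\<in>UNIV. \<Sum>j\<in>UNIV. a u $ i $ j * partial i (partial j f) u)
          + (\<Sum>i\<in>UNIV. b u $ i * partial i f u) + e u * f u)"

definition definite_form :: "real^'n^'n::finite \<Rightarrow> bool" where
  "definite_form B \<longleftrightarrow> (\<forall>\<xi>. \<xi> \<noteq> 0 \<longrightarrow> \<xi> \<bullet> (B *v \<xi>) > 0) \<or> (\<forall>\<xi>. \<xi> \<noteq> 0 \<longrightarrow> \<xi> \<bullet> (B *v \<xi>) < 0)"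

definition elliptic_diff_op2 ::
  "('a, 'n::finite) chart set \<Rightarrow> (('a \<Rightarrow> real) \<Rightarrow> 'a \<Rightarrow> real) \<Rightarrow> bool" where
  "elliptic_diff_op2 A L \<longleftrightarrow>
     (\<forall>c\<in>A. \<exists>a b e. diff_op2_in_chart A L c a b e \<and> (\<forall>u\<in>chart_im c. definite_form (a u)))"

definition linearization ::
  "(('a \<Rightarrow> real) \<Rightarrow> 'a \<Rightarrow> real) \<Rightarrow> ('a \<Rightarrow> real) \<Rightarrow> ('a \<Rightarrow> real) \<Rightarrow> 'a \<Rightarrow> real" where
  "linearization F \<phi> \<psi> p = deriv (\<lambda>t. F (\<lambda>q. \<phi> q + t * \<psi> q) p) 0"

definition elliptic_at ::
  "'a topology \<Rightarrow> ('a, 'n::finite) chart set \<Rightarrow> (('a \<Rightarrow> real) \<Rightarrow> 'a \<Rightarrow> real) \<Rightarrow> ('a \<Rightarrow> real) \<Rightarrow> bool" where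
  "elliptic_at M A F \<phi> \<longleftrightarrow>
     (\<forall>\<psi>\<in>smooth_functions A. \<forall>p\<in>topspace M.
        (\<lambda>t. F (\<lambda>q. \<phi> q + t * \<psi> q) p) field_differentiable (at 0)) \<and>
     elliptic_diff_op2 A (linearization F \<phi>)"

definition elliptic_in ::
  "'a topology \<Rightarrow> ('a, 'n::finite) chart set \<Rightarrow> (('a \<Rightarrow> real) \<Rightarrow> 'a \<Rightarrow> real) \<Rightarrow> ('a \<Rightarrow> real) set \<Rightarrow> bool" where
  "elliptic_in M A F K \<longleftrightarrow> (\<forall>\<phi>\<in>K. elliptic_at M A F \<phi>)"

end

theory Submission
  imports Defs "HOL-Computational_Algebra.Polynomial_FPS" "HOL-Computational_Algebra.Fundamental_Theorem_Algebra"
begin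

text \<open>
  The polynomials \<open>\<sigma>\<^sub>k\<close> have the generating function \<open>exp (\<mu>\<^sub>0 X) \<Prod> (1 + \<mu>\<^sub>j X)\<close>. In every
  chart \<open>\<sigma>\<^sub>k\<close> is a polynomial in \<open>\<mu>\<^sub>0\<close> and the traces of the powers of \<open>P\<close>, and the principal symbol
  of its linearization is \<open>T G\<^sup>-\<^sup>1\<close>, where \<open>T = \<Sum> (-1)\<^sup>i \<sigma>\<^sub>k\<^sub>-\<^sub>1\<^sub>-\<^sub>i P\<^sup>i\<close>. In a \<open>G\<close>-orthonormal
  eigenbasis of \<open>P\<close> this form is diagonal with entries \<open>\<sigma>\<^sub>k\<^sub>-\<^sub>1\<close> of the remaining eigenvalues when
  one of them is removed. Definiteness says that these have the sign \<open>(-1)\<^sup>k\<^sup>-\<^sup>1\<close> in the cone,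
  which follows from Newton's inequality for \<open>\<sigma>\<^sub>k\<close>. The operator is evaluated in an arbitrarily
  chosen chart at each point, so smoothness of the coefficients rests on the tensoriality of the Ricci
  tensor and the Hessian.
\<close>

section \<open>Generating functions and Newton's inequality\<close>

text \<open>The factor \<open>exp (c X)\<close> is the limit of \<open>(1 + c X / N)^N\<close>:
  \<open>c\<close> stands for infinitely many infinitesimal eigenvalues. Newton's inequality is
  therefore not the one for a finite list of numbers. It is obtained by carrying derivatives through
  the exponential, which acts on the polynomial factor as \<open>q \<mapsto> c q + q'\<close>; this
  operator keeps all roots real for \<open>c\<close> of either sign, which matters because the sign
  of \<open>c\<close> is free. The index set of \<open>wgen\<close> is arbitrary so that an
  eigenvalue can be removed.

  Changing the signs of \<open>c\<close> and of all eigenvalues multiplies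
  \<open>\<sigma>\<^sub>i\<close> by \<open>(-1)^i\<close>, so the negative cone is handled as the
  positive cone of the negated data.

  Two obstacles concern the eigenvalues. They need not depend differentiably on the matrix where
  they collide, and the definition only picks some list of them; hence the passage to traces of
  powers, which are polynomial in the entries. And \<open>G^-1 S\<close> is in general no symmetric
  matrix, only self-adjoint for \<open>G\<close>; hence the diagonalization of two forms at once in
  place of the spectral theorem.\<close>

definition wgen :: "real \<Rightarrow> ('i \<Rightarrow> real) \<Rightarrow> 'i set \<Rightarrow> real fps" where
  "wgen c \<mu> I = fps_exp c * (\<Prod>j\<in>I. 1 + fps_const (\<mu> j) * fps_X)"

definition geom_fps :: "real \<Rightarrow> real fps" where
  "geom_fps m = Abs_fps (\<lambda>i. (-m)^i)"

lemma geom_fps_inverse: "(1 + fps_const m * fps_X) * geom_fps m = 1"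
proof (rule fps_ext)
  fix n show "fps_nth ((1 + fps_const m * fps_X) * geom_fps m) n = fps_nth 1 n"
    by (cases n) (simp_all add: geom_fps_def distrib_right mult.assoc)
qed

lemma wgen_insert:
  assumes "finite I" "j \<notin> I"
  shows "wgen c \<mu> (insert j I) = (1 + fps_const (\<mu> j) * fps_X) * wgen c \<mu> I"
  using assms by (simp add: wgen_def algebra_simps)

lemma wgen_nth_0: "finite I \<Longrightarrow> fps_nth (wgen c \<mu> I) 0 = 1"
  by (induction I rule: finite_induct) (simp_all add: wgen_insert, simp add: wgen_def)

text \<open>Logarithmic differentiation: \<open>exp (c X)\<close> contributes \<open>c\<close> and
  each factor \<open>1 + m X\<close> contributes \<open>m / (1 + m X)\<close>, with
  \<open>geom_fps m\<close> serving as the reciprocal.\<close>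

lemma fps_deriv_wgen:
  assumes "finite I"
  shows "fps_deriv (wgen c \<mu> I) =
    wgen c \<mu> I * (fps_const c + (\<Sum>j\<in>I. fps_const (\<mu> j) * geom_fps (\<mu> j)))"
  using assms
proof (induction I rule: finite_induct)
  case empty
  then show ?case by (simp add: wgen_def mult.commute)
next
  case (insert j I)
  let ?l = "1 + fps_const (\<mu> j) * fps_X"
  let ?S = "fps_const c + (\<Sum>j\<in>I. fps_const (\<mu> j) * geom_fps (\<mu> j))"
  have gen: "(l * h) * (m * w) + l * (w * t) = (l * w) * (t + m * h)" for l h m w t :: "real fps"
    by (simp add: algebra_simps)
  have "fps_deriv (wgen c \<mu> (insert j I)) = fps_const (\<mu> j) * wgen c \<mu> I + ?l * (wgen c \<mu> I * ?S)"
    using insert by (simp add: wgen_insert)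
  also have "fps_const (\<mu> j) * wgen c \<mu> I = (?l * geom_fps (\<mu> j)) * (fps_const (\<mu> j) * wgen c \<mu> I)"
    by (simp add: geom_fps_inverse)
  also have "(?l * geom_fps (\<mu> j)) * (fps_const (\<mu> j) * wgen c \<mu> I) + ?l * (wgen c \<mu> I * ?S)
      = (?l * wgen c \<mu> I) * (?S + fps_const (\<mu> j) * geom_fps (\<mu> j))"
    by (rule gen)
  finally show ?case
    using insert by (simp add: wgen_insert add_ac)
qed

text \<open>These are Newton's identities, read off as the coefficient of \<open>X^k\<close> in
  \<open>f' = N f\<close>. The series \<open>N\<close> has the signed power sum of order
  \<open>i + 1\<close> as its coefficient of index \<open>i\<close>, and \<open>c\<close> enters
  only at \<open>i = 0\<close>.\<close>

lemma wgen_recursion: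
  fixes c :: real and \<mu> :: "real^'n::finite"
  defines "f \<equiv> wgen c (vec_nth \<mu>) UNIV"
  shows "real (Suc k) * fps_nth f (Suc k) = fps_nth f k * (c + (\<Sum>j\<in>UNIV. \<mu> $ j)) +
      (\<Sum>i=1..k. \<Sum>j\<in>UNIV. (-1)^i * fps_nth f (k - i) * (\<mu> $ j)^(i+1))"
proof -
  let ?N = "fps_const c + (\<Sum>j\<in>UNIV. fps_const (\<mu> $ j) * geom_fps (\<mu> $ j))"
  have N: "fps_nth ?N i = (if i = 0 then c else 0) + (\<Sum>j\<in>UNIV. (-1)^i * (\<mu> $ j)^(i+1))" for i
  proof -
    have "\<mu> $ j * (- \<mu> $ j)^i = (-1)^i * (\<mu> $ j)^(i+1)" for j
      by (subst power_minus) simp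
    then have "(\<Sum>j\<in>UNIV. \<mu> $ j * (- \<mu> $ j)^i) = (\<Sum>j\<in>UNIV. (-1)^i * (\<mu> $ j)^(i+1))"
      by (intro sum.cong) auto
    then show ?thesis
      by (simp add: geom_fps_def fps_sum_nth)
  qed
  have "real (Suc k) * fps_nth f (Suc k) = fps_nth (fps_deriv f) k" by simp
  also have "\<dots> = fps_nth (?N * f) k"
    unfolding f_def by (subst fps_deriv_wgen) (simp_all add: mult.commute)
  also have "\<dots> = (\<Sum>i=0..k. fps_nth ?N i * fps_nth f (k - i))"
    by (rule fps_mult_nth)
  also have "\<dots> = fps_nth ?N 0 * fps_nth f k + (\<Sum>i=1..k. fps_nth ?N i * fps_nth f (k - i))"
    by (simp add: sum.atLeast_Suc_atMost)
  also have "(\<Sum>i=1..k. fps_nth ?N i * fps_nth f (k - i)) = (\<Sum>i=1..k. \<Sum>j\<in>UNIV. (-1)^i * fps_nth f (k - i) * (\<mu> $ j)^(i+1))"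
  proof (rule sum.cong[OF refl])
    fix i assume "i \<in> {1..k}"
    then have "fps_nth ?N i = (\<Sum>j\<in>UNIV. (-1)^i * (\<mu> $ j)^(i+1))" unfolding N by simp
    then show "fps_nth ?N i * fps_nth f (k - i) = (\<Sum>j\<in>UNIV. (-1)^i * fps_nth f (k - i) * (\<mu> $ j)^(i+1))"
      by (simp add: sum_distrib_left mult_ac)
  qed
  finally show ?thesis by (simp add: N[of 0, simplified] mult.commute)
qed

lemma wsigma_eq_wgen_nth: "wsigma k c \<mu> = fps_nth (wgen c (vec_nth \<mu>) UNIV) k"
proof (induction k rule: less_induct)
  case (less k)
  show ?case
  proof (cases k)
    case 0 then show ?thesis by (simp add: wgen_nth_0)
  next
    case (Suc m)
    have "real (Suc m) * wsigma (Suc m) c \<mu> = real (Suc m) * fps_nth (wgen c (vec_nth \<mu>) UNIV) (Suc m)"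
      unfolding wgen_recursion using less Suc by (simp del: of_nat_Suc)
    then show ?thesis using Suc by simp
  qed
qed

text \<open>The substitution of \<open>-X\<close> for \<open>X\<close>. It turns the alternating
  signs of the negative cone into positivity, the form in which \<open>wgen_cone_remove\<close> is
  stated.\<close>

lemma wgen_uminus:
  assumes "finite I"
  shows "fps_nth (wgen (-c) (\<lambda>j. - \<mu> j) I) k = (-1)^k * fps_nth (wgen c \<mu> I) k"
  using assms
proof (induction I arbitrary: k rule: finite_induct)
  case empty
  then show ?case by (simp add: wgen_def power_minus[of c])
next
  case (insert j I)
  then show ?case
    by (cases k) (simp_all add: wgen_insert algebra_simps)
qed

section \<open>Real-rooted polynomials and the Laguerre inequality\<close>

definition real_rooted :: "real poly \<Rightarrow> bool" where
  "real_rooted q \<longleftrightarrow> (\<exists>l as. q = smult l (\<Prod>a\<leftarrow>as. [:-a, 1:]))"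

lemma real_rooted_mult: "real_rooted p \<Longrightarrow> real_rooted q \<Longrightarrow> real_rooted (p * q)"
proof -
  assume "real_rooted p" "real_rooted q"
  then obtain l as m bs where "p = smult l (\<Prod>a\<leftarrow>as. [:-a, 1:])" "q = smult m (\<Prod>a\<leftarrow>bs. [:-a, 1:])"
    by (auto simp: real_rooted_def)
  then have "p * q = smult (l * m) (\<Prod>a\<leftarrow>as @ bs. [:-a, 1:])" by (simp add: mult_ac)
  then show ?thesis unfolding real_rooted_def by blast
qed

lemma real_rooted_linear: "real_rooted [:-a, 1:]"
  unfolding real_rooted_def by (rule exI[of _ 1], rule exI[of _ "[a]"]) simp

lemma real_rooted_const: "real_rooted [:l:]"
  unfolding real_rooted_def by (rule exI[of _ l], rule exI[of _ "[]"]) simp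

lemma real_rooted_affine: "real_rooted [:1, m:]"
proof (cases "m = 0")
  case True then show ?thesis by (simp add: real_rooted_const)
next
  case False
  then have "[:1, m:] = smult m [:-(-1/m), 1:]" by simp
  then have "[:1, m:] = smult m (\<Prod>a\<leftarrow>[-1/m]. [:-a, 1:])" by simp
  then show ?thesis unfolding real_rooted_def by blast
qed

lemma poly_cpoly_of_real: "poly (map_poly complex_of_real p) (of_real x) = of_real (poly p x)"
  by (induction p) (simp_all add: map_poly_pCons)

abbreviation cpoly :: "real poly \<Rightarrow> complex poly" where
  "cpoly p \<equiv> map_poly complex_of_real p"

lemma cpoly_mult: "cpoly (p * q) = cpoly p * cpoly q"
  by (intro poly_eqI) (simp add: coeff_map_poly coeff_mult)

lemma cpoly_add: "cpoly (p + q) = cpoly p + cpoly q"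
  by (intro poly_eqI) (simp add: coeff_map_poly)

lemma cpoly_smult: "cpoly (smult c p) = smult (of_real c) (cpoly p)"
  by (intro poly_eqI) (simp add: coeff_map_poly)

text \<open>Every complex root is real by assumption, so the fundamental theorem of algebra always
  yields a real linear factor to split off; induction on the degree collects them.\<close>

lemma real_rootedI:
  assumes "\<And>z. poly (cpoly p) z = 0 \<Longrightarrow> Im z = 0" "p \<noteq> 0"
  shows "real_rooted p"
  using assms
proof (induction "degree p" arbitrary: p)
  case 0
  then obtain l where "p = [:l:]" by (metis degree_0_id)
  then show ?case by (simp add: real_rooted_const)
next
  case (Suc n)
  have "degree (cpoly p) = Suc n" using Suc.hyps(2) by (simp add: degree_map_poly)
  then have "\<not> constant (poly (cpoly p))" by (simp add: constant_degree)
  then obtain z where z: "poly (cpoly p) z = 0" using fundamental_theorem_of_algebra by blast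
  then have "z = of_real (Re z)" using Suc.prems(1) complex_eq_iff by force
  then have "poly p (Re z) = 0" using z by (metis of_real_eq_0_iff poly_cpoly_of_real)
  then obtain q where q: "p = [:- Re z, 1:] * q" using poly_eq_0_iff_dvd by blast
  have "q \<noteq> 0" using q Suc.prems(2) by auto
  then have "degree p = Suc (degree q)" unfolding q by (subst degree_mult_eq) auto
  then have "n = degree q" using Suc.hyps(2) by simp
  moreover have "Im z = 0" if "poly (cpoly q) z = 0" for z
    using that Suc.prems(1)[of z] unfolding q cpoly_mult poly_mult by simp
  ultimately have "real_rooted q" using Suc.hyps(1) \<open>q \<noteq> 0\<close> by blast
  then show ?case unfolding q by (intro real_rooted_mult real_rooted_linear)
qed

text \<open>Gauss--Lucas: off the real axis the logarithmic derivative \<open>\<Sum> 1/(z - a)\<close> is not real.\<close>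

lemma log_deriv_off_real_axis:
  assumes "Im z \<noteq> 0"
  shows "\<exists>w. poly (cpoly (pderiv (\<Prod>a\<leftarrow>as. [:-a, 1:]))) z = poly (cpoly (\<Prod>a\<leftarrow>as. [:-a, 1:])) z * w \<and>
    (if as = [] then w = 0 else Im w * Im z < 0)"
proof (induction as)
  case Nil then show ?case by simp
next
  case (Cons a as)
  then obtain w where w: "poly (cpoly (pderiv (\<Prod>a\<leftarrow>as. [:-a, 1:]))) z = poly (cpoly (\<Prod>a\<leftarrow>as. [:-a, 1:])) z * w"
    "if as = [] then w = 0 else Im w * Im z < 0" by blast
  let ?d = "z - of_real a"
  have d: "?d \<noteq> 0" using assms by (auto simp: complex_eq_iff)
  have "Im (1 / ?d) = - Im z / (cmod ?d)^2"
    by (simp add: Im_divide cmod_def)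
  then have "Im (1 / ?d) * Im z = - (Im z ^ 2 / (cmod ?d)^2)"
    by (simp add: power2_eq_square)
  also have "\<dots> < 0" using assms d by simp
  finally have *: "Im (1 / ?d + w) * Im z < 0"
    using w(2) by (auto simp: distrib_right split: if_splits)
  have lin: "poly (cpoly [:-a, 1:]) z = ?d" by (simp add: map_poly_pCons)
  have "pderiv [:-a, 1:] = 1" by (simp add: pderiv_pCons one_pCons)
  then have "poly (cpoly (pderiv (\<Prod>a\<leftarrow>a # as. [:-a, 1:]))) z
      = poly (cpoly (\<Prod>a\<leftarrow>as. [:-a, 1:])) z + ?d * poly (cpoly (pderiv (\<Prod>a\<leftarrow>as. [:-a, 1:]))) z"
    using lin by (simp add: pderiv_mult cpoly_add cpoly_mult del: mult_pCons_left)
  also have "\<dots> = poly (cpoly (\<Prod>a\<leftarrow>a # as. [:-a, 1:])) z * (1 / ?d + w)"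
  proof -
    have "p + ?d * (p * w) = ?d * p * (1 / ?d + w)" for p using d by (simp add: distrib_left)
    then show ?thesis using lin w(1) by (simp add: cpoly_mult del: mult_pCons_left)
  qed
  finally show ?case using * by (intro exI[of _ "1 / ?d + w"]) simp
qed

text \<open>The polynomial factor of the derivative of \<open>exp (c x) q\<close>.\<close>

definition exp_pderiv :: "real \<Rightarrow> real poly \<Rightarrow> real poly" where
  "exp_pderiv c q = smult c q + pderiv q"

text \<open>At a non-real \<open>z\<close> the value is \<open>q(z) (c + w)\<close> with
  \<open>w\<close> the logarithmic derivative of \<open>q\<close>. Since \<open>w\<close> is not
  real and \<open>c\<close> is, nothing cancels.\<close>

lemma real_rooted_exp_pderiv:
  assumes "real_rooted q"
  shows "real_rooted (exp_pderiv c q)"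
proof -
  obtain l as where q: "q = smult l (\<Prod>a\<leftarrow>as. [:-a, 1:])"
    using assms by (auto simp: real_rooted_def)
  show ?thesis
  proof (cases "as = [] \<or> l = 0")
    \<comment> \<open>For a constant \<open>q\<close> the logarithmic derivative is zero instead of
      non-real. The result is a constant, possibly zero, and \<open>real_rooted\<close> admits the
      zero polynomial through \<open>l = 0\<close>.\<close>
    case True
    then have "exp_pderiv c q = [:c * l:]" using q by (auto simp: exp_pderiv_def pderiv_smult)
    then show ?thesis by (simp only: real_rooted_const)
  next
    case False
    define p where "p = (\<Prod>a\<leftarrow>as. [:-a, 1:])"
    have nz: "poly (cpoly p) z \<noteq> 0" if "Im z \<noteq> 0" for z
      using that unfolding p_def
    proof (induction as)
      case (Cons a as)
      moreover have "poly (cpoly [:-a, 1:]) z \<noteq> 0" using that by (auto simp: map_poly_pCons complex_eq_iff)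
      ultimately show ?case by (simp add: cpoly_mult del: mult_pCons_left)
    qed simp
    have eq: "exp_pderiv c q = smult l (smult c p + pderiv p)"
      using q by (simp add: exp_pderiv_def p_def pderiv_smult smult_add_right mult.commute)
    have root: "poly (cpoly (exp_pderiv c q)) z \<noteq> 0" if z: "Im z \<noteq> 0" for z
    proof -
      obtain w where w: "poly (cpoly (pderiv p)) z = poly (cpoly p) z * w" "Im w * Im z < 0"
        using log_deriv_off_real_axis[OF z, of as] False unfolding p_def by auto
      have "poly (cpoly (exp_pderiv c q)) z = of_real l * (poly (cpoly p) z * (of_real c + w))"
        using w(1) by (simp add: eq cpoly_smult cpoly_add algebra_simps)
      moreover have "of_real c + w \<noteq> 0" using w(2) by (auto simp: complex_eq_iff)
      ultimately show ?thesis using False nz[OF z] by simp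
    qed
    have "exp_pderiv c q \<noteq> 0" using root[of \<i>] by auto
    then show ?thesis using root by (intro real_rootedI) auto
  qed
qed

text \<open>For \<open>q = l \<Prod> (x - a)\<close> the difference of the two sides is
  \<open>q^2 \<Sum> 1 / (x - a)^2\<close> away from the roots. The induction is the division-free
  form of this: a further factor \<open>x - a\<close> turns the defect \<open>D\<close> of
  \<open>r\<close> into \<open>r^2 + (x - a)^2 D\<close>.\<close>

lemma real_rooted_laguerre:
  assumes "real_rooted q"
  shows "poly q x * poly (pderiv (pderiv q)) x \<le> (poly (pderiv q) x)\<^sup>2"
proof -
  have *: "poly q x * poly (pderiv (pderiv q)) x \<le> (poly (pderiv q) x)\<^sup>2"
    if "q = (\<Prod>a\<leftarrow>as. [:-a, 1:])" for as q
    using that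
  proof (induction as arbitrary: q)
    case Nil then show ?case by simp
  next
    case (Cons a as)
    define r where "r = (\<Prod>a\<leftarrow>as. [:-a, 1:])"
    have p1: "pderiv [:-a, 1:] = 1" by (simp add: pderiv_pCons one_pCons)
    have q: "q = [:-a, 1:] * r" using Cons.prems by (simp add: r_def)
    have q1: "pderiv q = r + [:-a, 1:] * pderiv r" unfolding q by (simp add: pderiv_mult p1 del: mult_pCons_left)
    have q2: "pderiv (pderiv q) = pderiv r + pderiv r + [:-a, 1:] * pderiv (pderiv r)"
      unfolding q1 by (simp add: pderiv_mult pderiv_add p1 del: mult_pCons_left)
    have "(poly (pderiv q) x)\<^sup>2 - poly q x * poly (pderiv (pderiv q)) x = (poly r x)\<^sup>2 +
        (x - a)\<^sup>2 * ((poly (pderiv r) x)\<^sup>2 - poly r x * poly (pderiv (pderiv r)) x)"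
    proof -
      have lin: "poly [:-a, 1:] x = x - a" by simp
      have gen: "(r0 + y * r1)\<^sup>2 - y * r0 * (r1 + r1 + y * r2) = r0\<^sup>2 + y\<^sup>2 * (r1\<^sup>2 - r0 * r2)"
        for r0 r1 r2 y :: real by (simp add: power2_eq_square algebra_simps)
      have "poly q x = (x - a) * poly r x" unfolding q by (simp add: algebra_simps)
      moreover have "poly (pderiv q) x = poly r x + (x - a) * poly (pderiv r) x"
        unfolding q1 by (simp add: algebra_simps)
      moreover have "poly (pderiv (pderiv q)) x
          = poly (pderiv r) x + poly (pderiv r) x + (x - a) * poly (pderiv (pderiv r)) x"
        unfolding q2 by (simp add: algebra_simps)
      ultimately show ?thesis by (simp only: gen)
    qed
    moreover have "(poly (pderiv r) x)\<^sup>2 - poly r x * poly (pderiv (pderiv r)) x \<ge> 0"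
      using Cons.IH[OF r_def] by simp
    ultimately show ?case by (smt (verit) mult_nonneg_nonneg zero_le_power2)
  qed
  obtain l as where q: "q = smult l (\<Prod>a\<leftarrow>as. [:-a, 1:])"
    using assms by (auto simp: real_rooted_def)
  show ?thesis unfolding q using mult_left_mono[OF *[OF refl, of as], of "l\<^sup>2"]
    by (simp add: pderiv_smult power2_eq_square mult_ac)
qed

text \<open>Taylor's formula: \<open>m!\<close> times the coefficient is the \<open>m\<close>-th
  derivative at \<open>0\<close>, and each differentiation replaces \<open>q\<close> by
  \<open>exp_pderiv c q\<close> behind the same exponential.\<close>

lemma exp_pderiv_nth:
  "fact m * fps_nth (fps_exp c * fps_of_poly q) m = poly ((exp_pderiv c ^^ m) q) 0"
proof (induction m arbitrary: q)
  case 0 then show ?case by (simp add: poly_0_coeff_0)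
next
  case (Suc m)
  have "fps_deriv (fps_exp c * fps_of_poly q) = fps_exp c * fps_of_poly (exp_pderiv c q)"
    by (simp add: exp_pderiv_def fps_of_poly_pderiv fps_of_poly_add fps_of_poly_smult algebra_simps)
  then have "real (Suc m) * fps_nth (fps_exp c * fps_of_poly q) (Suc m) = fps_nth (fps_exp c * fps_of_poly (exp_pderiv c q)) m"
    by (metis fps_deriv_nth of_nat_Suc Suc_eq_plus1 of_nat_add of_nat_1)
  then have "fact (Suc m) * fps_nth (fps_exp c * fps_of_poly q) (Suc m) = fact m * fps_nth (fps_exp c * fps_of_poly (exp_pderiv c q)) m"
    by (metis fact_Suc mult.assoc mult.left_commute)
  then show ?case by (simp only: Suc funpow_Suc_right o_def)
qed

text \<open>Newton's inequality, from the Laguerre inequality for the \<open>m\<close>-th derivative of the generating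
  function, which is again \<open>exp\<close> times a real-rooted polynomial.\<close>

lemma wgen_newton:
  assumes "finite I"
  shows "real (Suc (Suc m)) * (fps_nth (wgen c \<mu> I) m * fps_nth (wgen c \<mu> I) (Suc (Suc m)))
     \<le> real (Suc m) * (fps_nth (wgen c \<mu> I) (Suc m))\<^sup>2"
proof -
  define q where "q = (\<Prod>j\<in>I. [:1, \<mu> j:])"
  have "real_rooted q" unfolding q_def using assms
    by (induction I rule: finite_induct)
      (simp_all add: real_rooted_mult real_rooted_affine del: mult_pCons_left,
       simp add: one_pCons real_rooted_const)
  then have rr: "real_rooted ((exp_pderiv c ^^ m) q)"
    by (induction m) (simp_all add: real_rooted_exp_pderiv)
  have g: "wgen c \<mu> I = fps_exp c * fps_of_poly q"
    unfolding wgen_def q_def by (simp add: fps_of_poly_prod fps_of_poly_pCons algebra_simps)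
  let ?f = "wgen c \<mu> I"
  define r where "r = (exp_pderiv c ^^ m) q"
  have f0: "poly r 0 = fact m * fps_nth ?f m"
    by (simp only: g exp_pderiv_nth r_def)
  have f1: "poly (exp_pderiv c r) 0 = fact (Suc m) * fps_nth ?f (Suc m)"
    by (simp only: g exp_pderiv_nth r_def) simp
  have f2: "poly (exp_pderiv c (exp_pderiv c r)) 0 = fact (Suc (Suc m)) * fps_nth ?f (Suc (Suc m))"
    by (simp only: g exp_pderiv_nth r_def) simp
  \<comment> \<open>The Laguerre expression \<open>y'^2 - y y''\<close> at \<open>0\<close> is the
    same for \<open>exp (c x) r\<close> as for \<open>r\<close>, since the terms with
    \<open>c\<close> cancel.\<close>
  have "(poly (exp_pderiv c r) 0)\<^sup>2 - poly r 0 * poly (exp_pderiv c (exp_pderiv c r)) 0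
     = (poly (pderiv r) 0)\<^sup>2 - poly r 0 * poly (pderiv (pderiv r)) 0"
    by (simp add: exp_pderiv_def pderiv_add pderiv_smult power2_eq_square algebra_simps)
  then have "poly r 0 * poly (exp_pderiv c (exp_pderiv c r)) 0 \<le> (poly (exp_pderiv c r) 0)\<^sup>2"
    using real_rooted_laguerre[OF rr[folded r_def], of 0] by linarith
  \<comment> \<open>The factorials of \<open>m\<close>, \<open>m + 1\<close> and
    \<open>m + 2\<close> share the factor \<open>m!^2 (m + 1)\<close>; after its removal the weights
    \<open>m + 2\<close> and \<open>m + 1\<close> remain.\<close>
  then have "(fact m * fact m * real (Suc m)) * (real (Suc (Suc m)) * (fps_nth ?f m * fps_nth ?f (Suc (Suc m))))
     \<le> (fact m * fact m * real (Suc m)) * (real (Suc m) * (fps_nth ?f (Suc m))\<^sup>2)"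
    unfolding f0 f1 f2 by (simp add: power2_eq_square mult_ac)
  then show ?thesis by (rule mult_left_le_imp_le) simp
qed

text \<open>With \<open>s_i\<close> for the reduced family, the full one has
  \<open>s_{i+1} + \<mu>_j s_i\<close> in degree \<open>i + 1\<close>. If \<open>s_m > 0\<close> but
  \<open>s_{m+1} \<le> 0\<close>, positivity in degree \<open>m + 1\<close> makes
  \<open>\<mu>_j s_m\<close> exceed \<open>- s_{m+1}\<close>, and positivity in degree
  \<open>m + 2\<close> then gives \<open>s_m s_{m+2} > s_{m+1}^2\<close>, against Newton's
  inequality. Reaching up to degree \<open>m + 2\<close> is why one order is lost.\<close>

lemma wgen_cone_remove:
  assumes "finite I" "j \<notin> I"
    and pos: "\<And>i. 1 \<le> i \<Longrightarrow> i \<le> k \<Longrightarrow> fps_nth (wgen c \<mu> (insert j I)) i > 0"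
    and "m < k"
  shows "fps_nth (wgen c \<mu> I) m > 0"
  using \<open>m < k\<close>
proof (induction m)
  case 0 then show ?case using assms by (simp add: wgen_nth_0)
next
  case (Suc m)
  let ?s = "\<lambda>i. fps_nth (wgen c \<mu> I) i"
  have eq: "fps_nth (wgen c \<mu> (insert j I)) (Suc i) = ?s (Suc i) + \<mu> j * ?s i" for i
    using assms(1,2) by (simp add: wgen_insert distrib_right mult.assoc)
  have s0: "?s m > 0" using Suc by simp
  show ?case
  proof (rule ccontr)
    assume neg: "\<not> ?s (Suc m) > 0"
    have p1: "?s (Suc m) + \<mu> j * ?s m > 0" using pos[of "Suc m"] Suc.prems eq by simp
    have p2: "?s (Suc (Suc m)) + \<mu> j * ?s (Suc m) > 0" using pos[of "Suc (Suc m)"] Suc.prems eq by simp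
    have "?s m * ?s (Suc (Suc m)) > ?s m * (- \<mu> j * ?s (Suc m))"
      using p2 s0 by (intro mult_strict_left_mono) auto
    moreover have "?s m * (- \<mu> j * ?s (Suc m)) = (- ?s (Suc m)) * (\<mu> j * ?s m)" by simp
    moreover have "(- ?s (Suc m)) * (\<mu> j * ?s m) \<ge> (- ?s (Suc m)) * (- ?s (Suc m))"
      using p1 neg by (intro mult_left_mono) auto
    ultimately have "?s m * ?s (Suc (Suc m)) > (- ?s (Suc m)) * (- ?s (Suc m))" by linarith
    then have gt: "?s m * ?s (Suc (Suc m)) > (?s (Suc m))\<^sup>2" by (simp add: power2_eq_square)
    have "real (Suc m) * (?s (Suc m))\<^sup>2 \<le> real (Suc (Suc m)) * (?s (Suc m))\<^sup>2"
      by (intro mult_right_mono) auto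
    also have "\<dots> < real (Suc (Suc m)) * (?s m * ?s (Suc (Suc m)))"
      using gt by (intro mult_strict_left_mono) auto
    finally show False using wgen_newton[OF assms(1), of m c \<mu>] by linarith
  qed
qed

section \<open>Simultaneous diagonalization\<close>

lemma inner_matrix_symmetric:
  fixes S :: "real^'n^'n"
  assumes "transpose S = S"
  shows "x \<bullet> (S *v y) = y \<bullet> (S *v x)"
  by (metis assms dot_lmul_matrix inner_commute transpose_matrix_vector)

lemma transpose_matrix_matrix_nth:
  fixes M :: "real^'n^'n"
  shows "(transpose A ** M ** B) $ i $ j = column i A \<bullet> (M *v column j B)"
  unfolding matrix_mul_assoc[symmetric]
  by (simp add: matrix_matrix_mult_def transpose_def column_def inner_vec_def matrix_vector_mult_def)

text \<open>First-order optimality at \<open>t = 0\<close>, where the expression attains its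
  maximum.\<close>

lemma quadratic_nonpos_imp_linear_zero:
  fixes a b :: real
  assumes "\<And>t. t * b + t\<^sup>2 * a \<le> 0"
  shows "b = 0"
proof (rule ccontr)
  assume b: "b \<noteq> 0"
  \<comment> \<open>Small enough for the linear term to win: with this \<open>t\<close> the
    expression equals \<open>t^2 (1 + |a| + a)\<close>.\<close>
  let ?t = "b / (1 + \<bar>a\<bar>)"
  have t: "?t * (1 + \<bar>a\<bar>) = b" by (simp add: abs_add_one_gt_zero)
  have "?t\<^sup>2 * (1 + \<bar>a\<bar>) = ?t * b" using t by (metis power2_eq_square mult.assoc)
  then have "?t * b + ?t\<^sup>2 * a = ?t\<^sup>2 * (1 + \<bar>a\<bar> + a)" by (simp add: distrib_left)
  also have "\<dots> > 0" using b by (intro mult_pos_pos) auto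
  finally show False using assms[of ?t] by linarith
qed

definition pos_def_mat :: "real^'n^'n \<Rightarrow> bool" where
  "pos_def_mat G \<longleftrightarrow> transpose G = G \<and> (\<forall>v. v \<noteq> 0 \<longrightarrow> v \<bullet> (G *v v) > 0)"

text \<open>The next vector maximizes the quotient of the two forms over the \<open>G\<close>-orthogonal complement of
  the vectors found so far.\<close>

lemma simultaneous_eigenvectors:
  fixes G S :: "real^'n^'n"
  assumes "pos_def_mat G" and S: "transpose S = S"
  shows "m \<le> CARD('n) \<Longrightarrow> \<exists>f d. (\<forall>i<m. \<forall>j<m. f i \<bullet> (G *v f j) = (if i = j then 1 else 0)) \<and>
    (\<forall>i<m. S *v f i = d i *\<^sub>R (G *v f i))"
proof (induction m)
  case 0 then show ?case by simp
next
  case (Suc m)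
  have G: "transpose G = G" "\<And>v. v \<noteq> 0 \<Longrightarrow> v \<bullet> (G *v v) > 0"
    using assms by (auto simp: pos_def_mat_def)
  from Suc obtain f d where on: "\<And>i j. i < m \<Longrightarrow> j < m \<Longrightarrow> f i \<bullet> (G *v f j) = (if i = j then 1 else 0)"
    and ev: "\<And>i. i < m \<Longrightarrow> S *v f i = d i *\<^sub>R (G *v f i)" by auto
  define W where "W = {v. \<forall>i<m. v \<bullet> (G *v f i) = 0}"
  have subW: "subspace W"
    unfolding W_def subspace_def by (auto simp: inner_add_left)
  define B where "B = (\<lambda>i. G *v f i) ` {..<m}"
  \<comment> \<open>Fewer than \<open>n\<close> vectors \<open>G *v f i\<close> span a proper
    subspace, so \<open>W\<close> contains a nonzero vector and its unit sphere \<open>K\<close> is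
    nonempty.\<close>
  have "dim B \<le> card B" by (intro dim_le_card') (simp add: B_def)
  also have "\<dots> \<le> m" unfolding B_def by (metis card_image_le card_lessThan finite_lessThan)
  finally have "dim B < DIM(real^'n)" using Suc.prems by simp
  then obtain x where x: "x \<noteq> 0" "\<And>y. y \<in> span B \<Longrightarrow> orthogonal x y"
    using orthogonal_to_subspace_exists by blast
  have xW: "x \<in> W" using x(2) by (auto simp: W_def B_def orthogonal_def span_base)
  define K where "K = sphere 0 1 \<inter> W"
  have "compact K" unfolding K_def by (intro compact_Int_closed closed_subspace subW) simp
  moreover have "x /\<^sub>R norm x \<in> K" using x(1) xW subW by (simp add: K_def subspace_scale)
  moreover have Kpos: "v \<bullet> (G *v v) > 0" if "v \<in> K" for v
    using that by (intro G(2)) (auto simp: K_def)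
  then have "continuous_on K (\<lambda>v. (v \<bullet> (S *v v)) / (v \<bullet> (G *v v)))"
    by (intro continuous_intros linear_continuous_on[unfolded linear_conv_bounded_linear] matrix_vector_mul_bounded_linear) force
  ultimately obtain v where v: "v \<in> K" and
    max: "\<And>w. w \<in> K \<Longrightarrow> (w \<bullet> (S *v w)) / (w \<bullet> (G *v w)) \<le> (v \<bullet> (S *v v)) / (v \<bullet> (G *v v))"
    using continuous_attains_sup[of K "\<lambda>v. (v \<bullet> (S *v v)) / (v \<bullet> (G *v v))"] by blast
  define \<rho> where "\<rho> = (v \<bullet> (S *v v)) / (v \<bullet> (G *v v))"
  \<comment> \<open>The form of \<open>Z\<close> will be at most zero on \<open>W\<close> and zero
    at \<open>v\<close>, so \<open>v\<close> is a maximum of it on \<open>W\<close> and the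
    first-order condition applies.\<close>
  define Z where "Z = S - \<rho> *\<^sub>R G"
  have Z: "Z *v y = S *v y - \<rho> *\<^sub>R (G *v y)" for y
    unfolding Z_def by (simp add: matrix_vector_mult_diff_rdistrib scaleR_matrix_vector_assoc)
  have Zsym: "transpose Z = Z"
    using G(1) S unfolding Z_def by (simp add: transpose_def vec_eq_iff)
  have vW: "v \<in> W" using v by (simp add: K_def)
  have Zv: "v \<bullet> (Z *v v) = 0" using Kpos[OF v] by (simp add: Z inner_diff_right \<rho>_def)
  have neg: "w \<bullet> (Z *v w) \<le> 0" if "w \<in> W" for w
  proof (cases "w = 0")
    case False
    let ?w = "w /\<^sub>R norm w"
    have wK: "?w \<in> K" using False that subW by (simp add: K_def subspace_scale)
    have "(?w \<bullet> (S *v ?w)) \<le> \<rho> * (?w \<bullet> (G *v ?w))"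
      using max[OF wK] Kpos[OF wK] unfolding \<rho>_def[symmetric] pos_divide_le_eq[OF Kpos[OF wK]] by simp
    then have "?w \<bullet> (Z *v ?w) \<le> 0" by (simp add: Z inner_diff_right)
    moreover have "w = norm w *\<^sub>R ?w" using False by simp
    then have "w \<bullet> (Z *v w) = (norm w)\<^sup>2 * (?w \<bullet> (Z *v ?w))"
      using False by (simp add: matrix_vector_mult_scaleR power2_eq_square field_simps)
    ultimately show ?thesis by (simp add: mult_nonneg_nonpos)
  qed simp
  have orthW: "w \<bullet> (Z *v v) = 0" if w: "w \<in> W" for w
  proof -
    have "t * (2 * (w \<bullet> (Z *v v))) + t\<^sup>2 * (w \<bullet> (Z *v w)) \<le> 0" for t
    proof -
      have "(v + t *\<^sub>R w) \<bullet> (Z *v (v + t *\<^sub>R w)) \<le> 0"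
        by (intro neg subspace_add subspace_scale subW vW w)
      then show ?thesis
        using Zv inner_matrix_symmetric[OF Zsym, of v w]
        by (simp add: matrix_vector_right_distrib matrix_vector_mult_scaleR inner_add_left inner_add_right power2_eq_square algebra_simps)
    qed
    then show ?thesis using quadratic_nonpos_imp_linear_zero by fastforce
  qed
  have orthf: "f i \<bullet> (Z *v v) = 0" if "i < m" for i
  proof -
    have "f i \<bullet> (Z *v v) = v \<bullet> (Z *v f i)" by (rule inner_matrix_symmetric[OF Zsym])
    also have "\<dots> = (d i - \<rho>) * (v \<bullet> (G *v f i))" using that by (simp add: Z ev inner_diff_right algebra_simps)
    finally show ?thesis using vW that by (simp add: W_def)
  qed
  have "y \<bullet> (Z *v v) = 0" for y
  proof -
    \<comment> \<open>The \<open>G\<close>-orthogonal projection of \<open>y\<close> onto the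
      vectors found so far; the remainder lies in \<open>W\<close>, and \<open>Z *v v\<close> is
      orthogonal to both parts.\<close>
    define p where "p = (\<Sum>i<m. (y \<bullet> (G *v f i)) *\<^sub>R f i)"
    have "y - p \<in> W"
      unfolding W_def
    proof safe
      fix j assume j: "j < m"
      have "p \<bullet> (G *v f j) = (\<Sum>i<m. (y \<bullet> (G *v f i)) * (if i = j then 1 else 0))"
        unfolding p_def inner_sum_left inner_scaleR_left by (intro sum.cong) (auto simp: on j)
      also have "\<dots> = y \<bullet> (G *v f j)" using j by (simp add: if_distrib cong: if_cong)
      finally show "(y - p) \<bullet> (G *v f j) = 0" by (simp add: inner_diff_left)
    qed
    then have "(y - p) \<bullet> (Z *v v) = 0" by (rule orthW)
    moreover have "p \<bullet> (Z *v v) = 0" by (simp add: p_def inner_sum_left orthf)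
    ultimately show ?thesis by (simp add: inner_diff_left)
  qed
  then have "Z *v v = 0" using inner_eq_zero_iff by blast
  then have Sv: "S *v v = \<rho> *\<^sub>R (G *v v)" by (simp add: Z)
  \<comment> \<open>Compactness called for the Euclidean unit sphere; the length with respect to
    \<open>G\<close> is corrected afterwards.\<close>
  let ?r = "sqrt (v \<bullet> (G *v v))"
  define u where "u = v /\<^sub>R ?r"
  have r: "?r > 0" using Kpos[OF v] by simp
  have uu: "u \<bullet> (G *v u) = 1"
    using r by (simp add: u_def matrix_vector_mult_scaleR field_simps)
  have uf: "u \<bullet> (G *v f i) = 0" "f i \<bullet> (G *v u) = 0" if "i < m" for i
  proof -
    show "u \<bullet> (G *v f i) = 0" using vW that by (simp add: u_def W_def)
    then show "f i \<bullet> (G *v u) = 0" using inner_matrix_symmetric[OF G(1)] by metis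
  qed
  have Su: "S *v u = \<rho> *\<^sub>R (G *v u)" by (simp add: u_def matrix_vector_mult_scaleR Sv)
  show ?case
    by (rule exI[of _ "f(m := u)"], rule exI[of _ "d(m := \<rho>)"])
       (auto simp: less_Suc_eq on ev uu uf Su)
qed

lemma simultaneous_diagonalization:
  fixes G S :: "real^'n^'n"
  assumes "pos_def_mat G" "transpose S = S"
  obtains E and d :: "real^'n" where "transpose E ** G ** E = mat 1"
    "transpose E ** S ** E = (\<chi> i j. if i = j then d $ i else 0)"
proof -
  obtain f d where on: "\<And>i j. i < CARD('n) \<Longrightarrow> j < CARD('n) \<Longrightarrow> f i \<bullet> (G *v f j) = (if i = j then 1 else 0)"
    and ev: "\<And>i. i < CARD('n) \<Longrightarrow> S *v f i = d i *\<^sub>R (G *v f i)"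
    using simultaneous_eigenvectors[OF assms order_refl] by blast
  obtain h :: "'n \<Rightarrow> nat" where h: "bij_betw h UNIV {..<CARD('n)}"
    using ex_bij_betw_finite_nat[of "UNIV :: 'n set"] by (auto simp: lessThan_atLeast0)
  then have hl: "h i < CARD('n)" and hi: "h i = h j \<longleftrightarrow> i = j" for i j
    by (auto simp: bij_betw_def inj_on_eq_iff)
  define E :: "real^'n^'n" where "E = (\<chi> i j. f (h j) $ i)"
  have col: "column j E = f (h j)" for j by (simp add: column_def E_def vec_eq_iff)
  show thesis
  proof (rule that[of E "\<chi> i. d (h i)"])
    show "transpose E ** G ** E = mat 1"
      by (simp add: vec_eq_iff transpose_matrix_matrix_nth col on hl hi mat_def)
    show "transpose E ** S ** E = (\<chi> i j. if i = j then (\<chi> i. d (h i)) $ i else 0)"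
      by (simp add: vec_eq_iff transpose_matrix_matrix_nth col on ev hl hi)
  qed
qed

section \<open>Linearization of the weighted symmetric polynomials\<close>

primrec mat_pow :: "real^'n^'n \<Rightarrow> nat \<Rightarrow> real^'n^'n" where
  "mat_pow P 0 = mat 1"
| "mat_pow P (Suc i) = P ** mat_pow P i"

definition power_sum_coeff :: "real \<Rightarrow> real^'n::finite^'n \<Rightarrow> nat \<Rightarrow> real" where
  "power_sum_coeff c P i = (if i = 0 then c else 0) + (-1)^i * trace (mat_pow P (Suc i))"

text \<open>Newton's identities taken as a definition for an arbitrary matrix. No eigenvalues are
  chosen, and the value is polynomial in \<open>c\<close> and the entries of \<open>P\<close>, which
  gives smoothness and derivatives directly.\<close>

fun trsigma :: "nat \<Rightarrow> real \<Rightarrow> real^'n::finite^'n \<Rightarrow> real" where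
  "trsigma 0 c P = 1"
| "trsigma (Suc k) c P = (\<Sum>i\<le>k. trsigma (k - i) c P * power_sum_coeff c P i) / real (Suc k)"

text \<open>The Newton transformation. Its role is that of a gradient:
  \<open>trace (newton_mat k c P ** P')\<close> is the part of the derivative of
  \<open>trsigma (Suc k)\<close> that comes from \<open>P\<close>.\<close>

definition newton_mat :: "nat \<Rightarrow> real \<Rightarrow> real^'n::finite^'n \<Rightarrow> real^'n^'n" where
  "newton_mat k c P = (\<Sum>i\<le>k. ((-1)^i * trsigma (k - i) c P) *\<^sub>R mat_pow P i)"

definition diag :: "real^'n \<Rightarrow> real^'n^'n" where
  "diag d = (\<chi> i j. if i = j then d $ i else 0)"

lemma diag_mult: "diag x ** diag y = diag (\<chi> i. x $ i * y $ i)"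
proof -
  have "(\<Sum>k\<in>UNIV. (if i = k then x $ i else 0) * (if k = j then y $ k else 0))
     = (\<Sum>k\<in>UNIV. if k = i then (if i = j then x $ i * y $ i else 0) else 0)" for i j
    by (intro sum.cong) auto
  then show ?thesis by (simp add: diag_def matrix_matrix_mult_def vec_eq_iff)
qed

lemma mat_pow_diag: "mat_pow (diag d) i = diag (\<chi> j. d $ j ^ i)"
proof (induction i)
  case 0 show ?case by (simp add: diag_def mat_def vec_eq_iff)
qed (simp add: diag_mult)

lemma trace_diag: "trace (diag d) = (\<Sum>j\<in>UNIV. d $ j)"
  by (simp add: trace_def diag_def)

lemma mat_pow_conj:
  fixes E F :: "real^'n^'n"
  assumes "F ** E = mat 1" "E ** F = mat 1"
  shows "mat_pow (E ** D ** F) i = E ** mat_pow D i ** F"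
proof (induction i)
  case 0 show ?case using assms by simp
next
  case (Suc i)
  have "mat_pow (E ** D ** F) (Suc i) = E ** D ** (F ** E) ** mat_pow D i ** F"
    by (simp add: Suc matrix_mul_assoc)
  then show ?case using assms by (simp add: matrix_mul_assoc)
qed

lemma trace_mat_pow_conj:
  fixes E F :: "real^'n^'n"
  assumes "F ** E = mat 1" "E ** F = mat 1"
  shows "trace (mat_pow (E ** D ** F) i) = trace (mat_pow D i)"
  unfolding mat_pow_conj[OF assms]
  by (subst trace_mul_sym) (simp add: matrix_mul_assoc assms)

text \<open>Only traces of powers enter. This makes the operator insensitive to a change of
  coordinates, which acts on the endomorphism by conjugation.\<close>

lemma trsigma_conj:
  fixes E F :: "real^'n^'n"
  assumes "F ** E = mat 1" "E ** F = mat 1"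
  shows "trsigma k c (E ** D ** F) = trsigma k c D"
proof (induction k rule: less_induct)
  case (less k)
  have "power_sum_coeff c (E ** D ** F) i = power_sum_coeff c D i" for i
    by (simp only: power_sum_coeff_def trace_mat_pow_conj[OF assms])
  then show ?case using less by (cases k) simp_all
qed

lemma wsigma_eq_trsigma:
  fixes \<mu> :: "real^'n::finite"
  assumes "\<And>i. trace (mat_pow P i) = (\<Sum>j\<in>UNIV. \<mu> $ j ^ i)"
  shows "wsigma k c \<mu> = trsigma k c P"
proof (induction k rule: less_induct)
  case (less k)
  show ?case
  proof (cases k)
    case (Suc m)
    have p0: "power_sum_coeff c P 0 = c + (\<Sum>j\<in>UNIV. \<mu> $ j)"
      unfolding power_sum_coeff_def assms by simp
    have pi: "trsigma (m - i) c P * power_sum_coeff c P i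
        = (\<Sum>j\<in>UNIV. (-1)^i * wsigma (m - i) c \<mu> * (\<mu> $ j)^(i+1))" if "i \<in> {1..m}" for i
      using that less Suc unfolding power_sum_coeff_def assms by (simp add: sum_distrib_left mult_ac)
    have "(\<Sum>i\<le>m. trsigma (m - i) c P * power_sum_coeff c P i)
       = trsigma m c P * power_sum_coeff c P 0 + (\<Sum>i=1..m. trsigma (m - i) c P * power_sum_coeff c P i)"
      by (simp add: atMost_atLeast0 sum.atLeast_Suc_atMost)
    also have "(\<Sum>i=1..m. trsigma (m - i) c P * power_sum_coeff c P i)
       = (\<Sum>i=1..m. \<Sum>j\<in>UNIV. (-1)^i * wsigma (m - i) c \<mu> * (\<mu> $ j)^(i+1))"
      by (intro sum.cong refl pi)
    also have "trsigma m c P * power_sum_coeff c P 0 = wsigma m c \<mu> * (c + (\<Sum>j\<in>UNIV. \<mu> $ j))"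
      using less Suc by (simp add: p0)
    finally show ?thesis using Suc by simp
  qed simp
qed

text \<open>The eigenvalue list behind \<open>wsigma_end\<close> is picked by \<open>SOME\<close>.
  Any two candidates have the same characteristic polynomial, hence the same multiset of roots,
  hence equal sums over them.\<close>

lemma eigenvalues_sum_eq:
  assumes "eigenvalues P \<mu>" "eigenvalues P \<nu>"
  shows "(\<Sum>j\<in>UNIV. (f (\<mu> $ j) :: real)) = (\<Sum>j\<in>UNIV. f (\<nu> $ j))"
proof -
  define p where "p \<mu> = (\<Prod>j\<in>UNIV. [:- (\<mu> $ j), 1:])" for \<mu> :: "real^'a"
  have "poly (p \<mu>) t = poly (p \<nu>) t" for t
    using assms by (simp add: eigenvalues_def p_def poly_prod)
  then have "p \<mu> = p \<nu>" by (simp add: poly_eq_poly_eq_iff[symmetric] fun_eq_iff)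
  moreover have "proots (p \<mu>) = image_mset (\<lambda>j. \<mu> $ j) (mset_set UNIV)" for \<mu> :: "real^'a"
  proof -
    have "proots (p \<mu>) = (\<Sum>j\<in>UNIV. {#\<mu> $ j#})" unfolding p_def by (subst proots_prod) auto
    also have "\<dots> = image_mset (\<lambda>j. \<mu> $ j) (mset_set UNIV)"
      by (simp add: sum_unfold_sum_mset)
    finally show ?thesis .
  qed
  ultimately have "image_mset (\<lambda>j. \<mu> $ j) (mset_set UNIV) = image_mset (\<lambda>j. \<nu> $ j) (mset_set UNIV)"
    by metis
  then have "image_mset f (image_mset (\<lambda>j. \<mu> $ j) (mset_set UNIV)) = image_mset f (image_mset (\<lambda>j. \<nu> $ j) (mset_set UNIV))"
    by simp
  then show ?thesis by (simp add: sum_unfold_sum_mset multiset.map_comp o_def)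
qed

lemma bounded_bilinear_matrix_mult: "bounded_bilinear ((**) :: real^'n^'m \<Rightarrow> real^'p^'n \<Rightarrow> real^'p^'m)"
proof -
  have "bilinear ((**) :: real^'n^'m \<Rightarrow> real^'p^'n \<Rightarrow> real^'p^'m)"
    unfolding bilinear_def
    by (intro conjI allI linearI)
      (simp_all add: matrix_add_ldistrib vec_eq_iff matrix_matrix_mult_def sum.distrib sum_distrib_left distrib_right distrib_left mult_ac)
  then show ?thesis by (simp add: bilinear_conv_bounded_bilinear)
qed

lemma eigenvalues_conj_diag:
  fixes E F :: "real^'n^'n"
  assumes "F ** E = mat 1" "E ** F = mat 1"
  shows "eigenvalues (E ** diag d ** F) d"
  unfolding eigenvalues_def
proof
  fix t
  have "mat t = E ** mat t ** F"
  proof -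
    have "mat t = t *\<^sub>R (mat 1 :: real^'n^'n)" by (simp add: mat_def vec_eq_iff)
    then show ?thesis using assms
      by (simp add: bounded_bilinear.scaleR_left[OF bounded_bilinear_matrix_mult]
          bounded_bilinear.scaleR_right[OF bounded_bilinear_matrix_mult])
  qed
  then have "mat t - E ** diag d ** F = E ** (mat t - diag d) ** F"
    by (simp add: bounded_bilinear.diff_left[OF bounded_bilinear_matrix_mult]
        bounded_bilinear.diff_right[OF bounded_bilinear_matrix_mult])
  then have "det (mat t - E ** diag d ** F) = (det E * det F) * det (mat t - diag d)"
    by (simp add: det_mul mult_ac)
  also have "det E * det F = 1" using assms by (metis det_I det_mul)
  also have "det (mat t - diag d) = (\<Prod>j\<in>UNIV. t - d $ j)"
    by (subst det_diagonal) (auto simp: mat_def diag_def)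
  finally show "det (mat t - E ** diag d ** F) = (\<Prod>j\<in>UNIV. t - d $ j)" by simp
qed

lemma matrix_inv_unique:
  fixes A B :: "real^'n^'n"
  assumes "A ** B = mat 1" "B ** A = mat 1"
  shows "matrix_inv A = B"
proof -
  have "A ** matrix_inv A = mat 1 \<and> matrix_inv A ** A = mat 1"
    unfolding matrix_inv_def by (rule someI[of _ B]) (use assms in simp)
  then have "B = B ** A ** matrix_inv A" by (simp add: matrix_mul_assoc[symmetric])
  then show ?thesis using assms by simp
qed

lemma matrix_inv_inverse:
  fixes A :: "real^'n^'n"
  assumes "invertible A"
  shows "A ** matrix_inv A = mat 1" "matrix_inv A ** A = mat 1"
  using assms matrix_inv_unique unfolding invertible_def by metis+

text \<open>From \<open>E^T G E = 1\<close> the matrix \<open>F = E^T G\<close> is the inverse of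
  \<open>E\<close>, so the congruence that diagonalizes \<open>S\<close> becomes a similarity that
  diagonalizes \<open>G^-1 S\<close>. The last identity will turn \<open>E D F G^-1\<close> into the
  congruence \<open>E D E^T\<close>, the shape that fits a quadratic form.\<close>

lemma self_adjoint_normal_form:
  fixes G S :: "real^'n^'n"
  assumes "pos_def_mat G" "transpose S = S"
  obtains E F :: "real^'n^'n" and d :: "real^'n" where "F ** E = mat 1" "E ** F = mat 1" "matrix_inv G = E ** transpose E"
    "matrix_inv G ** S = E ** diag d ** F" "F ** matrix_inv G = transpose E"
proof -
  obtain E and d :: "real^'n" where E: "transpose E ** G ** E = mat 1" "transpose E ** S ** E = diag d"
    by (rule simultaneous_diagonalization[OF assms, folded diag_def]) blast
  define F where "F = transpose E ** G"
  have FE: "F ** E = mat 1" using E(1) by (simp add: F_def)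
  then have EF: "E ** F = mat 1" using matrix_left_right_inverse by blast
  then have 1: "(E ** transpose E) ** G = mat 1" by (simp add: F_def matrix_mul_assoc)
  then have 2: "G ** (E ** transpose E) = mat 1" using matrix_left_right_inverse by blast
  have inv: "matrix_inv G = E ** transpose E" by (rule matrix_inv_unique[OF 2 1])
  have "matrix_inv G ** S = E ** (transpose E ** S ** E) ** F"
    by (simp add: inv matrix_mul_assoc[symmetric] EF)
  then have 3: "matrix_inv G ** S = E ** diag d ** F" by (simp only: E(2))
  have "F ** matrix_inv G = (F ** E) ** transpose E" by (simp add: inv matrix_mul_assoc)
  then have "F ** matrix_inv G = transpose E" by (simp add: FE)
  then show thesis using that FE EF inv 3 by blast
qed

lemma trace_mat_pow_conj_diag:
  fixes E F :: "real^'n^'n"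
  assumes "F ** E = mat 1" "E ** F = mat 1"
  shows "trace (mat_pow (E ** diag d ** F) i) = (\<Sum>j\<in>UNIV. d $ j ^ i)"
  unfolding trace_mat_pow_conj[OF assms] mat_pow_diag trace_diag by simp

text \<open>The diagonal entries \<open>d\<close> show that a list of eigenvalues exists, so the
  \<open>SOME\<close> term really is one, and its power sums agree with those of
  \<open>d\<close>.\<close>

lemma wsigma_end_eq_trsigma:
  fixes G S :: "real^'n^'n"
  assumes "pos_def_mat G" "transpose S = S"
  shows "wsigma_end k c (matrix_inv G ** S) = trsigma k c (matrix_inv G ** S)"
proof -
  obtain E F :: "real^'n^'n" and d :: "real^'n" where EF: "F ** E = mat 1" "E ** F = mat 1" "matrix_inv G ** S = E ** diag d ** F"
    by (rule self_adjoint_normal_form[OF assms])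
  let ?\<mu> = "SOME \<mu>. eigenvalues (matrix_inv G ** S) \<mu>"
  have d: "eigenvalues (matrix_inv G ** S) d" unfolding EF(3) by (rule eigenvalues_conj_diag[OF EF(1,2)])
  then have \<mu>: "eigenvalues (matrix_inv G ** S) ?\<mu>" by (rule someI)
  show ?thesis unfolding wsigma_end_def
  proof (rule wsigma_eq_trsigma)
    fix i
    have "trace (mat_pow (matrix_inv G ** S) i) = (\<Sum>j\<in>UNIV. d $ j ^ i)"
      unfolding EF(3) by (rule trace_mat_pow_conj_diag[OF EF(1,2)])
    also have "\<dots> = (\<Sum>j\<in>UNIV. ?\<mu> $ j ^ i)" by (rule eigenvalues_sum_eq[OF d \<mu>])
    finally show "trace (mat_pow (matrix_inv G ** S) i) = (\<Sum>j\<in>UNIV. ?\<mu> $ j ^ i)" .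
  qed
qed

section \<open>Derivatives of traces and of the polynomials\<close>

lemma bounded_linear_trace: "bounded_linear (trace :: real^'n^'n \<Rightarrow> real)"
  unfolding linear_conv_bounded_linear[symmetric]
  by (intro linearI) (simp_all add: trace_def sum.distrib sum_distrib_left)

lemma mat_pow_add: "mat_pow P (i + j) = mat_pow P i ** mat_pow P j"
  by (induction i) (simp_all add: matrix_mul_assoc[symmetric])

lemma mat_pow_Suc_right: "mat_pow P (Suc i) = mat_pow P i ** P"
  using mat_pow_add[of P i 1] by simp

text \<open>\<open>P\<close> and \<open>P'\<close> need not commute, so the derivative of
  \<open>P^n\<close> is a sum of words \<open>P^a P' P^b\<close>. Under the trace all of them become
  equal by cyclicity.\<close>

lemma has_derivative_trace_mat_pow:
  fixes P :: "real \<Rightarrow> real^'n^'n"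
  assumes P: "(P has_vector_derivative P') (at x)"
  shows "((\<lambda>t. trace (mat_pow (P t) (Suc i))) has_real_derivative
     real (Suc i) * trace (mat_pow (P x) i ** P')) (at x)"
proof -
  define D where "D = rec_nat 0 (\<lambda>n d. P x ** d + P' ** mat_pow (P x) n)"
  have D: "D 0 = 0" "D (Suc n) = P x ** D n + P' ** mat_pow (P x) n" for n
    by (simp_all add: D_def)
  have der: "((\<lambda>t. mat_pow (P t) n) has_vector_derivative D n) (at x)" for n
  proof (induction n)
    case 0 show ?case by (simp add: D)
  next
    case (Suc n)
    show ?case unfolding D mat_pow.simps
      by (rule bounded_bilinear.has_vector_derivative[OF bounded_bilinear_matrix_mult P Suc])
  qed
  \<comment> \<open>The left factor \<open>P^m\<close> is carried along because each step of the
    recursion moves one \<open>P\<close> into it. For \<open>n = 0\<close> the truncated exponent is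
    harmless, since \<open>real n\<close> vanishes.\<close>
  have tr: "trace (mat_pow (P x) m ** D n) = real n * trace (mat_pow (P x) (m + n - 1) ** P')" for m n
  proof (induction n arbitrary: m)
    case 0 show ?case by (simp add: D matrix_matrix_mult_def trace_def)
  next
    case (Suc n)
    have "trace (mat_pow (P x) m ** P' ** mat_pow (P x) n) = trace (mat_pow (P x) (m + n) ** P')"
      by (subst trace_mul_sym) (simp add: matrix_mul_assoc mat_pow_add[symmetric] add.commute)
    moreover have "mat_pow (P x) m ** (P x ** D n) = mat_pow (P x) (Suc m) ** D n"
      by (simp add: mat_pow_Suc_right matrix_mul_assoc del: mat_pow.simps(2))
    ultimately show ?case unfolding D
      using Suc[of "Suc m"]
      by (simp add: matrix_add_ldistrib trace_add matrix_mul_assoc[symmetric] algebra_simps del: mat_pow.simps(2))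
  qed
  have "((\<lambda>t. trace (mat_pow (P t) (Suc i))) has_real_derivative trace (D (Suc i))) (at x)"
    unfolding has_real_derivative_iff_has_vector_derivative
    by (rule bounded_linear.has_vector_derivative[OF bounded_linear_trace der])
  then show ?thesis using tr[of 0 "Suc i"] by (simp del: mat_pow.simps(2))
qed

lemma newton_mat_trace:
  "trace (newton_mat k c P ** B) = (\<Sum>i\<le>k. trsigma (k - i) c P * ((-1)^i * trace (mat_pow P i ** B)))"
proof -
  interpret l: bounded_linear "\<lambda>A. trace (A ** B)"
    by (intro bounded_linear_compose[OF bounded_linear_trace] bounded_bilinear.bounded_linear_left bounded_bilinear_matrix_mult)
  show ?thesis unfolding newton_mat_def l.sum l.scale by (intro sum.cong) auto
qed

text \<open>With \<open>F(X) = \<Sum> \<sigma>\<^sub>k X\<^sup>k\<close> and \<open>F' = F N\<close>, the variation of \<open>F\<close> is \<open>F B\<close> where \<open>B' = \<delta>N\<close>.\<close>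

lemma has_derivative_trsigma:
  fixes P :: "real \<Rightarrow> real^'n^'n"
  assumes P: "(P has_vector_derivative P') (at x)" and c: "(c has_real_derivative c') (at x)"
  shows "((\<lambda>t. trsigma (Suc k) (c t) (P t)) has_real_derivative
     trsigma k (c x) (P x) * c' + trace (newton_mat k (c x) (P x) ** P')) (at x)"
proof -
  define F where "F = Abs_fps (\<lambda>k. trsigma k (c x) (P x))"
  define N where "N = Abs_fps (power_sum_coeff (c x) (P x))"
  \<comment> \<open>\<open>b i\<close> is the variation of the power sum coefficient divided by
    \<open>i + 1\<close>, so that the formal derivative of \<open>B\<close> has these variations as
    coefficients: the factor \<open>i + 1\<close> in the derivative of
    \<open>trace (P^(i+1))\<close> is the exponent of \<open>X^(i+1)\<close>.\<close>
  define b where "b i = (if i = 0 then c' else 0) + (-1)^i * trace (mat_pow (P x) i ** P')" for i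
  define B where "B = fps_X * Abs_fps b"
  have nthF: "fps_nth F i = trsigma i (c x) (P x)" and nthN: "fps_nth N i = power_sum_coeff (c x) (P x) i" for i
    by (simp_all add: F_def N_def)
  have dF: "fps_deriv F = F * N"
  proof (rule fps_ext)
    fix n
    have "fps_nth (fps_deriv F) n = (\<Sum>i\<le>n. trsigma (n - i) (c x) (P x) * power_sum_coeff (c x) (P x) i)"
      by (simp add: nthF del: of_nat_Suc)
    also have "\<dots> = fps_nth (N * F) n"
      unfolding fps_mult_nth nthF nthN atMost_atLeast0 by (intro sum.cong) auto
    finally show "fps_nth (fps_deriv F) n = fps_nth (F * N) n" by (simp only: mult.commute[of F])
  qed
  have dN: "((\<lambda>t. power_sum_coeff (c t) (P t) i) has_real_derivative fps_nth (fps_deriv B) i) (at x)" for i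
  proof -
    have "((\<lambda>t. (if i = 0 then c t else 0) + (-1)^i * trace (mat_pow (P t) (Suc i))) has_real_derivative
       (if i = 0 then c' else 0) + (-1)^i * (real (Suc i) * trace (mat_pow (P x) i ** P'))) (at x)"
      using c by (intro DERIV_add DERIV_cmult has_derivative_trace_mat_pow[OF P]) auto
    also have "(if i = 0 then c' else 0) + (-1)^i * (real (Suc i) * trace (mat_pow (P x) i ** P')) = fps_nth (fps_deriv B) i"
      by (auto simp: B_def b_def algebra_simps)
    finally show ?thesis unfolding power_sum_coeff_def .
  qed
  have main: "((\<lambda>t. trsigma k (c t) (P t)) has_real_derivative fps_nth (F * B) k) (at x)" for k
  proof (induction k rule: less_induct)
    case (less k)
    show ?case
    proof (cases k)
      case 0 then show ?thesis by (simp add: B_def)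
    next
      case (Suc m)
      have "((\<lambda>t. (\<Sum>i\<le>m. trsigma (m - i) (c t) (P t) * power_sum_coeff (c t) (P t) i) / real (Suc m)) has_real_derivative
          (\<Sum>i\<le>m. fps_nth (F * B) (m - i) * power_sum_coeff (c x) (P x) i + fps_nth (fps_deriv B) i * trsigma (m - i) (c x) (P x)) / real (Suc m)) (at x)"
        using less Suc by (intro DERIV_cdivide DERIV_sum DERIV_mult dN) auto
      moreover have "(\<Sum>i\<le>m. fps_nth (F * B) (m - i) * power_sum_coeff (c x) (P x) i + fps_nth (fps_deriv B) i * trsigma (m - i) (c x) (P x))
          = fps_nth (N * (F * B) + fps_deriv B * F) m"
        unfolding fps_add_nth fps_mult_nth[of N] fps_mult_nth[of "fps_deriv B"] nthF nthN atMost_atLeast0 sum.distrib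
        by (simp only: mult.commute)
      \<comment> \<open>By the linearized recursion the variations of the coefficients of
        \<open>F\<close> form a series with derivative \<open>N (F B) + F B'\<close>, and
        \<open>F' = F N\<close> identifies this with the derivative of \<open>F B\<close>.\<close>
      moreover have "N * (F * B) + fps_deriv B * F = fps_deriv (F * B)"
        by (simp add: dF mult_ac)
      moreover have "fps_nth (fps_deriv (F * B)) m / real (Suc m) = fps_nth (F * B) (Suc m)"
        unfolding fps_deriv_nth by simp
      ultimately show ?thesis unfolding Suc trsigma.simps by (simp only:)
    qed
  qed
  have "fps_nth (F * B) (Suc k) = fps_nth (Abs_fps b * F) k"
  proof -
    have "F * B = fps_X * (Abs_fps b * F)" by (simp add: B_def mult_ac)
    then show ?thesis by (simp only: fps_X_mult_nth) simp
  qed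
  also have "\<dots> = (\<Sum>i\<le>k. b i * trsigma (k - i) (c x) (P x))"
    by (simp add: fps_mult_nth nthF atMost_atLeast0)
  also have "\<dots> = (\<Sum>i\<le>k. (if i = 0 then c' * trsigma k (c x) (P x) else 0) +
      trsigma (k - i) (c x) (P x) * ((-1)^i * trace (mat_pow (P x) i ** P')))"
    by (intro sum.cong) (auto simp: b_def distrib_right)
  also have "\<dots> = trsigma k (c x) (P x) * c' + trace (newton_mat k (c x) (P x) ** P')"
    by (simp add: sum.distrib newton_mat_trace mult.commute)
  finally show ?thesis using main[of "Suc k"] by (simp only:)
qed

text \<open>On the eigenvector with eigenvalue \<open>d_j\<close> the Newton transformation acts by
  \<open>\<Sum> (-1)^i \<sigma>_{k-i} d_j^i\<close>. This is a coefficient of the generating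
  function times \<open>1 / (1 + d_j X)\<close>, and that division removes the factor of index
  \<open>j\<close>.\<close>

lemma newton_mat_conj:
  fixes E F :: "real^'n^'n"
  assumes "F ** E = mat 1" "E ** F = mat 1"
  shows "newton_mat k c (E ** diag d ** F) =
     E ** diag (\<chi> j. fps_nth (wgen c (vec_nth d) (UNIV - {j})) k) ** F"
proof -
  let ?P = "E ** diag d ** F"
  interpret l: bounded_linear "\<lambda>A. E ** A ** F"
    by (intro bounded_linear_compose[OF bounded_bilinear.bounded_linear_left[OF bounded_bilinear_matrix_mult]]
        bounded_bilinear.bounded_linear_right[OF bounded_bilinear_matrix_mult])
  have trs: "trsigma i c ?P = fps_nth (wgen c (vec_nth d) UNIV) i" for i
    unfolding wsigma_eq_wgen_nth[symmetric]
    by (rule wsigma_eq_trsigma[symmetric]) (rule trace_mat_pow_conj_diag[OF assms])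
  have rem: "(\<Sum>i\<le>k. (-1)^i * fps_nth (wgen c (vec_nth d) UNIV) (k - i) * d $ j ^ i)
     = fps_nth (wgen c (vec_nth d) (UNIV - {j})) k" for j
  proof -
    have "wgen c (vec_nth d) UNIV = (1 + fps_const (d $ j) * fps_X) * wgen c (vec_nth d) (UNIV - {j})"
      using wgen_insert[of "UNIV - {j}" j c "vec_nth d"] by (simp add: insert_UNIV)
    then have "geom_fps (d $ j) * wgen c (vec_nth d) UNIV =
       ((1 + fps_const (d $ j) * fps_X) * geom_fps (d $ j)) * wgen c (vec_nth d) (UNIV - {j})"
      by (simp only: mult_ac)
    then have "geom_fps (d $ j) * wgen c (vec_nth d) UNIV = wgen c (vec_nth d) (UNIV - {j})"
      by (simp only: geom_fps_inverse mult_1)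
    then have "fps_nth (wgen c (vec_nth d) (UNIV - {j})) k = fps_nth (geom_fps (d $ j) * wgen c (vec_nth d) UNIV) k"
      by simp
    also have "\<dots> = (\<Sum>i\<le>k. (-1)^i * fps_nth (wgen c (vec_nth d) UNIV) (k - i) * d $ j ^ i)"
      unfolding fps_mult_nth atMost_atLeast0
      by (intro sum.cong) (auto simp: geom_fps_def power_minus[of "d $ j"] mult_ac)
    finally show ?thesis by simp
  qed
  have "newton_mat k c ?P = (\<Sum>i\<le>k. ((-1)^i * fps_nth (wgen c (vec_nth d) UNIV) (k - i)) *\<^sub>R (E ** diag (\<chi> j. d $ j ^ i) ** F))"
    unfolding newton_mat_def trs mat_pow_conj[OF assms] mat_pow_diag ..
  also have "\<dots> = E ** (\<Sum>i\<le>k. ((-1)^i * fps_nth (wgen c (vec_nth d) UNIV) (k - i)) *\<^sub>R diag (\<chi> j. d $ j ^ i)) ** F"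
    by (simp only: l.sum l.scale)
  also have "(\<Sum>i\<le>k. ((-1)^i * fps_nth (wgen c (vec_nth d) UNIV) (k - i)) *\<^sub>R diag (\<chi> j. d $ j ^ i))
     = diag (\<chi> j. fps_nth (wgen c (vec_nth d) (UNIV - {j})) k)"
    by (simp add: vec_eq_iff diag_def rem)
  finally show ?thesis .
qed

lemma inner_diag_conj:
  fixes E :: "real^'n^'n"
  shows "\<xi> \<bullet> ((E ** diag \<tau> ** transpose E) *v \<xi>) = (\<Sum>j\<in>UNIV. \<tau> $ j * ((transpose E *v \<xi>) $ j)\<^sup>2)"
proof -
  have "\<xi> \<bullet> ((E ** diag \<tau> ** transpose E) *v \<xi>) = (transpose E *v \<xi>) \<bullet> (diag \<tau> *v (transpose E *v \<xi>))"
    by (metis dot_lmul_matrix matrix_vector_mul_assoc transpose_matrix_vector transpose_transpose matrix_mul_assoc)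
  also have "\<dots> = (\<Sum>j\<in>UNIV. \<tau> $ j * ((transpose E *v \<xi>) $ j)\<^sup>2)"
  proof -
    have "(diag \<tau> *v y) $ j = \<tau> $ j * y $ j" for y j
    proof -
      have "(diag \<tau> *v y) $ j = (\<Sum>i\<in>UNIV. if i = j then \<tau> $ j * y $ j else 0)"
        unfolding matrix_vector_mult_def diag_def by (simp only: vec_lambda_beta) (intro sum.cong, auto)
      then show ?thesis by simp
    qed
    then show ?thesis by (simp add: inner_vec_def power2_eq_square mult_ac)
  qed
  finally show ?thesis .
qed

lemma newton_mat_symmetric:
  fixes G S :: "real^'n^'n" and c :: real and k :: nat
  assumes "pos_def_mat G" "transpose S = S"
  defines "A \<equiv> newton_mat k c (matrix_inv G ** S) ** matrix_inv G"
  shows "transpose A = A"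
proof -
  obtain E F :: "real^'n^'n" and d :: "real^'n" where EF: "F ** E = mat 1" "E ** F = mat 1" "matrix_inv G ** S = E ** diag d ** F"
    "F ** matrix_inv G = transpose E"
    by (rule self_adjoint_normal_form[OF assms(1,2)])
  have "transpose (diag \<tau>) = diag \<tau>" for \<tau> :: "real^'n"
    by (auto simp: diag_def transpose_def vec_eq_iff)
  then show ?thesis unfolding A_def EF(3) newton_mat_conj[OF EF(1,2)]
    unfolding matrix_mul_assoc[symmetric] EF(4)
    by (simp add: matrix_transpose_mul matrix_mul_assoc)
qed

text \<open>In the eigenbasis the form is a weighted sum of squares of the entries of
  \<open>E^T \<xi>\<close>. All weights have the sign \<open>(-1)^k\<close>, and \<open>E^T\<close>
  is injective.\<close>

lemma newton_mat_definite:
  fixes G S :: "real^'n^'n"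
  assumes "pos_def_mat G" "transpose S = S"
    and cone: "\<And>j. 1 \<le> j \<Longrightarrow> j \<le> Suc k \<Longrightarrow> (-1)^j * trsigma j c (matrix_inv G ** S) > 0"
  shows "definite_form (newton_mat k c (matrix_inv G ** S) ** matrix_inv G)"
proof -
  let ?A = "newton_mat k c (matrix_inv G ** S) ** matrix_inv G"
  obtain E F :: "real^'n^'n" and d :: "real^'n" where EF: "F ** E = mat 1" "E ** F = mat 1" "matrix_inv G ** S = E ** diag d ** F"
    "F ** matrix_inv G = transpose E"
    by (rule self_adjoint_normal_form[OF assms(1,2)])
  define \<tau> where "\<tau> = (\<chi> j. fps_nth (wgen c (vec_nth d) (UNIV - {j})) k)"
  have A: "?A = E ** diag \<tau> ** transpose E"
    unfolding EF(3) newton_mat_conj[OF EF(1,2)] \<tau>_def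
    unfolding matrix_mul_assoc[symmetric] EF(4) ..
  have trs: "trsigma i c (matrix_inv G ** S) = fps_nth (wgen c (vec_nth d) UNIV) i" for i
    unfolding EF(3) wsigma_eq_wgen_nth[symmetric]
    by (rule wsigma_eq_trsigma[symmetric]) (rule trace_mat_pow_conj_diag[OF EF(1,2)])
  have pos: "(-1)^k * \<tau> $ j > 0" for j
  proof -
    have "fps_nth (wgen (-c) (\<lambda>i. - vec_nth d i) (UNIV - {j})) k > 0"
    \<comment> \<open>The cone of the negated data reaches degree \<open>Suc k\<close>, one more
      than the degree \<open>k\<close> wanted for the family without \<open>j\<close>.\<close>
    proof (rule wgen_cone_remove[of _ j "Suc k"])
      fix i assume "1 \<le> i" "i \<le> Suc k"
      then show "fps_nth (wgen (-c) (\<lambda>i. - vec_nth d i) (insert j (UNIV - {j}))) i > 0"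
        using cone[of i] by (simp add: insert_UNIV wgen_uminus trs)
    qed auto
    then show ?thesis by (simp add: wgen_uminus \<tau>_def)
  qed
  have "(-1)^k * (\<xi> \<bullet> (?A *v \<xi>)) > 0" if "\<xi> \<noteq> 0" for \<xi>
  proof -
    let ?y = "transpose E *v \<xi>"
    have "?y \<noteq> 0"
    proof
      assume "?y = 0"
      moreover have "transpose F ** transpose E = mat 1" by (metis EF(2) matrix_transpose_mul transpose_mat)
      then have "\<xi> = transpose F *v ?y" by (simp only: matrix_vector_mul_assoc matrix_vector_mul_lid)
      ultimately show False using that by simp
    qed
    then obtain j where "?y $ j \<noteq> 0" by (metis vec_eq_iff zero_index)
    then have "(\<Sum>j\<in>UNIV. ((-1)^k * \<tau> $ j) * (?y $ j)\<^sup>2) > 0"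
      using pos by (intro sum_pos2[of _ j]) (auto simp: less_imp_le mult_pos_pos)
    then show ?thesis unfolding A inner_diag_conj by (simp add: sum_distrib_left mult.assoc)
  qed
  then show ?thesis unfolding definite_form_def by (cases "even k") auto
qed

section \<open>Smooth functions\<close>

lemma partial_eqI:
  assumes "(f has_derivative f') (at u)"
  shows "partial i f u = f' (axis i 1)"
  using frechet_derivative_at[OF assms] by (simp add: partial_def)

lemma has_derivative_transform_open:
  assumes "open S" "u \<in> S" "\<And>v. v \<in> S \<Longrightarrow> f v = g v"
  shows "(f has_derivative f') (at u) \<longleftrightarrow> (g has_derivative f') (at u)"
  using assms has_derivative_transform_within_open[of f f' u UNIV S g]
    has_derivative_transform_within_open[of g f' u UNIV S f] by (metis)

text \<open>No differentiability is assumed: both functions have the same set of derivatives at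
  \<open>u\<close>, so the choice inside \<open>frechet_derivative\<close> is the same.\<close>

lemma partial_cong_open:
  assumes "open S" "u \<in> S" "\<And>v. v \<in> S \<Longrightarrow> f v = g v"
  shows "partial i f u = partial i g u"
proof -
  have "(f has_derivative f') (at u) \<longleftrightarrow> (g has_derivative f') (at u)" for f'
    by (rule has_derivative_transform_open[OF assms(1,2)]) (rule assms(3))
  then show ?thesis by (simp add: partial_def frechet_derivative_def)
qed

lemma differentiable_cong_open:
  assumes "open S" "u \<in> S" "\<And>v. v \<in> S \<Longrightarrow> f v = g v"
  shows "f differentiable (at u) \<longleftrightarrow> g differentiable (at u)"
proof -
  have "(f has_derivative f') (at u) \<longleftrightarrow> (g has_derivative f') (at u)" for f'
    by (rule has_derivative_transform_open[OF assms(1,2)]) (rule assms(3))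
  then show ?thesis by (simp add: differentiable_def)
qed

lemma differentiable_has_derivative:
  "f differentiable (at u) \<Longrightarrow> (f has_derivative frechet_derivative f (at u)) (at u)"
  by (simp add: frechet_derivative_works)

lemma partial_const: "partial i (\<lambda>u. c) u = 0"
  by (rule partial_eqI[THEN trans]) (auto intro!: derivative_eq_intros)

lemma partial_add:
  assumes "f differentiable (at u)" "g differentiable (at u)"
  shows "partial i (\<lambda>u. f u + g u) u = partial i f u + partial i g u"
  unfolding partial_def[of i f] partial_def[of i g]
  by (rule partial_eqI) (intro has_derivative_add differentiable_has_derivative assms)

lemma partial_sum:
  assumes "\<And>k. k \<in> I \<Longrightarrow> f k differentiable (at u)"
  shows "partial i (\<lambda>u. \<Sum>k\<in>I. f k u) u = (\<Sum>k\<in>I. partial i (f k) u)"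
  unfolding partial_def[of i "f _"]
  by (rule partial_eqI) (intro has_derivative_sum differentiable_has_derivative assms)

lemma partial_bilinear:
  assumes "bounded_bilinear h" "f differentiable (at u)" "g differentiable (at u)"
  shows "partial i (\<lambda>u. h (f u) (g u)) u = h (f u) (partial i g u) + h (partial i f u) (g u)"
  unfolding partial_def[of i f] partial_def[of i g]
  by (rule partial_eqI) (intro bounded_bilinear.FDERIV[OF assms(1)] differentiable_has_derivative assms)

lemma partial_mult:
  fixes f g :: "real^'n::finite \<Rightarrow> real"
  assumes "f differentiable (at u)" "g differentiable (at u)"
  shows "partial i (\<lambda>u. f u * g u) u = f u * partial i g u + partial i f u * g u"
  by (rule partial_bilinear[OF bounded_bilinear_mult assms])

lemma partial_linear:
  assumes "bounded_linear h" "f differentiable (at u)"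
  shows "partial i (\<lambda>u. h (f u)) u = h (partial i f u)"
  unfolding partial_def[of i f]
  by (rule partial_eqI) (intro bounded_linear.has_derivative[OF assms(1)] differentiable_has_derivative assms)

lemma partial_nth:
  assumes "f differentiable (at u)"
  shows "partial i (\<lambda>u. f u $ k) u = partial i f u $ k"
  by (rule partial_linear[OF bounded_linear_vec_nth assms])

lemma frechet_derivative_eq_partial_sum:
  assumes "f differentiable (at u)"
  shows "frechet_derivative f (at u) v = (\<Sum>i\<in>UNIV. v $ i *\<^sub>R partial i f u)"
proof -
  interpret l: linear "frechet_derivative f (at u)"
    by (rule linear_frechet_derivative[OF assms])
  have "v = (\<Sum>i\<in>UNIV. v $ i *\<^sub>R axis i 1)"
    using basis_expansion[of v] by (simp add: scalar_mult_eq_scaleR)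
  then have "frechet_derivative f (at u) v = frechet_derivative f (at u) (\<Sum>i\<in>UNIV. v $ i *\<^sub>R axis i 1)"
    by simp
  then show ?thesis by (simp add: l.sum l.scale partial_def)
qed

lemma partial_chain:
  fixes T :: "real^'n::finite \<Rightarrow> real^'m::finite"
  assumes T: "T differentiable (at u)" and f: "f differentiable (at (T u))"
  shows "partial i (\<lambda>w. f (T w)) u = (\<Sum>a\<in>UNIV. partial i (\<lambda>w. T w $ a) u *\<^sub>R partial a f (T u))"
proof -
  have "((\<lambda>w. f (T w)) has_derivative (\<lambda>v. frechet_derivative f (at (T u)) (frechet_derivative T (at u) v))) (at u)"
    by (rule has_derivative_compose) (intro differentiable_has_derivative T f)+
  then have "partial i (\<lambda>w. f (T w)) u = frechet_derivative f (at (T u)) (partial i T u)"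
    unfolding partial_def[of i T] by (rule partial_eqI)
  then show ?thesis using T by (simp add: frechet_derivative_eq_partial_sum[OF f] partial_nth)
qed

text \<open>The rules for partial derivatives hold only at points of \<open>S\<close>, whereas
  \<open>Ck_on\<close> speaks of total functions. The inductions over the order therefore replace a
  partial derivative by its formula with this lemma; openness makes agreement on \<open>S\<close>
  pass to derivatives.\<close>

lemma Ck_on_cong:
  assumes "open S" "\<And>u. u \<in> S \<Longrightarrow> f u = g u" "Ck_on r S f"
  shows "Ck_on r S g"
  using assms(2,3)
proof (induction r arbitrary: f g)
  case 0 then show ?case by (simp cong: continuous_on_cong)
next
  case (Suc r)
  have "Ck_on r S (partial i g)" for i
  proof (rule Suc.IH)
    show "partial i f u = partial i g u" if "u \<in> S" for u
      using assms(1) that Suc.prems(1) by (rule partial_cong_open)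
  qed (use Suc.prems in simp)
  then show ?case
    using Suc.prems differentiable_cong_open[OF assms(1) _ Suc.prems(1)] by auto
qed

lemma Ck_on_SucD: "Ck_on (Suc r) S f \<Longrightarrow> Ck_on r S f"
proof (induction r arbitrary: f)
  case 0
  then show ?case
    by (auto intro!: continuous_at_imp_continuous_on differentiable_imp_continuous_within)
next
  case (Suc r) then show ?case by (metis Ck_on.simps(2))
qed

section \<open>Closure of differentiability classes under algebraic operations\<close>

lemma Ck_on_const:
  fixes S :: "(real^'n::finite) set"
  shows "Ck_on r S (\<lambda>u. c)"
proof (induction r arbitrary: c)
  case (Suc r)
  have "partial i (\<lambda>u. c) = (\<lambda>u. 0)" for i :: 'n by (simp add: fun_eq_iff partial_const)
  then show ?case using Suc by simp
qed simp

lemma Ck_on_add: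
  assumes S: "open S" shows "Ck_on r S f \<Longrightarrow> Ck_on r S g \<Longrightarrow> Ck_on r S (\<lambda>u. f u + g u)"
proof (induction r arbitrary: f g)
  case 0 then show ?case by (simp add: continuous_on_add)
next
  case (Suc r)
  have "Ck_on r S (partial i (\<lambda>u. f u + g u))" for i
    by (rule Ck_on_cong[OF S _ Suc.IH[of "partial i f" "partial i g"]])
       (use Suc.prems in \<open>auto simp: partial_add\<close>)
  then show ?case using Suc.prems by auto
qed

lemma Ck_on_linear:
  assumes S: "open S" and h: "bounded_linear h" shows "Ck_on r S f \<Longrightarrow> Ck_on r S (\<lambda>u. h (f u))"
proof (induction r arbitrary: f)
  case 0 then show ?case by (simp add: bounded_linear.continuous_on[OF h])
next
  case (Suc r)
  have "Ck_on r S (partial i (\<lambda>u. h (f u)))" for i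
    by (rule Ck_on_cong[OF S _ Suc.IH[of "partial i f"]])
       (use Suc.prems in \<open>auto simp: partial_linear[OF h]\<close>)
  then show ?case
    using Suc.prems bounded_linear.has_derivative[OF h] unfolding Ck_on.simps differentiable_def by blast
qed

lemma Ck_on_bilinear:
  assumes S: "open S" and h: "bounded_bilinear h"
  shows "Ck_on r S f \<Longrightarrow> Ck_on r S g \<Longrightarrow> Ck_on r S (\<lambda>u. h (f u) (g u))"
proof (induction r arbitrary: f g)
  case 0 then show ?case by (simp add: bounded_bilinear.continuous_on[OF h])
next
  case (Suc r)
  have fg: "Ck_on r S f" "Ck_on r S g" using Suc.prems Ck_on_SucD by blast+
  have "Ck_on r S (partial i (\<lambda>u. h (f u) (g u)))" for i
    by (rule Ck_on_cong[OF S _ Ck_on_add[OF S Suc.IH[of f "partial i g"] Suc.IH[of "partial i f" g]]])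
       (use Suc.prems fg in \<open>auto simp: partial_bilinear[OF h]\<close>)
  moreover have "(\<lambda>u. h (f u) (g u)) differentiable (at u)" if "u \<in> S" for u
    using Suc.prems that bounded_bilinear.FDERIV[OF h] unfolding differentiable_def Ck_on.simps by blast
  ultimately show ?case by simp
qed

text \<open>The derivative of \<open>g = 1/f\<close> is \<open>- g f' g\<close>, which contains
  \<open>g\<close> itself: the induction hypothesis supplies \<open>g\<close> to order
  \<open>r\<close>, and products do the rest.\<close>

lemma Ck_on_inverse:
  fixes f :: "real^'n::finite \<Rightarrow> real"
  assumes S: "open S" and nz: "\<And>u. u \<in> S \<Longrightarrow> f u \<noteq> 0"
  shows "Ck_on r S f \<Longrightarrow> Ck_on r S (\<lambda>u. inverse (f u))"
proof (induction r)
  case 0 then show ?case using nz by (simp add: continuous_on_inverse)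
next
  case (Suc r)
  let ?g = "\<lambda>u. inverse (f u)"
  have g: "Ck_on r S ?g" using Suc Ck_on_SucD by blast
  have der: "(?g has_derivative (\<lambda>v. - (?g u * frechet_derivative f (at u) v * ?g u))) (at u)" if "u \<in> S" for u
    using nz[OF that] Suc.prems that
    by (intro Deriv.has_derivative_inverse differentiable_has_derivative) auto
  have "Ck_on r S (partial i ?g)" for i
  proof (rule Ck_on_cong[OF S])
    show "Ck_on r S (\<lambda>u. - (?g u * partial i f u * ?g u))"
      using Suc.prems g by (intro Ck_on_linear[OF S bounded_linear_minus[OF bounded_linear_ident]] Ck_on_bilinear[OF S bounded_bilinear_mult]) auto
    show "- (?g u * partial i f u * ?g u) = partial i ?g u" if "u \<in> S" for u
      unfolding partial_eqI[OF der[OF that]] partial_def[of i f] ..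
  qed
  then show ?case using der unfolding differentiable_def Ck_on.simps by blast
qed

lemma smooth_on_cong:
  assumes "open S" "\<And>u. u \<in> S \<Longrightarrow> f u = g u" "smooth_on S f"
  shows "smooth_on S g"
  using assms Ck_on_cong unfolding smooth_on_def by blast

lemma smooth_on_differentiable: "smooth_on S f \<Longrightarrow> u \<in> S \<Longrightarrow> f differentiable (at u)"
  unfolding smooth_on_def by (metis Ck_on.simps(2))

lemma smooth_on_partial: "smooth_on S f \<Longrightarrow> smooth_on S (partial i f)"
  unfolding smooth_on_def by (metis Ck_on.simps(2))

lemma smooth_on_const: "smooth_on S (\<lambda>u. c)"
  by (simp add: smooth_on_def Ck_on_const)

lemma smooth_on_add: "open S \<Longrightarrow> smooth_on S f \<Longrightarrow> smooth_on S g \<Longrightarrow> smooth_on S (\<lambda>u. f u + g u)"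
  by (simp add: smooth_on_def Ck_on_add)

lemma smooth_on_linear: "open S \<Longrightarrow> bounded_linear h \<Longrightarrow> smooth_on S f \<Longrightarrow> smooth_on S (\<lambda>u. h (f u))"
  by (simp add: smooth_on_def Ck_on_linear)

lemma smooth_on_bilinear:
  "open S \<Longrightarrow> bounded_bilinear h \<Longrightarrow> smooth_on S f \<Longrightarrow> smooth_on S g \<Longrightarrow> smooth_on S (\<lambda>u. h (f u) (g u))"
  by (simp add: smooth_on_def Ck_on_bilinear)

lemma smooth_on_minus: "open S \<Longrightarrow> smooth_on S f \<Longrightarrow> smooth_on S (\<lambda>u. - f u)"
  by (rule smooth_on_linear[OF _ bounded_linear_minus[OF bounded_linear_ident]])

lemma smooth_on_diff:
  assumes "open S" "smooth_on S f" "smooth_on S g" shows "smooth_on S (\<lambda>u. f u - g u)"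
  using smooth_on_add[OF assms(1,2) smooth_on_minus[OF assms(1,3)]] by simp

lemma smooth_on_mult:
  fixes f g :: "real^'n::finite \<Rightarrow> real"
  shows "open S \<Longrightarrow> smooth_on S f \<Longrightarrow> smooth_on S g \<Longrightarrow> smooth_on S (\<lambda>u. f u * g u)"
  by (rule smooth_on_bilinear[OF _ bounded_bilinear_mult])

lemma smooth_on_divide:
  fixes f g :: "real^'n::finite \<Rightarrow> real"
  assumes "open S" "smooth_on S f" "smooth_on S g" "\<And>u. u \<in> S \<Longrightarrow> g u \<noteq> 0"
  shows "smooth_on S (\<lambda>u. f u / g u)"
  unfolding divide_inverse using assms
  by (intro smooth_on_mult) (auto simp: smooth_on_def Ck_on_inverse)

lemma smooth_on_sum:
  assumes "open S" "\<And>k. k \<in> I \<Longrightarrow> smooth_on S (f k)"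
  shows "smooth_on S (\<lambda>u. \<Sum>k\<in>I. f k u)"
  using assms(2)
proof (induction I rule: infinite_finite_induct)
  case (insert x I)
  then show ?case using smooth_on_add[OF assms(1), of "f x" "\<lambda>u. \<Sum>k\<in>I. f k u"] by simp
qed (simp_all add: smooth_on_const)

lemma smooth_on_prod:
  fixes f :: "'k \<Rightarrow> real^'n::finite \<Rightarrow> real"
  assumes "open S" "\<And>k. k \<in> I \<Longrightarrow> smooth_on S (f k)"
  shows "smooth_on S (\<lambda>u. \<Prod>k\<in>I. f k u)"
  using assms(2)
proof (induction I rule: infinite_finite_induct)
  case (insert x I)
  then show ?case using smooth_on_mult[OF assms(1), of "f x" "\<lambda>u. \<Prod>k\<in>I. f k u"] by simp
qed (simp_all add: smooth_on_const)

lemma smooth_on_nth: "open S \<Longrightarrow> smooth_on S f \<Longrightarrow> smooth_on S (\<lambda>u. f u $ k)"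
  by (rule smooth_on_linear[OF _ bounded_linear_vec_nth])

lemma smooth_on_vec_lambda:
  fixes f :: "'m::finite \<Rightarrow> real^'n::finite \<Rightarrow> 'b::real_normed_vector"
  assumes "open S" "\<And>k. smooth_on S (f k)"
  shows "smooth_on S (\<lambda>u. \<chi> k. f k u)"
proof -
  have ax: "bounded_linear (axis k :: 'b \<Rightarrow> 'b^'m)" for k
  proof (rule bounded_linear_intro[where K=1])
    show "axis k (x + y) = axis k x + axis k (y::'b)" for x y by (simp add: vec_eq_iff axis_def)
    show "axis k (r *\<^sub>R x) = r *\<^sub>R axis k (x::'b)" for r x by (simp add: vec_eq_iff axis_def)
    show "norm (axis k x) \<le> norm (x::'b) * 1" for x
    proof -
      have "(norm (axis k x $ i))\<^sup>2 = (if i = k then (norm x)\<^sup>2 else 0)" for i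
        by (simp add: axis_def)
      then show ?thesis by (simp add: norm_vec_def L2_set_def)
    qed
  qed
  have "(\<lambda>u. \<chi> k. f k u) = (\<lambda>u. \<Sum>k\<in>UNIV. axis k (f k u))"
    by (simp add: fun_eq_iff vec_eq_iff axis_def)
  then show ?thesis using assms by (simp add: smooth_on_sum smooth_on_linear[OF _ ax])
qed

lemma smooth_on_matrix_mult:
  fixes A B :: "real^'m::finite \<Rightarrow> real^'n::finite^'n"
  shows "open S \<Longrightarrow> smooth_on S A \<Longrightarrow> smooth_on S B \<Longrightarrow> smooth_on S (\<lambda>u. A u ** B u)"
  by (rule smooth_on_bilinear[OF _ bounded_bilinear_matrix_mult])

lemma smooth_on_det:
  fixes A :: "real^'m::finite \<Rightarrow> real^'n::finite^'n"
  assumes "open S" "smooth_on S A"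
  shows "smooth_on S (\<lambda>u. det (A u))"
  unfolding det_def using assms
  by (intro smooth_on_sum smooth_on_mult smooth_on_const smooth_on_prod smooth_on_nth)

text \<open>By Cramer's rule the entries of the inverse are quotients of determinants, hence
  rational in the entries of \<open>A\<close>.\<close>

lemma smooth_on_matrix_inv:
  fixes A :: "real^'m::finite \<Rightarrow> real^'n::finite^'n"
  assumes S: "open S" and A: "smooth_on S A" and inv: "\<And>u. u \<in> S \<Longrightarrow> invertible (A u)"
  shows "smooth_on S (\<lambda>u. matrix_inv (A u))"
proof -
  \<comment> \<open>\<open>A u\<close> with column \<open>i\<close> replaced by the unit vector
    \<open>e_j\<close>; Cramer's rule applies because column \<open>j\<close> of the inverse solves
    \<open>A x = e_j\<close>.\<close>
  define N where "N i j u = (\<chi> r s. if s = i then axis j 1 $ r else A u $ r $ s)" for i j and u :: "real^'m"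
  have "smooth_on S (\<lambda>u. if s = i then axis j 1 $ r else A u $ r $ s)" for i j r s
    using S A by (cases "s = i") (auto intro!: smooth_on_const smooth_on_nth)
  then have N: "smooth_on S (N i j)" for i j
    unfolding N_def by (intro smooth_on_vec_lambda S)
  have "smooth_on S (\<lambda>u. \<chi> i j. det (N i j u) / det (A u))"
    using inv by (intro smooth_on_vec_lambda smooth_on_divide smooth_on_det S A N) (simp add: invertible_det_nz)
  then show ?thesis
  proof (rule smooth_on_cong[OF S, rotated])
    fix u assume u: "u \<in> S"
    have d0: "det (A u) \<noteq> 0" using inv[OF u] by (simp add: invertible_det_nz)
    have "matrix_inv (A u) $ i $ j = det (N i j u) / det (A u)" for i j
    proof -
      have "A u *v (matrix_inv (A u) *v axis j 1) = axis j 1"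
        using inv[OF u] by (simp add: matrix_vector_mul_assoc matrix_inv_inverse)
      then have "matrix_inv (A u) *v axis j 1 = (\<chi> k. det (\<chi> r s. if s = k then axis j 1 $ r else A u $ r $ s) / det (A u))"
        using cramer[OF d0] by blast
      then have "(matrix_inv (A u) *v axis j 1) $ i = det (N i j u) / det (A u)" by (simp add: N_def)
      then show ?thesis by (simp add: matrix_vector_mult_basis column_def)
    qed
    then show "(\<chi> i j. det (N i j u) / det (A u)) = matrix_inv (A u)" by (simp add: vec_eq_iff)
  qed
qed

text \<open>For Schwarz's theorem: the second difference equals \<open>h\<^sup>2\<close> times either mixed derivative at nearby points.\<close>

lemma line_has_real_derivative:
  fixes f :: "real^'n::finite \<Rightarrow> real"
  assumes "f differentiable (at (p + s *\<^sub>R axis i 1))"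
  shows "((\<lambda>s. f (p + s *\<^sub>R axis i 1)) has_real_derivative partial i f (p + s *\<^sub>R axis i 1)) (at s)"
proof -
  let ?q = "p + s *\<^sub>R axis i 1"
  have "((\<lambda>s. p + s *\<^sub>R axis i 1) has_derivative (\<lambda>t. t *\<^sub>R axis i 1)) (at s)"
    by (auto intro!: derivative_eq_intros)
  then have "((\<lambda>s. f (p + s *\<^sub>R axis i 1)) has_derivative (\<lambda>t. frechet_derivative f (at ?q) (t *\<^sub>R axis i 1))) (at s)"
    using differentiable_has_derivative[OF assms] by (rule has_derivative_compose)
  moreover have "frechet_derivative f (at ?q) (t *\<^sub>R axis i 1) = partial i f ?q * t" for t
    using linear_scale[OF linear_frechet_derivative[OF assms]] by (simp add: partial_def)
  ultimately show ?thesis by (simp add: has_field_derivative_def)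
qed

lemma second_difference_mean_value:
  fixes f :: "real^'n::finite \<Rightarrow> real"
  assumes f: "Ck_on (Suc (Suc 0)) S f" and h: "h > 0"
    and S: "\<And>s t. 0 \<le> s \<Longrightarrow> s \<le> h \<Longrightarrow> 0 \<le> t \<Longrightarrow> t \<le> h \<Longrightarrow> u + s *\<^sub>R axis i 1 + t *\<^sub>R axis j 1 \<in> S"
  obtains s t where "0 < s" "s < h" "0 < t" "t < h"
    "f (u + h *\<^sub>R axis i 1 + h *\<^sub>R axis j 1) - f (u + h *\<^sub>R axis i 1) - f (u + h *\<^sub>R axis j 1) + f u =
     h * h * partial j (partial i f) (u + s *\<^sub>R axis i 1 + t *\<^sub>R axis j 1)"
proof -
  \<comment> \<open>The second difference is \<open>A h - A 0\<close>, the increment in direction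
    \<open>i\<close> of a difference in direction \<open>j\<close>. The mean value theorem yields a
    derivative along \<open>i\<close>, whose difference along \<open>j\<close> is treated in the
    same way.\<close>
  define A where "A s = f (u + h *\<^sub>R axis j 1 + s *\<^sub>R axis i 1) - f (u + s *\<^sub>R axis i 1)" for s
  have d: "f differentiable (at (u + s *\<^sub>R axis i 1 + t *\<^sub>R axis j 1))"
    "partial i f differentiable (at (u + s *\<^sub>R axis i 1 + t *\<^sub>R axis j 1))"
    if "0 \<le> s" "s \<le> h" "0 \<le> t" "t \<le> h" for s t
    using f S[OF that] by auto
  have "(A has_real_derivative (partial i f (u + h *\<^sub>R axis j 1 + s *\<^sub>R axis i 1) - partial i f (u + s *\<^sub>R axis i 1))) (at s)"
    if "0 \<le> s" "s \<le> h" for s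
    unfolding A_def using d(1)[OF that, of h] d(1)[OF that, of 0] h
    by (intro DERIV_diff line_has_real_derivative) (auto simp: add_ac)
  then obtain s where s: "0 < s" "s < h"
    "A h - A 0 = (h - 0) * (partial i f (u + h *\<^sub>R axis j 1 + s *\<^sub>R axis i 1) - partial i f (u + s *\<^sub>R axis i 1))"
    using MVT2[OF h, of A "\<lambda>s. partial i f (u + h *\<^sub>R axis j 1 + s *\<^sub>R axis i 1) - partial i f (u + s *\<^sub>R axis i 1)"] by blast
  let ?B = "\<lambda>t. partial i f (u + s *\<^sub>R axis i 1 + t *\<^sub>R axis j 1)"
  have "(?B has_real_derivative partial j (partial i f) (u + s *\<^sub>R axis i 1 + t *\<^sub>R axis j 1)) (at t)"
    if "0 \<le> t" "t \<le> h" for t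
    by (intro line_has_real_derivative d(2)) (use s that in auto)
  then obtain t where t: "0 < t" "t < h" "?B h - ?B 0 = (h - 0) * partial j (partial i f) (u + s *\<^sub>R axis i 1 + t *\<^sub>R axis j 1)"
    using MVT2[OF h, of ?B "\<lambda>t. partial j (partial i f) (u + s *\<^sub>R axis i 1 + t *\<^sub>R axis j 1)"] by blast
  have "A h - A 0 = h * (?B h - ?B 0)" using s(3) by (simp add: add_ac)
  also have "\<dots> = h * h * partial j (partial i f) (u + s *\<^sub>R axis i 1 + t *\<^sub>R axis j 1)" using t(3) by simp
  finally have "f (u + h *\<^sub>R axis i 1 + h *\<^sub>R axis j 1) - f (u + h *\<^sub>R axis i 1) - f (u + h *\<^sub>R axis j 1) + f u =
     h * h * partial j (partial i f) (u + s *\<^sub>R axis i 1 + t *\<^sub>R axis j 1)"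
    unfolding A_def by (simp add: add_ac)
  then show thesis using that s t by blast
qed

lemma mixed_partials_real:
  fixes f :: "real^'n::finite \<Rightarrow> real"
  assumes S: "open S" "u \<in> S" and f: "Ck_on (Suc (Suc 0)) S f"
  shows "partial i (partial j f) u = partial j (partial i f) u"
proof (rule ccontr)
  let ?X = "partial i (partial j f)" and ?Y = "partial j (partial i f)"
  assume "?X u \<noteq> ?Y u"
  define e where "e = \<bar>?X u - ?Y u\<bar> / 2"
  have e: "e > 0" using \<open>?X u \<noteq> ?Y u\<close> by (simp add: e_def)
  have "continuous_on S ?X" "continuous_on S ?Y" using f by auto
  then have "isCont ?X u" "isCont ?Y u" using S by (simp_all add: continuous_on_eq_continuous_at)
  then obtain d1 d2 where d: "d1 > 0" "d2 > 0" "\<And>v. dist v u < d1 \<Longrightarrow> dist (?X v) (?X u) < e"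
    "\<And>v. dist v u < d2 \<Longrightarrow> dist (?Y v) (?Y u) < e"
    using e unfolding continuous_at_eps_delta by metis
  obtain r where r: "r > 0" "ball u r \<subseteq> S" using S open_contains_ball by blast
  \<comment> \<open>The points in question lie within \<open>2 h\<close> of \<open>u\<close>; a
    third of the smallest radius keeps this strictly below each of them.\<close>
  define h where "h = Min {d1, d2, r} / 3"
  have h: "h > 0" "2 * h < d1" "2 * h < d2" "2 * h < r" using d r by (auto simp: h_def)
  have near: "dist (u + s *\<^sub>R axis k 1 + t *\<^sub>R axis l 1) u \<le> 2 * h"
    if "0 \<le> s" "s \<le> h" "0 \<le> t" "t \<le> h" for s t and k l :: 'n
  proof -
    have "norm (s *\<^sub>R axis k 1 + t *\<^sub>R axis l 1 :: real^'n) \<le> norm (s *\<^sub>R axis k 1 :: real^'n) + norm (t *\<^sub>R axis l 1 :: real^'n)"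
      by (rule norm_triangle_ineq)
    also have "\<dots> \<le> 2 * h" using that by simp
    finally show ?thesis by (simp add: dist_norm add.assoc)
  qed
  then have inS: "u + s *\<^sub>R axis k 1 + t *\<^sub>R axis l 1 \<in> S"
    if "0 \<le> s" "s \<le> h" "0 \<le> t" "t \<le> h" for s t and k l :: 'n
    using r(2) h(4) near[OF that, of k l] by (auto simp: dist_commute subset_iff)
  obtain s t where st: "0 < s" "s < h" "0 < t" "t < h"
    "f (u + h *\<^sub>R axis i 1 + h *\<^sub>R axis j 1) - f (u + h *\<^sub>R axis i 1) - f (u + h *\<^sub>R axis j 1) + f u =
     h * h * ?Y (u + s *\<^sub>R axis i 1 + t *\<^sub>R axis j 1)"
    using second_difference_mean_value[OF f h(1) inS] by blast
  obtain s' t' where st': "0 < s'" "s' < h" "0 < t'" "t' < h"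
    "f (u + h *\<^sub>R axis j 1 + h *\<^sub>R axis i 1) - f (u + h *\<^sub>R axis j 1) - f (u + h *\<^sub>R axis i 1) + f u =
     h * h * ?X (u + s' *\<^sub>R axis j 1 + t' *\<^sub>R axis i 1)"
    using second_difference_mean_value[OF f h(1) inS] by blast
  have "h * h * ?X (u + s' *\<^sub>R axis j 1 + t' *\<^sub>R axis i 1) = h * h * ?Y (u + s *\<^sub>R axis i 1 + t *\<^sub>R axis j 1)"
  proof -
    have com: "u + h *\<^sub>R axis j 1 + h *\<^sub>R axis i 1 = u + h *\<^sub>R axis i 1 + h *\<^sub>R axis j 1" by (simp add: add_ac)
    show ?thesis unfolding st(5)[symmetric] st'(5)[symmetric] com by simp
  qed
  then have eq: "?X (u + s' *\<^sub>R axis j 1 + t' *\<^sub>R axis i 1) = ?Y (u + s *\<^sub>R axis i 1 + t *\<^sub>R axis j 1)"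
    using h(1) by simp
  have "dist (?X (u + s' *\<^sub>R axis j 1 + t' *\<^sub>R axis i 1)) (?X u) < e"
    by (intro d(3) le_less_trans[OF near h(2)]) (use st' in auto)
  moreover have "dist (?Y (u + s *\<^sub>R axis i 1 + t *\<^sub>R axis j 1)) (?Y u) < e"
    by (intro d(4) le_less_trans[OF near h(3)]) (use st in auto)
  moreover have "False" if "\<bar>z - x\<bar> < \<bar>x - y\<bar> / 2" "\<bar>z - y\<bar> < \<bar>x - y\<bar> / 2" for x y z :: real
    using that by argo
  ultimately show False unfolding eq dist_real_def e_def by blast
qed

lemma mixed_partials:
  fixes f :: "real^'n::finite \<Rightarrow> real"
  assumes "open S" "u \<in> S" "smooth_on S f"
  shows "partial i (partial j f) u = partial j (partial i f) u"
  using assms mixed_partials_real unfolding smooth_on_def by blast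

section \<open>Curvature in a chart\<close>

lemmas mat_bilinear = bounded_bilinear_matrix_mult
lemmas mat_mult_distribs =
  bounded_bilinear.add_left[OF bounded_bilinear_matrix_mult]
  bounded_bilinear.add_right[OF bounded_bilinear_matrix_mult]
  bounded_bilinear.diff_left[OF bounded_bilinear_matrix_mult]
  bounded_bilinear.diff_right[OF bounded_bilinear_matrix_mult]
  bounded_bilinear.scaleR_left[OF bounded_bilinear_matrix_mult]
  bounded_bilinear.scaleR_right[OF bounded_bilinear_matrix_mult]
  bounded_bilinear.sum_left[OF bounded_bilinear_matrix_mult]
  bounded_bilinear.sum_right[OF bounded_bilinear_matrix_mult]

lemma pos_def_mat_invertible:
  fixes G :: "real^'n^'n"
  assumes "pos_def_mat G"
  shows "invertible G"
proof -
  have "x = 0" if "G *v x = 0" for x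
    using assms that unfolding pos_def_mat_def by (metis inner_zero_right less_irrefl)
  then show ?thesis by (simp add: invertible_left_inverse matrix_left_invertible_ker)
qed

lemma pos_def_mat_inv_symmetric:
  fixes G :: "real^'n^'n"
  assumes "pos_def_mat G"
  shows "transpose (matrix_inv G) = matrix_inv G"
proof -
  have "transpose G = G" using assms by (simp add: pos_def_mat_def)
  then obtain E F :: "real^'n^'n" and d :: "real^'n" where "matrix_inv G = E ** transpose E"
    by (rule self_adjoint_normal_form[OF assms])
  then show ?thesis by (simp add: matrix_transpose_mul)
qed

lemma sum3_rotate: "(\<Sum>a\<in>A. \<Sum>b\<in>B. \<Sum>c\<in>C. f a b c) = (\<Sum>b\<in>B. \<Sum>c\<in>C. \<Sum>a\<in>A. f a b c)"
  by (subst sum.swap) (intro sum.cong refl sum.swap)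

lemma mixed_partials_matrix:
  fixes F :: "real^'n::finite \<Rightarrow> real^'m::finite^'k::finite"
  assumes S: "open S" "u \<in> S" and F: "smooth_on S F"
  shows "partial i (partial j F) u = partial j (partial i F) u"
proof -
  have h: "bounded_linear (\<lambda>M::real^'m^'k. M $ a $ b)" for a b
    by (intro bounded_linear_compose[OF bounded_linear_vec_nth bounded_linear_vec_nth])
  have *: "partial i (partial j F) u $ a $ b = partial i (partial j (\<lambda>w. F w $ a $ b)) u" for i j a b
  proof -
    have "partial i (partial j F) u $ a $ b = partial i (\<lambda>w. partial j F w $ a $ b) u"
      using smooth_on_differentiable[OF smooth_on_partial[OF F] S(2)] by (rule partial_linear[OF h, symmetric])
    also have "\<dots> = partial i (partial j (\<lambda>w. F w $ a $ b)) u"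
      by (rule partial_cong_open[OF S]) (rule partial_linear[OF h smooth_on_differentiable[OF F], symmetric])
    finally show ?thesis .
  qed
  have "smooth_on S (\<lambda>w. F w $ a $ b)" for a b by (rule smooth_on_linear[OF S(1) h F])
  then have "partial i (partial j F) u $ a $ b = partial j (partial i F) u $ a $ b" for a b
    unfolding * by (rule mixed_partials[OF S])
  then show ?thesis by (simp add: vec_eq_iff)
qed

text \<open>The connection matrices: with \<open>\<Gamma>\<^sup>l\<^sub>j\<^sub>k\<close> in row
  \<open>l\<close> and column \<open>k\<close>, covariant differentiation becomes
  \<open>\<partial>\<^sub>j\<close> plus a matrix product, so the laws below are matrix
  identities.\<close>

definition chmat :: "(real^'n::finite \<Rightarrow> real^'n^'n) \<Rightarrow> 'n \<Rightarrow> real^'n \<Rightarrow> real^'n^'n" where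
  "chmat G j u = (\<chi> l k. christoffel G l j k u)"

definition chmat_low :: "(real^'n::finite \<Rightarrow> real^'n^'n) \<Rightarrow> 'n \<Rightarrow> real^'n \<Rightarrow> real^'n^'n" where
  "chmat_low G j u = (\<chi> m k. (1/2) * (partial j (\<lambda>w. G w $ k $ m) u + partial k (\<lambda>w. G w $ j $ m) u
     - partial m (\<lambda>w. G w $ j $ k) u))"

definition riemat :: "(real^'n::finite \<Rightarrow> real^'n^'n) \<Rightarrow> 'n \<Rightarrow> 'n \<Rightarrow> real^'n \<Rightarrow> real^'n^'n" where
  "riemat G i j u = (\<chi> l k. riemann G l k i j u)"

lemma chmat_eq: "chmat G j u = matrix_inv (G u) ** chmat_low G j u"
  by (simp add: chmat_def chmat_low_def christoffel_def matrix_matrix_mult_def vec_eq_iff sum_distrib_left mult_ac)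

lemma ricci_eq_riemat: "ricci G u $ j $ k = (\<Sum>i\<in>UNIV. riemat G i j u $ i $ k)"
  by (simp add: ricci_def riemat_def)

locale metric_chart =
  fixes S :: "(real^'n::finite) set" and G :: "real^'n \<Rightarrow> real^'n^'n"
  assumes open_S: "open S" and smooth_G: "smooth_on S G" and pos_def_G: "\<And>u. u \<in> S \<Longrightarrow> pos_def_mat (G u)"
begin

lemma G_symmetric:
  assumes "u \<in> S" shows "G u $ i $ j = G u $ j $ i"
proof -
  have "transpose (G u) $ i $ j = G u $ i $ j"
    using pos_def_G[OF assms] by (simp add: pos_def_mat_def)
  then show ?thesis by (simp add: transpose_def)
qed

lemma invertible_G: "u \<in> S \<Longrightarrow> invertible (G u)"
  by (intro pos_def_mat_invertible pos_def_G)

lemma smooth_entry: "smooth_on S (\<lambda>w. G w $ i $ j)"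
  by (intro smooth_on_nth open_S smooth_G)

lemma smooth_inv: "smooth_on S (\<lambda>u. matrix_inv (G u))"
  by (intro smooth_on_matrix_inv open_S smooth_G invertible_G)

lemma smooth_chmat_low: "smooth_on S (chmat_low G j)"
  unfolding chmat_low_def[abs_def]
  by (intro smooth_on_vec_lambda smooth_on_mult smooth_on_const smooth_on_add smooth_on_diff smooth_on_partial smooth_entry open_S)

lemma smooth_chmat: "smooth_on S (chmat G j)"
  unfolding chmat_eq[abs_def] by (intro smooth_on_matrix_mult open_S smooth_inv smooth_chmat_low)

lemma smooth_christoffel: "smooth_on S (christoffel G l j k)"
proof -
  have "smooth_on S (\<lambda>u. chmat G j u $ l $ k)" by (intro smooth_on_nth open_S smooth_chmat)
  then show ?thesis by (simp add: chmat_def eta_contract_eq)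
qed

lemma smooth_ricci: "smooth_on S (ricci G)"
  unfolding ricci_def[abs_def] riemann_def[abs_def]
  by (intro smooth_on_vec_lambda smooth_on_sum smooth_on_mult smooth_on_add smooth_on_diff smooth_on_partial smooth_christoffel open_S)

lemma G_chmat: "u \<in> S \<Longrightarrow> G u ** chmat G j u = chmat_low G j u"
  by (simp add: chmat_eq matrix_mul_assoc matrix_inv_inverse invertible_G)

lemma christoffel_symmetric:
  assumes "u \<in> S" shows "christoffel G l i j u = christoffel G l j i u"
proof -
  have "partial m (\<lambda>w. G w $ i $ j) u = partial m (\<lambda>w. G w $ j $ i) u" for m
    by (rule partial_cong_open[OF open_S assms]) (rule G_symmetric)
  then show ?thesis unfolding christoffel_def by (simp add: add.commute)
qed

lemma riemat_eq:
  assumes "u \<in> S"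
  shows "riemat G i j u = partial i (chmat G j) u - partial j (chmat G i) u + chmat G i u ** chmat G j u - chmat G j u ** chmat G i u"
proof -
  have h: "bounded_linear (\<lambda>M::real^'n^'n. M $ a $ b)" for a b
    by (intro bounded_linear_compose[OF bounded_linear_vec_nth bounded_linear_vec_nth])
  have "partial i (chmat G j) u $ l $ k = partial i (christoffel G l j k) u" for i j l k
    using partial_linear[OF h[of l k] smooth_on_differentiable[OF smooth_chmat[of j] assms], of i]
    by (simp add: chmat_def eta_contract_eq)
  then show ?thesis
    by (simp add: riemat_def riemann_def vec_eq_iff matrix_matrix_mult_def sum_subtractf)
       (simp add: chmat_def)
qed

lemma partial_inv:
  assumes "u \<in> S"
  shows "partial j (\<lambda>u. matrix_inv (G u)) u = - (matrix_inv (G u) ** partial j G u ** matrix_inv (G u))"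
proof -
  let ?H = "\<lambda>u. matrix_inv (G u)"
  have "0 = partial j (\<lambda>u. ?H u ** G u) u"
  proof -
    have "partial j (\<lambda>u. ?H u ** G u) u = partial j (\<lambda>u. mat 1) u"
      by (rule partial_cong_open[OF open_S assms]) (simp add: matrix_inv_inverse invertible_G)
    then show ?thesis by (simp add: partial_const)
  qed
  also have "\<dots> = ?H u ** partial j G u + partial j ?H u ** G u"
    using smooth_on_differentiable[OF smooth_inv assms] smooth_on_differentiable[OF smooth_G assms]
    by (rule partial_bilinear[OF mat_bilinear])
  finally have "partial j ?H u ** G u = - (?H u ** partial j G u)" by (simp add: eq_neg_iff_add_eq_0 add.commute)
  then have "partial j ?H u ** G u ** ?H u = - (?H u ** partial j G u) ** ?H u" by simp
  then show ?thesis
    using assms by (simp add: matrix_mul_assoc[symmetric] matrix_inv_inverse invertible_G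
        bounded_bilinear.minus_left[OF mat_bilinear])
qed

text \<open>This contraction is the logarithmic derivative of \<open>sqrt (det G)\<close>. Of the
  three terms of the Christoffel symbol, the two with a derivative in a summed direction cancel
  because the metric and its inverse are symmetric.\<close>

lemma trace_chmat:
  assumes "u \<in> S"
  shows "(\<Sum>i\<in>UNIV. christoffel G i i k u) = (1/2) * trace (matrix_inv (G u) ** partial k G u)"
proof -
  let ?H = "\<lambda>i m. matrix_inv (G u) $ i $ m"
  have Hs: "?H i m = ?H m i" for i m
    using arg_cong[OF pos_def_mat_inv_symmetric[OF pos_def_G[OF assms]], of "\<lambda>A. A $ m $ i"]
    by (simp only: transpose_def vec_lambda_beta)
  have d: "partial k G u $ i $ m = partial k (\<lambda>w. G w $ i $ m) u" for k i m
    using partial_linear[OF bounded_linear_compose[OF bounded_linear_vec_nth bounded_linear_vec_nth]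
        smooth_on_differentiable[OF smooth_G assms], of k i m] by simp
  have sym: "partial k (\<lambda>w. G w $ i $ m) u = partial k (\<lambda>w. G w $ m $ i) u" for k i m
    by (rule partial_cong_open[OF open_S assms]) (rule G_symmetric)
  have "(\<Sum>i\<in>UNIV. \<Sum>m\<in>UNIV. ?H i m * partial i (\<lambda>w. G w $ k $ m) u)
      = (\<Sum>i\<in>UNIV. \<Sum>m\<in>UNIV. ?H i m * partial m (\<lambda>w. G w $ i $ k) u)"
  proof (subst sum.swap, intro sum.cong refl)
    fix i m
    show "?H m i * partial m (\<lambda>w. G w $ k $ i) u = ?H i m * partial m (\<lambda>w. G w $ i $ k) u"
      using Hs[of m i] sym[of m k i] by simp
  qed
  then have "(\<Sum>i\<in>UNIV. christoffel G i i k u) = (1/2) * (\<Sum>i\<in>UNIV. \<Sum>m\<in>UNIV. ?H i m * partial k (\<lambda>w. G w $ i $ m) u)"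
    unfolding christoffel_def distrib_left right_diff_distrib sum.distrib sum_subtractf sum_distrib_left[symmetric] by simp
  also have "(\<Sum>i\<in>UNIV. \<Sum>m\<in>UNIV. ?H i m * partial k (\<lambda>w. G w $ i $ m) u) = trace (matrix_inv (G u) ** partial k G u)"
    unfolding trace_def matrix_matrix_mult_def
    by (simp only: vec_lambda_beta, intro sum.cong refl) (simp only: d sym[of k])
  finally show ?thesis .
qed

text \<open>The term that is hardest to see as symmetric is the derivative
  \<open>\<partial>_j\<close> of the contraction \<open>\<Gamma>^i_{ik}\<close>. By
  \<open>trace_chmat\<close> it is a second derivative of \<open>log (sqrt (det G))\<close>, which
  the proof treats through traces: mixed partials of \<open>G\<close> commute and the trace is
  cyclic. The other terms are symmetric because the connection is torsion-free. Symmetry of the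
  Ricci tensor is part of what makes \<open>P\<close> self-adjoint.\<close>

lemma ricci_symmetric:
  assumes u: "u \<in> S"
  shows "transpose (ricci G u) = ricci G u"
proof -
  have diffC: "christoffel G l i j differentiable (at u)" for l i j
    by (rule smooth_on_differentiable[OF smooth_christoffel u])
  have tr: "(\<Sum>i\<in>UNIV. partial j (christoffel G i i k) u) = (\<Sum>i\<in>UNIV. partial k (christoffel G i i j) u)" for j k
  proof -
    have *: "(\<Sum>i\<in>UNIV. partial j (christoffel G i i k) u) =
       (1/2) * (trace (matrix_inv (G u) ** partial j (partial k G) u)
          - trace (matrix_inv (G u) ** partial j G u ** matrix_inv (G u) ** partial k G u))" for j k
    proof -
      have dH: "(\<lambda>u. matrix_inv (G u)) differentiable (at u)" and dG: "partial k G differentiable (at u)" for k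
        by (rule smooth_on_differentiable[OF smooth_inv u] smooth_on_differentiable[OF smooth_on_partial[OF smooth_G] u])+
      have diff: "(\<lambda>u. matrix_inv (G u) ** partial k G u) differentiable (at u)" for k
        by (rule smooth_on_differentiable[OF _ u]) (intro smooth_on_matrix_mult open_S smooth_inv smooth_on_partial smooth_G)
      have "(\<Sum>i\<in>UNIV. partial j (christoffel G i i k) u) = partial j (\<lambda>u. \<Sum>i\<in>UNIV. christoffel G i i k u) u"
        by (rule partial_sum[symmetric]) (rule diffC)
      also have "\<dots> = partial j (\<lambda>u. (1/2) * trace (matrix_inv (G u) ** partial k G u)) u"
        by (rule partial_cong_open[OF open_S u]) (rule trace_chmat)
      also have "\<dots> = (1/2) * trace (partial j (\<lambda>u. matrix_inv (G u) ** partial k G u) u)"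
        by (rule partial_linear[OF bounded_linear_const_mult[OF bounded_linear_trace] diff])
      also have "partial j (\<lambda>u. matrix_inv (G u) ** partial k G u) u
         = matrix_inv (G u) ** partial j (partial k G) u + partial j (\<lambda>u. matrix_inv (G u)) u ** partial k G u"
        by (rule partial_bilinear[OF mat_bilinear dH dG])
      finally show ?thesis unfolding partial_inv[OF u]
        by (simp add: trace_add trace_sub bounded_bilinear.minus_left[OF mat_bilinear])
    qed
    have "trace (matrix_inv (G u) ** partial j G u ** matrix_inv (G u) ** partial k G u)
        = trace (matrix_inv (G u) ** partial k G u ** matrix_inv (G u) ** partial j G u)"
      using trace_mul_sym[of "matrix_inv (G u) ** partial j G u" "matrix_inv (G u) ** partial k G u"]
      by (simp add: matrix_mul_assoc)
    then show ?thesis unfolding * mixed_partials_matrix[OF open_S u smooth_G, of j k] by simp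
  qed
  have 1: "partial i (christoffel G l j k) u = partial i (christoffel G l k j) u" for i j k l
    by (rule partial_cong_open[OF open_S u]) (rule christoffel_symmetric)
  note cs = christoffel_symmetric[OF u]
  have "ricci G u $ j $ k = ricci G u $ k $ j" for j k
  proof -
    have 3: "(\<Sum>i\<in>UNIV. \<Sum>m\<in>UNIV. christoffel G i j m u * christoffel G m i k u)
       = (\<Sum>i\<in>UNIV. \<Sum>m\<in>UNIV. christoffel G i k m u * christoffel G m i j u)"
    proof (subst sum.swap, intro sum.cong refl)
      fix i m
      show "christoffel G m j i u * christoffel G i m k u = christoffel G i k m u * christoffel G m i j u"
        using cs[of m j i] cs[of i m k] by simp
    qed
    have "ricci G u $ j $ k = (\<Sum>i\<in>UNIV. partial i (christoffel G i j k) u) - (\<Sum>i\<in>UNIV. partial j (christoffel G i i k) u)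
       + (\<Sum>i\<in>UNIV. \<Sum>m\<in>UNIV. christoffel G i i m u * christoffel G m j k u)
       - (\<Sum>i\<in>UNIV. \<Sum>m\<in>UNIV. christoffel G i j m u * christoffel G m i k u)" for j k
      by (simp add: ricci_def riemann_def sum.distrib sum_subtractf)
    then show ?thesis using 3 tr[of j k] 1[of _ _ j k] cs[of _ j k] by simp
  qed
  then show ?thesis by (simp add: transpose_def vec_eq_iff)
qed

lemma hessian_symmetric:
  assumes u: "u \<in> S" and f: "smooth_on S f"
  shows "transpose (hessian G f u) = hessian G f u"
  using mixed_partials[OF open_S u f] christoffel_symmetric[OF u]
  by (simp add: hessian_def transpose_def vec_eq_iff)

lemma smooth_hessian: "smooth_on S f \<Longrightarrow> smooth_on S (hessian G f)"
  unfolding hessian_def[abs_def]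
  by (intro smooth_on_vec_lambda smooth_on_sum smooth_on_mult smooth_on_diff smooth_on_partial smooth_christoffel open_S)

end

section \<open>Change of coordinates\<close>

lemma matrix_triple_nth:
  fixes A B M :: "real^'n^'n"
  shows "(transpose A ** M ** B) $ i $ j = (\<Sum>a\<in>UNIV. \<Sum>b\<in>UNIV. A $ a $ i * M $ a $ b * B $ b $ j)"
  unfolding matrix_mul_assoc[symmetric]
  by (simp add: matrix_matrix_mult_def transpose_def sum_distrib_left mult.assoc)

definition jacobian_mat :: "(real^'n::finite \<Rightarrow> real^'n) \<Rightarrow> real^'n \<Rightarrow> real^'n^'n" where
  "jacobian_mat T u = (\<chi> a i. partial i (\<lambda>w. T w $ a) u)"

lemma matrix_frechet_derivative:
  assumes "T differentiable (at u)"
  shows "matrix (frechet_derivative T (at u)) = jacobian_mat T u"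
  using partial_nth[OF assms] by (simp add: matrix_def jacobian_mat_def partial_def[of _ T])

text \<open>In its use \<open>W\<close> is the image of the overlap under the first chart, while
  \<open>V\<close> is the whole image of the second. Besides smoothness of \<open>T\<close> the link
  between the two metrics is the pullback law, from which all other transformation laws are
  derived.\<close>

locale coord_change = src: metric_chart W G + tgt: metric_chart V G'
  for W V :: "(real^'n::finite) set" and G G' :: "real^'n \<Rightarrow> real^'n^'n" +
  fixes T :: "real^'n \<Rightarrow> real^'n"
  assumes smooth_T: "smooth_on W T" and T_in: "\<And>u. u \<in> W \<Longrightarrow> T u \<in> V"
    and G_pullback: "\<And>u. u \<in> W \<Longrightarrow> G u = transpose (jacobian_mat T u) ** G' (T u) ** jacobian_mat T u"
begin

abbreviation J :: "real^'n \<Rightarrow> real^'n^'n" where "J \<equiv> jacobian_mat T"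

lemma smooth_T_nth: "smooth_on W (\<lambda>w. T w $ a)"
  by (intro smooth_on_nth src.open_S smooth_T)

lemma smooth_J: "smooth_on W J"
  unfolding jacobian_mat_def[abs_def] by (intro smooth_on_vec_lambda smooth_on_partial smooth_T_nth src.open_S)

lemma partial_J_nth:
  assumes "u \<in> W"
  shows "partial i J u $ a $ j = partial i (partial j (\<lambda>w. T w $ a)) u"
  using partial_linear[OF bounded_linear_compose[OF bounded_linear_vec_nth bounded_linear_vec_nth]
      smooth_on_differentiable[OF smooth_J assms], of i a j]
  by (simp add: jacobian_mat_def eta_contract_eq)

lemma partial_J_symmetric:
  assumes "u \<in> W"
  shows "partial i J u $ a $ j = partial j J u $ a $ i"
  unfolding partial_J_nth[OF assms] by (rule mixed_partials[OF src.open_S assms smooth_T_nth])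

lemma partial_comp:
  assumes "u \<in> W" "f differentiable (at (T u))"
  shows "partial i (\<lambda>w. f (T w)) u = (\<Sum>a\<in>UNIV. J u $ a $ i *\<^sub>R partial a f (T u))"
  using partial_chain[OF smooth_on_differentiable[OF smooth_T assms(1)] assms(2)] by (simp add: jacobian_mat_def)

lemma differentiable_comp:
  assumes "u \<in> W" "f differentiable (at (T u))"
  shows "(\<lambda>w. f (T w)) differentiable (at u)"
  using differentiable_chain_at[OF smooth_on_differentiable[OF smooth_T assms(1)] assms(2)] by (simp add: o_def)

lemma invertible_J:
  assumes "u \<in> W"
  shows "invertible (J u)"
proof -
  have "matrix_inv (G u) ** transpose (J u) ** G' (T u) ** J u = mat 1"
    using matrix_inv_inverse(2)[OF src.invertible_G[OF assms]] G_pullback[OF assms]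
    by (simp add: matrix_mul_assoc)
  then show ?thesis using invertible_left_inverse by blast
qed

text \<open>Product rule on \<open>J^T G' J\<close>. The term that differentiates the right factor
  \<open>J\<close> is rewritten, by symmetry of \<open>G'\<close>, so that the first two sums have
  the same shape with \<open>j\<close> and \<open>m\<close> exchanged; the third comes from the
  chain rule.\<close>

lemma partial_G:
  assumes u: "u \<in> W"
  shows "partial i (\<lambda>w. G w $ j $ m) u =
    (\<Sum>a\<in>UNIV. \<Sum>b\<in>UNIV. partial i J u $ a $ j * G' (T u) $ a $ b * J u $ b $ m)
    + (\<Sum>a\<in>UNIV. \<Sum>b\<in>UNIV. partial i J u $ a $ m * G' (T u) $ a $ b * J u $ b $ j)
    + (\<Sum>c\<in>UNIV. \<Sum>a\<in>UNIV. \<Sum>b\<in>UNIV. J u $ c $ i * partial c (\<lambda>v. G' v $ a $ b) (T u) * J u $ a $ j * J u $ b $ m)"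
proof -
  have h: "bounded_linear (\<lambda>M::real^'n^'n. M $ a $ b)" for a b
    by (intro bounded_linear_compose[OF bounded_linear_vec_nth bounded_linear_vec_nth])
  have dJ: "J differentiable (at u)" by (rule smooth_on_differentiable[OF smooth_J u])
  have dJn: "(\<lambda>w. J w $ a $ b) differentiable (at u)" for a b
    using bounded_linear.has_derivative[OF h] dJ unfolding differentiable_def by blast
  have pJn: "partial i (\<lambda>w. J w $ a $ b) u = partial i J u $ a $ b" for a b
    by (rule partial_linear[OF h dJ])
  have dG: "(\<lambda>v. G' v $ a $ b) differentiable (at (T u))" for a b
    by (rule smooth_on_differentiable[OF tgt.smooth_entry T_in[OF u]])
  have dGT: "(\<lambda>w. G' (T w) $ a $ b) differentiable (at u)" for a b
    by (rule differentiable_comp[OF u dG])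
  have pGT: "partial i (\<lambda>w. G' (T w) $ a $ b) u = (\<Sum>c\<in>UNIV. J u $ c $ i * partial c (\<lambda>v. G' v $ a $ b) (T u))" for a b
    using partial_comp[OF u dG] by simp
  have d1: "(\<lambda>w. J w $ a $ j * G' (T w) $ a $ b) differentiable (at u)" for a b
    by (rule differentiable_mult[OF dJn dGT])
  have d2: "(\<lambda>w. J w $ a $ j * G' (T w) $ a $ b * J w $ b $ m) differentiable (at u)" for a b
    by (rule differentiable_mult[OF d1 dJn])
  have d3: "(\<lambda>w. \<Sum>b\<in>UNIV. J w $ a $ j * G' (T w) $ a $ b * J w $ b $ m) differentiable (at u)" for a
    by (rule differentiable_sum) (simp_all add: d2)
  have "partial i (\<lambda>w. G w $ j $ m) u = partial i (\<lambda>w. \<Sum>a\<in>UNIV. \<Sum>b\<in>UNIV. J w $ a $ j * G' (T w) $ a $ b * J w $ b $ m) u"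
    by (rule partial_cong_open[OF src.open_S u]) (simp add: G_pullback matrix_triple_nth)
  also have "\<dots> = (\<Sum>a\<in>UNIV. \<Sum>b\<in>UNIV. partial i (\<lambda>w. J w $ a $ j * G' (T w) $ a $ b * J w $ b $ m) u)"
    by (simp only: partial_sum[OF d3] partial_sum[OF d2])
  also have "\<dots> = (\<Sum>a\<in>UNIV. \<Sum>b\<in>UNIV.
      (J u $ a $ j * G' (T u) $ a $ b) * partial i J u $ b $ m +
      (J u $ a $ j * (\<Sum>c\<in>UNIV. J u $ c $ i * partial c (\<lambda>v. G' v $ a $ b) (T u)) + partial i J u $ a $ j * G' (T u) $ a $ b) * J u $ b $ m)"
    by (simp only: partial_mult[OF d1 dJn] partial_mult[OF dJn dGT] pJn pGT)
  also have "\<dots> = (\<Sum>a\<in>UNIV. \<Sum>b\<in>UNIV. (J u $ a $ j * G' (T u) $ a $ b) * partial i J u $ b $ m)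
      + (\<Sum>a\<in>UNIV. \<Sum>b\<in>UNIV. \<Sum>c\<in>UNIV. J u $ c $ i * partial c (\<lambda>v. G' v $ a $ b) (T u) * J u $ a $ j * J u $ b $ m)
      + (\<Sum>a\<in>UNIV. \<Sum>b\<in>UNIV. partial i J u $ a $ j * G' (T u) $ a $ b * J u $ b $ m)"
  proof -
    have "x * y * z + (x * (\<Sum>c\<in>UNIV. p c * q c) + r * y) * w = x * y * z + (\<Sum>c\<in>UNIV. p c * q c * x * w) + r * y * w"
      for x y z r w :: real and p q :: "'n \<Rightarrow> real"
      by (simp add: distrib_right distrib_left sum_distrib_left sum_distrib_right mult_ac)
    then show ?thesis by (simp only: sum.distrib)
  qed
  also have "(\<Sum>a\<in>UNIV. \<Sum>b\<in>UNIV. (J u $ a $ j * G' (T u) $ a $ b) * partial i J u $ b $ m)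
      = (\<Sum>a\<in>UNIV. \<Sum>b\<in>UNIV. partial i J u $ a $ m * G' (T u) $ a $ b * J u $ b $ j)"
  proof (subst sum.swap, intro sum.cong refl)
    fix a b
    show "J u $ b $ j * G' (T u) $ b $ a * partial i J u $ a $ m = partial i J u $ a $ m * G' (T u) $ a $ b * J u $ b $ j"
      using tgt.G_symmetric[OF T_in[OF u], of a b] by simp
  qed
  also have "(\<Sum>a\<in>UNIV. \<Sum>b\<in>UNIV. \<Sum>c\<in>UNIV. J u $ c $ i * partial c (\<lambda>v. G' v $ a $ b) (T u) * J u $ a $ j * J u $ b $ m)
     = (\<Sum>c\<in>UNIV. \<Sum>a\<in>UNIV. \<Sum>b\<in>UNIV. J u $ c $ i * partial c (\<lambda>v. G' v $ a $ b) (T u) * J u $ a $ j * J u $ b $ m)"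
    by (rule sum3_rotate[symmetric])
  finally show ?thesis by simp
qed

text \<open>Of the six terms with second derivatives of \<open>T\<close>, four cancel by the
  symmetry of second derivatives, and the other two agree and produce
  \<open>J^T G' \<partial>_j J\<close>. The terms with derivatives of \<open>G'\<close> recombine to
  the lowered symbols of \<open>G'\<close>.\<close>

lemma chmat_low_law:
  assumes u: "u \<in> W"
  shows "chmat_low G j u = transpose (J u) ** (\<Sum>b\<in>UNIV. J u $ b $ j *\<^sub>R chmat_low G' b (T u)) ** J u
    + transpose (J u) ** G' (T u) ** partial j J u"
proof -
  define P where "P i j m = (\<Sum>a\<in>UNIV. \<Sum>b\<in>UNIV. partial i J u $ a $ j * G' (T u) $ a $ b * J u $ b $ m)" for i j m
  define dg where "dg c a b = partial c (\<lambda>v. G' v $ a $ b) (T u)" for c a b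
  define D where "D i j m = (\<Sum>c\<in>UNIV. \<Sum>a\<in>UNIV. \<Sum>b\<in>UNIV. J u $ c $ i * dg c a b * J u $ a $ j * J u $ b $ m)" for i j m
  have pG: "partial i (\<lambda>w. G w $ j $ m) u = P i j m + P i m j + D i j m" for i j m
    unfolding P_def D_def dg_def by (rule partial_G[OF u])
  have Psym: "P i j m = P j i m" for i j m
    unfolding P_def by (simp only: partial_J_symmetric[OF u, of i _ j])
  have "chmat_low G j u $ m $ k =
    (transpose (J u) ** (\<Sum>b\<in>UNIV. J u $ b $ j *\<^sub>R chmat_low G' b (T u)) ** J u) $ m $ k
    + (transpose (J u) ** G' (T u) ** partial j J u) $ m $ k" for m k
  proof -
    have "chmat_low G j u $ m $ k = (1/2) * ((P j k m + P j m k + D j k m) + (P k j m + P k m j + D k j m) - (P m j k + P m k j + D m j k))"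
      by (simp add: chmat_low_def pG)
    then have lhs: "chmat_low G j u $ m $ k = P j k m + (1/2) * (D j k m + D k j m - D m j k)"
      using Psym[of j k m] Psym[of j m k] Psym[of k m j] by (simp add: field_simps)
    have P2: "P j k m = (transpose (J u) ** G' (T u) ** partial j J u) $ m $ k"
      unfolding P_def matrix_triple_nth
    proof (subst sum.swap, intro sum.cong refl)
      fix a b
      show "partial j J u $ b $ k * G' (T u) $ b $ a * J u $ a $ m = J u $ a $ m * G' (T u) $ a $ b * partial j J u $ b $ k"
        using tgt.G_symmetric[OF T_in[OF u], of a b] by simp
    qed
    have D1: "D j k m = (\<Sum>a\<in>UNIV. \<Sum>c\<in>UNIV. \<Sum>b\<in>UNIV. J u $ b $ j * dg b c a * J u $ c $ k * J u $ a $ m)"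
      unfolding D_def by (subst sum3_rotate, subst sum.swap) simp
    have D2: "D k j m = (\<Sum>a\<in>UNIV. \<Sum>c\<in>UNIV. \<Sum>b\<in>UNIV. J u $ c $ k * dg c b a * J u $ b $ j * J u $ a $ m)"
      unfolding D_def by (subst sum3_rotate, subst sum3_rotate) simp
    have D3: "D m j k = (\<Sum>a\<in>UNIV. \<Sum>c\<in>UNIV. \<Sum>b\<in>UNIV. J u $ a $ m * dg a b c * J u $ b $ j * J u $ c $ k)"
      unfolding D_def by (intro sum.cong refl sum.swap)
    have "(transpose (J u) ** (\<Sum>b\<in>UNIV. J u $ b $ j *\<^sub>R chmat_low G' b (T u)) ** J u) $ m $ k
       = (\<Sum>a\<in>UNIV. \<Sum>c\<in>UNIV. \<Sum>b\<in>UNIV. (1/2) * (J u $ b $ j * dg b c a * J u $ c $ k * J u $ a $ m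
         + J u $ c $ k * dg c b a * J u $ b $ j * J u $ a $ m - J u $ a $ m * dg a b c * J u $ b $ j * J u $ c $ k))"
      unfolding matrix_triple_nth chmat_low_def dg_def[symmetric]
      by (intro sum.cong refl) (simp add: sum_distrib_left sum_distrib_right algebra_simps)
    also have "\<dots> = (1/2) * (D j k m + D k j m - D m j k)"
      unfolding D1 D2 D3 by (simp add: sum.distrib sum_subtractf flip: sum_distrib_left sum_divide_distrib)
    finally show ?thesis unfolding lhs P2 by simp
  qed
  then show ?thesis by (simp add: vec_eq_iff)
qed

definition pullback_conn :: "'n \<Rightarrow> real^'n \<Rightarrow> real^'n^'n" where
  "pullback_conn j u = (\<Sum>b\<in>UNIV. J u $ b $ j *\<^sub>R chmat G' b (T u))"

text \<open>The law of the lowered symbols with the invertible factor \<open>J^T G'\<close>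
  cancelled: the transformation of a connection under the gauge change \<open>J\<close>.\<close>

lemma chmat_law:
  assumes u: "u \<in> W"
  shows "J u ** chmat G j u = pullback_conn j u ** J u + partial j J u"
proof -
  let ?A = "transpose (J u) ** G' (T u)"
  have inv: "invertible ?A"
    by (intro invertible_mult transpose_invertible invertible_J u tgt.invertible_G T_in)
  have "?A ** (J u ** chmat G j u) = chmat_low G j u"
    using src.G_chmat[OF u, of j] G_pullback[OF u] by (simp add: matrix_mul_assoc)
  also have "\<dots> = ?A ** (pullback_conn j u ** J u + partial j J u)"
    unfolding chmat_low_law[OF u] pullback_conn_def
    by (simp add: mat_mult_distribs matrix_mul_assoc[symmetric] tgt.G_chmat[OF T_in[OF u], symmetric])
  finally have "matrix_inv ?A ** (?A ** (J u ** chmat G j u)) = matrix_inv ?A ** (?A ** (pullback_conn j u ** J u + partial j J u))"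
    by (rule arg_cong)
  moreover have cancel: "matrix_inv ?A ** (?A ** X) = X" for X
    unfolding matrix_mul_assoc[of "matrix_inv ?A" ?A] matrix_inv_inverse(2)[OF inv] by (rule matrix_mul_lid)
  ultimately show ?thesis unfolding cancel by blast
qed

lemma partial_pullback_conn:
  assumes u: "u \<in> W"
  shows "pullback_conn j differentiable (at u)"
    "partial i (pullback_conn j) u = (\<Sum>b\<in>UNIV. \<Sum>c\<in>UNIV. (J u $ b $ j * J u $ c $ i) *\<^sub>R partial c (chmat G' b) (T u))
      + (\<Sum>b\<in>UNIV. partial i J u $ b $ j *\<^sub>R chmat G' b (T u))"
proof -
  have h: "bounded_linear (\<lambda>M::real^'n^'n. M $ a $ b)" for a b
    by (intro bounded_linear_compose[OF bounded_linear_vec_nth bounded_linear_vec_nth])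
  have dJ: "J differentiable (at u)" by (rule smooth_on_differentiable[OF smooth_J u])
  have dJn: "(\<lambda>w. J w $ a $ b) differentiable (at u)" for a b
    using bounded_linear.has_derivative[OF h] dJ unfolding differentiable_def by blast
  have pJn: "partial i (\<lambda>w. J w $ a $ b) u = partial i J u $ a $ b" for a b
    by (rule partial_linear[OF h dJ])
  have dC: "chmat G' b differentiable (at (T u))" for b
    by (rule smooth_on_differentiable[OF tgt.smooth_chmat T_in[OF u]])
  note dCT = differentiable_comp[OF u dC]
  have d: "(\<lambda>u. J u $ b $ j *\<^sub>R chmat G' b (T u)) differentiable (at u)" for b
    using bounded_bilinear.FDERIV[OF bounded_bilinear_scaleR] dJn dCT unfolding differentiable_def by blast
  show "pullback_conn j differentiable (at u)"
    unfolding pullback_conn_def[abs_def] by (rule differentiable_sum) (simp_all add: d)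
  have "partial i (pullback_conn j) u = (\<Sum>b\<in>UNIV. partial i (\<lambda>u. J u $ b $ j *\<^sub>R chmat G' b (T u)) u)"
    unfolding pullback_conn_def[abs_def] by (rule partial_sum) (rule d)
  also have "\<dots> = (\<Sum>b\<in>UNIV. J u $ b $ j *\<^sub>R (\<Sum>c\<in>UNIV. J u $ c $ i *\<^sub>R partial c (chmat G' b) (T u)) + partial i J u $ b $ j *\<^sub>R chmat G' b (T u))"
    by (simp only: partial_bilinear[OF bounded_bilinear_scaleR dJn dCT] pJn partial_comp[OF u dC])
  finally show "partial i (pullback_conn j) u = (\<Sum>b\<in>UNIV. \<Sum>c\<in>UNIV. (J u $ b $ j * J u $ c $ i) *\<^sub>R partial c (chmat G' b) (T u))
      + (\<Sum>b\<in>UNIV. partial i J u $ b $ j *\<^sub>R chmat G' b (T u))"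
    by (simp add: sum.distrib scaleR_sum_right)
qed

text \<open>A change of coordinates acts on the connection matrices as a gauge transformation, under which
  the curvature is conjugated.\<close>

lemma riemat_law:
  assumes u: "u \<in> W"
  shows "J u ** riemat G i j u = (\<Sum>b\<in>UNIV. \<Sum>c\<in>UNIV. (J u $ b $ j * J u $ c $ i) *\<^sub>R riemat G' c b (T u)) ** J u"
proof -
  have dJ: "J differentiable (at u)" by (rule smooth_on_differentiable[OF smooth_J u])
  have dpJ: "partial j J differentiable (at u)" for j by (rule smooth_on_differentiable[OF smooth_on_partial[OF smooth_J] u])
  have dC: "chmat G j differentiable (at u)" for j by (rule smooth_on_differentiable[OF src.smooth_chmat u])
  have dNJ: "(\<lambda>u. pullback_conn j u ** J u) differentiable (at u)" for j
    using bounded_bilinear.FDERIV[OF mat_bilinear] partial_pullback_conn(1)[OF u] dJ unfolding differentiable_def by blast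
  have der: "J u ** partial i (chmat G j) u = pullback_conn j u ** partial i J u + partial i (pullback_conn j) u ** J u + partial i (partial j J) u - partial i J u ** chmat G j u" for i j
  proof -
    have "partial i (\<lambda>u. J u ** chmat G j u) u = partial i (\<lambda>u. pullback_conn j u ** J u + partial j J u) u"
      by (rule partial_cong_open[OF src.open_S u]) (rule chmat_law)
    also have "\<dots> = pullback_conn j u ** partial i J u + partial i (pullback_conn j) u ** J u + partial i (partial j J) u"
      by (simp only: partial_add[OF dNJ dpJ] partial_bilinear[OF mat_bilinear partial_pullback_conn(1)[OF u] dJ])
    finally show ?thesis by (simp add: partial_bilinear[OF mat_bilinear dJ dC] algebra_simps)
  qed
  have quad: "J u ** (chmat G i u ** chmat G j u) = pullback_conn i u ** pullback_conn j u ** J u + pullback_conn i u ** partial j J u + partial i J u ** chmat G j u" for i j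
  proof -
    have "J u ** (chmat G i u ** chmat G j u) = (pullback_conn i u ** J u + partial i J u) ** chmat G j u"
      by (simp add: matrix_mul_assoc chmat_law[OF u])
    also have "\<dots> = pullback_conn i u ** (J u ** chmat G j u) + partial i J u ** chmat G j u"
      by (simp add: mat_mult_distribs matrix_mul_assoc)
    finally show ?thesis by (simp add: chmat_law[OF u] mat_mult_distribs matrix_mul_assoc)
  qed
  \<comment> \<open>The inhomogeneous terms go: \<open>\<partial>_i J\<close> times
    \<open>chmat G j\<close> cancels between \<open>der\<close> and \<open>quad\<close>, and what is
    symmetric in \<open>i\<close> and \<open>j\<close> drops out of the difference.\<close>
  have "J u ** riemat G i j u = (partial i (pullback_conn j) u - partial j (pullback_conn i) u + pullback_conn i u ** pullback_conn j u - pullback_conn j u ** pullback_conn i u) ** J u"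
    unfolding src.riemat_eq[OF u] mat_mult_distribs der quad mixed_partials_matrix[OF src.open_S u smooth_J, of i j]
    by (simp add: algebra_simps)
  also have "partial i (pullback_conn j) u - partial j (pullback_conn i) u + pullback_conn i u ** pullback_conn j u - pullback_conn j u ** pullback_conn i u
     = (\<Sum>b\<in>UNIV. \<Sum>c\<in>UNIV. (J u $ b $ j * J u $ c $ i) *\<^sub>R riemat G' c b (T u))"
  proof -
    have NN: "pullback_conn i u ** pullback_conn j u = (\<Sum>b\<in>UNIV. \<Sum>c\<in>UNIV. (J u $ b $ j * J u $ c $ i) *\<^sub>R (chmat G' c (T u) ** chmat G' b (T u)))" for i j
      unfolding pullback_conn_def mat_mult_distribs by (simp add: scaleR_sum_right mult.commute)
    have sw: "(\<Sum>b\<in>UNIV. \<Sum>c\<in>UNIV. (J u $ b $ i * J u $ c $ j) *\<^sub>R F b c)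
       = (\<Sum>b\<in>UNIV. \<Sum>c\<in>UNIV. (J u $ b $ j * J u $ c $ i) *\<^sub>R F c b)" for F :: "'n \<Rightarrow> 'n \<Rightarrow> real^'n^'n"
      by (subst sum.swap) (simp add: mult.commute)
    have "partial i J u $ b $ j = partial j J u $ b $ i" for b by (rule partial_J_symmetric[OF u])
    then show ?thesis
      unfolding partial_pullback_conn(2)[OF u] NN[of i j] NN[of j i] sw[of "\<lambda>b c. partial c (chmat G' b) (T u)"]
        sw[of "\<lambda>b c. chmat G' c (T u) ** chmat G' b (T u)"] tgt.riemat_eq[OF T_in[OF u]]
      by (simp add: sum.distrib sum_subtractf scaleR_right_distrib scaleR_right_diff_distrib)
  qed
  finally show ?thesis .
qed

text \<open>Solving \<open>riemat_law\<close> for the curvature matrix introduces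
  \<open>J^-1\<close> on the upper index; the trace contracts it with one factor \<open>J\<close> to
  a Kronecker delta, and the factors on the two free indices are left.\<close>

lemma ricci_law:
  assumes u: "u \<in> W"
  shows "ricci G u = transpose (J u) ** ricci G' (T u) ** J u"
proof -
  let ?Ji = "matrix_inv (J u)"
  note Jinv = matrix_inv_inverse[OF invertible_J[OF u]]
  define X where "X b c = riemat G' c b (T u) ** J u" for b c
  have "ricci G u $ j $ k = (transpose (J u) ** ricci G' (T u) ** J u) $ j $ k" for j k
  proof -
    have R: "riemat G i j u = ?Ji ** (\<Sum>b\<in>UNIV. \<Sum>c\<in>UNIV. (J u $ b $ j * J u $ c $ i) *\<^sub>R X b c)" for i
    proof -
      have "riemat G i j u = ?Ji ** (J u ** riemat G i j u)" by (simp add: matrix_mul_assoc Jinv)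
      then show ?thesis unfolding riemat_law[OF u] X_def by (simp add: mat_mult_distribs)
    qed
    have delta: "(\<Sum>i\<in>UNIV. J u $ c $ i * ?Ji $ i $ a) = (if c = a then 1 else 0)" for c a
      using Jinv(1) by (simp add: matrix_matrix_mult_def mat_def vec_eq_iff)
    have "ricci G u $ j $ k = (\<Sum>i\<in>UNIV. \<Sum>a\<in>UNIV. \<Sum>b\<in>UNIV. \<Sum>c\<in>UNIV. ?Ji $ i $ a * (J u $ b $ j * J u $ c $ i * X b c $ a $ k))"
      unfolding ricci_eq_riemat R matrix_matrix_mult_def
      by (simp add: sum_distrib_left mult.assoc)
    also have "\<dots> = (\<Sum>a\<in>UNIV. \<Sum>b\<in>UNIV. \<Sum>i\<in>UNIV. \<Sum>c\<in>UNIV. ?Ji $ i $ a * (J u $ b $ j * J u $ c $ i * X b c $ a $ k))"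
      by (rule sum3_rotate)
    also have "\<dots> = (\<Sum>a\<in>UNIV. \<Sum>b\<in>UNIV. \<Sum>c\<in>UNIV. \<Sum>i\<in>UNIV. ?Ji $ i $ a * (J u $ b $ j * J u $ c $ i * X b c $ a $ k))"
      by (intro sum.cong refl sum.swap)
    also have "\<dots> = (\<Sum>a\<in>UNIV. \<Sum>b\<in>UNIV. \<Sum>c\<in>UNIV. J u $ b $ j * X b c $ a $ k * (\<Sum>i\<in>UNIV. J u $ c $ i * ?Ji $ i $ a))"
      by (simp add: sum_distrib_left mult_ac)
    also have "\<dots> = (\<Sum>a\<in>UNIV. \<Sum>b\<in>UNIV. J u $ b $ j * X b a $ a $ k)"
      unfolding delta by (simp add: if_distrib[of "\<lambda>x. _ * x"] cong: if_cong)
    also have "\<dots> = (\<Sum>a\<in>UNIV. \<Sum>b\<in>UNIV. \<Sum>d\<in>UNIV. J u $ b $ j * riemat G' a b (T u) $ a $ d * J u $ d $ k)"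
      by (simp add: X_def matrix_matrix_mult_def sum_distrib_left mult.assoc)
    also have "\<dots> = (\<Sum>b\<in>UNIV. \<Sum>d\<in>UNIV. \<Sum>a\<in>UNIV. J u $ b $ j * riemat G' a b (T u) $ a $ d * J u $ d $ k)"
      by (rule sum3_rotate)
    also have "\<dots> = (transpose (J u) ** ricci G' (T u) ** J u) $ j $ k"
      unfolding matrix_triple_nth ricci_eq_riemat by (simp add: sum_distrib_left sum_distrib_right)
    finally show ?thesis .
  qed
  then show ?thesis by (simp add: vec_eq_iff)
qed

text \<open>The term with \<open>\<partial>_i J\<close> in the second derivatives of
  \<open>f' \<circ> T\<close> is exactly the inhomogeneous term of the Christoffel law, so it
  cancels. The second claim, the law of the differential, serves for the gradient norm.\<close>

lemma hessian_law:
  assumes u: "u \<in> W" and f': "smooth_on V f'" and f: "\<And>w. w \<in> W \<Longrightarrow> f w = f' (T w)"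
  shows "hessian G f u = transpose (J u) ** hessian G' f' (T u) ** J u"
    and "partial j f u = (\<Sum>a\<in>UNIV. J u $ a $ j * partial a f' (T u))"
proof -
  have df': "f' differentiable (at (T w))" if "w \<in> W" for w
    by (rule smooth_on_differentiable[OF f' T_in[OF that]])
  have dpf': "partial a f' differentiable (at (T w))" if "w \<in> W" for w a
    by (rule smooth_on_differentiable[OF smooth_on_partial[OF f'] T_in[OF that]])
  have h: "bounded_linear (\<lambda>M::real^'n^'n. M $ a $ b)" for a b
    by (intro bounded_linear_compose[OF bounded_linear_vec_nth bounded_linear_vec_nth])
  have dJ: "J differentiable (at u)" by (rule smooth_on_differentiable[OF smooth_J u])
  have dJn: "(\<lambda>w. J w $ a $ b) differentiable (at u)" for a b
    using bounded_linear.has_derivative[OF h] dJ unfolding differentiable_def by blast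
  have pJn: "partial i (\<lambda>w. J w $ a $ b) u = partial i J u $ a $ b" for i a b
    by (rule partial_linear[OF h dJ])
  have p1: "partial j f w = (\<Sum>a\<in>UNIV. J w $ a $ j * partial a f' (T w))" if "w \<in> W" for w j
    using partial_cong_open[OF src.open_S that f, where i = j] partial_comp[OF that df'[OF that], where i = j] by simp
  then show "partial j f u = (\<Sum>a\<in>UNIV. J u $ a $ j * partial a f' (T u))" using u .
  note dpT = differentiable_comp[OF u dpf'[OF u]]
  have d: "(\<lambda>w. J w $ a $ j * partial a f' (T w)) differentiable (at u)" for a j
    by (rule differentiable_mult[OF dJn dpT])
  have p2: "partial i (partial j f) u = (\<Sum>a\<in>UNIV. \<Sum>b\<in>UNIV. J u $ a $ j * (J u $ b $ i * partial b (partial a f') (T u)))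
      + (\<Sum>a\<in>UNIV. partial i J u $ a $ j * partial a f' (T u))" for i j
  proof -
    have "partial i (partial j f) u = partial i (\<lambda>w. \<Sum>a\<in>UNIV. J w $ a $ j * partial a f' (T w)) u"
      by (rule partial_cong_open[OF src.open_S u p1])
    also have "\<dots> = (\<Sum>a\<in>UNIV. J u $ a $ j * (\<Sum>b\<in>UNIV. J u $ b $ i *\<^sub>R partial b (partial a f') (T u)) + partial i J u $ a $ j * partial a f' (T u))"
      by (simp only: partial_sum[OF d] partial_mult[OF dJn dpT] pJn partial_comp[OF u dpf'[OF u]])
    finally show ?thesis by (simp add: sum.distrib sum_distrib_left)
  qed
  have chr: "(\<Sum>l\<in>UNIV. christoffel G l i j u * partial l f u) =
     (\<Sum>a\<in>UNIV. (\<Sum>b\<in>UNIV. \<Sum>c\<in>UNIV. J u $ b $ i * christoffel G' a b c (T u) * J u $ c $ j) * partial a f' (T u))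
      + (\<Sum>a\<in>UNIV. partial i J u $ a $ j * partial a f' (T u))" for i j
  proof -
    have "(J u ** chmat G i u) $ a $ j = (pullback_conn i u ** J u + partial i J u) $ a $ j" for a
      by (simp only: chmat_law[OF u])
    then have law: "(\<Sum>l\<in>UNIV. J u $ a $ l * christoffel G l i j u) =
       (\<Sum>b\<in>UNIV. \<Sum>c\<in>UNIV. J u $ b $ i * christoffel G' a b c (T u) * J u $ c $ j) + partial i J u $ a $ j" for a
      by (simp add: matrix_matrix_mult_def chmat_def pullback_conn_def sum_distrib_right) (subst sum.swap, simp)
    have "(\<Sum>l\<in>UNIV. christoffel G l i j u * partial l f u) = (\<Sum>l\<in>UNIV. \<Sum>a\<in>UNIV. J u $ a $ l * christoffel G l i j u * partial a f' (T u))"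
      unfolding p1[OF u] by (simp add: sum_distrib_left mult_ac)
    also have "\<dots> = (\<Sum>a\<in>UNIV. (\<Sum>l\<in>UNIV. J u $ a $ l * christoffel G l i j u) * partial a f' (T u))"
      unfolding sum_distrib_right by (rule sum.swap)
    finally show ?thesis unfolding law by (simp add: distrib_right sum.distrib)
  qed
  have "hessian G f u $ i $ j = (transpose (J u) ** hessian G' f' (T u) ** J u) $ i $ j" for i j
  proof -
    have e1: "(\<Sum>a\<in>UNIV. \<Sum>b\<in>UNIV. J u $ a $ j * (J u $ b $ i * partial b (partial a f') (T u)))
       = (\<Sum>b\<in>UNIV. \<Sum>c\<in>UNIV. J u $ b $ i * partial b (partial c f') (T u) * J u $ c $ j)"
      by (subst sum.swap) (simp add: mult_ac)
    have e2: "(\<Sum>a\<in>UNIV. (\<Sum>b\<in>UNIV. \<Sum>c\<in>UNIV. J u $ b $ i * christoffel G' a b c (T u) * J u $ c $ j) * partial a f' (T u))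
       = (\<Sum>b\<in>UNIV. \<Sum>c\<in>UNIV. J u $ b $ i * (\<Sum>a\<in>UNIV. christoffel G' a b c (T u) * partial a f' (T u)) * J u $ c $ j)"
      unfolding sum_distrib_right sum_distrib_left by (subst sum3_rotate) (simp add: mult_ac)
    have "hessian G f u $ i $ j = partial i (partial j f) u - (\<Sum>l\<in>UNIV. christoffel G l i j u * partial l f u)"
      by (simp add: hessian_def)
    also have "\<dots> = (\<Sum>b\<in>UNIV. \<Sum>c\<in>UNIV. J u $ b $ i * partial b (partial c f') (T u) * J u $ c $ j)
       - (\<Sum>b\<in>UNIV. \<Sum>c\<in>UNIV. J u $ b $ i * (\<Sum>a\<in>UNIV. christoffel G' a b c (T u) * partial a f' (T u)) * J u $ c $ j)"
      unfolding p2 chr e1 e2 by simp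
    also have "\<dots> = (\<Sum>b\<in>UNIV. \<Sum>c\<in>UNIV. J u $ b $ i * hessian G' f' (T u) $ b $ c * J u $ c $ j)"
      by (simp add: hessian_def right_diff_distrib left_diff_distrib sum_subtractf)
    finally show ?thesis unfolding matrix_triple_nth .
  qed
  then show "hessian G f u = transpose (J u) ** hessian G' f' (T u) ** J u" by (simp add: vec_eq_iff)
qed

lemma inv_law:
  assumes u: "u \<in> W"
  shows "matrix_inv (G u) = matrix_inv (J u) ** matrix_inv (G' (T u)) ** transpose (matrix_inv (J u))"
proof -
  note Jinv = matrix_inv_inverse[OF invertible_J[OF u]]
  note Ginv = matrix_inv_inverse[OF tgt.invertible_G[OF T_in[OF u]]]
  let ?B = "matrix_inv (J u) ** matrix_inv (G' (T u)) ** transpose (matrix_inv (J u))"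
  have Jt: "transpose (matrix_inv (J u)) ** transpose (J u) = mat 1"
    by (metis Jinv(1) matrix_transpose_mul transpose_mat)
  have "?B ** G u = matrix_inv (J u) ** matrix_inv (G' (T u)) ** (transpose (matrix_inv (J u)) ** transpose (J u)) ** G' (T u) ** J u"
    unfolding G_pullback[OF u] by (simp only: matrix_mul_assoc)
  also have "\<dots> = matrix_inv (J u) ** (matrix_inv (G' (T u)) ** G' (T u)) ** J u"
    unfolding Jt by (simp add: matrix_mul_assoc)
  also have "\<dots> = mat 1" by (simp add: Ginv Jinv)
  finally have 1: "?B ** G u = mat 1" .
  then have 2: "G u ** ?B = mat 1" using matrix_left_right_inverse by blast
  show ?thesis by (rule matrix_inv_unique[OF 2 1])
qed

lemma inv_mult_law:
  assumes u: "u \<in> W"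
  shows "matrix_inv (G u) ** (transpose (J u) ** X ** J u) = matrix_inv (J u) ** (matrix_inv (G' (T u)) ** X) ** J u"
proof -
  have Jt: "transpose (matrix_inv (J u)) ** transpose (J u) = mat 1"
    by (metis matrix_inv_inverse(1)[OF invertible_J[OF u]] matrix_transpose_mul transpose_mat)
  have "matrix_inv (G u) ** (transpose (J u) ** X ** J u)
    = matrix_inv (J u) ** matrix_inv (G' (T u)) ** (transpose (matrix_inv (J u)) ** transpose (J u)) ** X ** J u"
    unfolding inv_law[OF u] by (simp only: matrix_mul_assoc)
  then show ?thesis unfolding Jt by (simp add: matrix_mul_assoc)
qed

lemma ric_tilde_law:
  assumes u: "u \<in> W" and f': "smooth_on V f'" and f: "\<And>w. w \<in> W \<Longrightarrow> f w = f' (T w)"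
  shows "ric_tilde G lam f u = matrix_inv (J u) ** ric_tilde G' lam f' (T u) ** J u"
proof -
  have "ricci G u + hessian G f u - lam *\<^sub>R G u = transpose (J u) ** (ricci G' (T u) + hessian G' f' (T u) - lam *\<^sub>R G' (T u)) ** J u"
    by (simp only: mat_mult_distribs ricci_law[OF u] hessian_law(1)[OF u f' f] G_pullback[OF u, symmetric])
  then show ?thesis unfolding ric_tilde_def by (simp only: inv_mult_law[OF u])
qed

end

text \<open>\<open>scalar_curv\<close> pairs equal index positions while the trace of a product
  pairs transposed ones; the symmetry of the Ricci tensor reconciles them.\<close>

lemma (in metric_chart) scalar_curv_eq_trace:
  assumes "u \<in> S"
  shows "scalar_curv G u = trace (matrix_inv (G u) ** ricci G u)"
proof -
  have "ricci G u $ i $ j = ricci G u $ j $ i" for i j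
  proof -
    have "transpose (ricci G u) $ i $ j = ricci G u $ i $ j" by (simp add: ricci_symmetric[OF assms])
    then show ?thesis by (simp add: transpose_def)
  qed
  then show ?thesis unfolding scalar_curv_def trace_def matrix_matrix_mult_def by simp
qed

lemma grad_norm_sq_eq_inner:
  "grad_norm_sq G f u = (\<chi> i. partial i f u) \<bullet> (matrix_inv (G u) *v (\<chi> i. partial i f u))"
  by (simp add: grad_norm_sq_def inner_vec_def matrix_vector_mult_def sum_distrib_left mult_ac)

context coord_change
begin

lemma Y_tilde_law:
  assumes u: "u \<in> W" and f': "smooth_on V f'" and f: "\<And>w. w \<in> W \<Longrightarrow> f w = f' (T w)"
  shows "Y_tilde G lam f u = Y_tilde G' lam f' (T u)"
proof -
  note Jinv = matrix_inv_inverse[OF invertible_J[OF u]]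
  have "scalar_curv G u = trace (matrix_inv (J u) ** (matrix_inv (G' (T u)) ** ricci G' (T u)) ** J u)"
    unfolding src.scalar_curv_eq_trace[OF u] ricci_law[OF u] inv_mult_law[OF u] ..
  also have "\<dots> = trace (J u ** (matrix_inv (J u) ** (matrix_inv (G' (T u)) ** ricci G' (T u))))"
    by (rule trace_mul_sym)
  also have "\<dots> = scalar_curv G' (T u)"
    unfolding tgt.scalar_curv_eq_trace[OF T_in[OF u]] by (simp only: matrix_mul_assoc Jinv matrix_mul_lid)
  finally have 1: "scalar_curv G u = scalar_curv G' (T u)" .
  let ?v = "\<chi> i. partial i f u" and ?v' = "\<chi> a. partial a f' (T u)"
  have v: "?v = transpose (J u) *v ?v'"
    by (simp add: vec_eq_iff matrix_vector_mult_def transpose_def hessian_law(2)[OF u f' f])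
  have Jt: "transpose (matrix_inv (J u)) ** transpose (J u) = mat 1"
    by (metis matrix_inv_inverse(1)[OF invertible_J[OF u]] matrix_transpose_mul transpose_mat)
  have "grad_norm_sq G f u = (transpose (J u) *v ?v') \<bullet> (matrix_inv (G u) *v (transpose (J u) *v ?v'))"
    unfolding grad_norm_sq_eq_inner v ..
  also have "\<dots> = ?v' \<bullet> (J u *v (matrix_inv (G u) *v (transpose (J u) *v ?v')))"
    by (metis dot_lmul_matrix transpose_matrix_vector)
  also have "J u *v (matrix_inv (G u) *v (transpose (J u) *v ?v')) =
     ((J u ** matrix_inv (J u)) ** matrix_inv (G' (T u)) ** (transpose (matrix_inv (J u)) ** transpose (J u))) *v ?v'"
    unfolding inv_law[OF u] by (simp only: matrix_vector_mul_assoc matrix_mul_assoc)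
  also have "\<dots> = matrix_inv (G' (T u)) *v ?v'" unfolding Jt Jinv by simp
  also have "?v' \<bullet> (matrix_inv (G' (T u)) *v ?v') = grad_norm_sq G' f' (T u)"
    unfolding grad_norm_sq_eq_inner ..
  finally show ?thesis using 1 f[OF u] by (simp add: Y_tilde_def)
qed

lemma trsigma_law:
  assumes u: "u \<in> W" and f': "smooth_on V f'" and f: "\<And>w. w \<in> W \<Longrightarrow> f w = f' (T w)"
  shows "trsigma k (Y_tilde G lam f u) (ric_tilde G lam f u) = trsigma k (Y_tilde G' lam f' (T u)) (ric_tilde G' lam f' (T u))"
proof -
  have "Y_tilde G lam f u = Y_tilde G' lam f' (T u)"
    by (rule Y_tilde_law[OF u f']) (rule f)
  moreover have "ric_tilde G lam f u = matrix_inv (J u) ** ric_tilde G' lam f' (T u) ** J u"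
    by (rule ric_tilde_law[OF u f']) (rule f)
  ultimately show ?thesis
    by (simp only: trsigma_conj matrix_inv_inverse[OF invertible_J[OF u]])
qed

end

section \<open>Ellipticity\<close>

lemma Ck_on_subset: "Ck_on r S f \<Longrightarrow> W \<subseteq> S \<Longrightarrow> Ck_on r W f"
  by (induction r arbitrary: f) (auto intro: continuous_on_subset)

lemma smooth_on_subset: "smooth_on S f \<Longrightarrow> W \<subseteq> S \<Longrightarrow> smooth_on W f"
  using Ck_on_subset unfolding smooth_on_def by blast

lemma smooth_on_mat_pow:
  fixes P :: "real^'m::finite \<Rightarrow> real^'n::finite^'n"
  assumes "open S" "smooth_on S P"
  shows "smooth_on S (\<lambda>u. mat_pow (P u) i)"
  by (induction i) (simp_all add: smooth_on_const smooth_on_matrix_mult assms)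

lemma smooth_on_trsigma:
  fixes P :: "real^'m::finite \<Rightarrow> real^'n::finite^'n"
  assumes S: "open S" and c: "smooth_on S c" and P: "smooth_on S P"
  shows "smooth_on S (\<lambda>u. trsigma k (c u) (P u))"
proof (induction k rule: less_induct)
  case (less k)
  have tr: "smooth_on S (\<lambda>u. trace (mat_pow (P u) j))" for j
    by (intro smooth_on_linear[OF S bounded_linear_trace] smooth_on_mat_pow S P)
  have c0: "smooth_on S (\<lambda>u. if i = 0 then c u else 0)" for i :: nat
    using c by (cases "i = 0") (simp_all add: smooth_on_const)
  have N: "smooth_on S (\<lambda>u. power_sum_coeff (c u) (P u) i)" for i
    unfolding power_sum_coeff_def by (intro smooth_on_add smooth_on_mult smooth_on_const S tr c0)
  show ?case
  proof (cases k)
    case 0 then show ?thesis by (simp add: smooth_on_const)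
  next
    case (Suc m)
    have "smooth_on S (\<lambda>u. (1 / real (Suc m)) * (\<Sum>i\<le>m. trsigma (m - i) (c u) (P u) * power_sum_coeff (c u) (P u) i))"
      by (intro smooth_on_mult smooth_on_const smooth_on_sum S less N) (simp add: Suc)
    then show ?thesis using Suc by simp
  qed
qed

lemma smooth_on_newton_mat:
  fixes P :: "real^'m::finite \<Rightarrow> real^'n::finite^'n"
  assumes "open S" "smooth_on S c" "smooth_on S P"
  shows "smooth_on S (\<lambda>u. newton_mat k (c u) (P u))"
  unfolding newton_mat_def using assms
  by (intro smooth_on_sum smooth_on_bilinear[OF _ bounded_bilinear_scaleR] smooth_on_mult smooth_on_const
      smooth_on_trsigma smooth_on_mat_pow)

text \<open>In the theorem \<open>m\<close> is \<open>k - 1\<close>: differentiating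
  \<open>\<sigma>_{m+1}\<close> leaves expressions of order \<open>m\<close>.\<close>

definition lin_coeff2 where
  "lin_coeff2 m lam G f u = newton_mat m (Y_tilde G lam f u) (ric_tilde G lam f u) ** matrix_inv (G u)"

text \<open>First-order terms have two sources: the gradient norm in \<open>Y_tilde\<close>, whose
  derivative is polarized into two sums, and the Christoffel part of the Hessian, which the
  principal coefficients multiply.\<close>

definition lin_coeff1 where
  "lin_coeff1 m lam G f u = (\<chi> l. - (1/2) * trsigma m (Y_tilde G lam f u) (ric_tilde G lam f u) *
       ((\<Sum>j\<in>UNIV. matrix_inv (G u) $ l $ j * partial j f u) + (\<Sum>i\<in>UNIV. matrix_inv (G u) $ i $ l * partial i f u))
     - (\<Sum>i\<in>UNIV. \<Sum>j\<in>UNIV. lin_coeff2 m lam G f u $ i $ j * christoffel G l i j u))"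

definition lin_coeff0 where
  "lin_coeff0 m lam G f u = lam * trsigma m (Y_tilde G lam f u) (ric_tilde G lam f u)"

context metric_chart
begin

lemma smooth_inv_entry: "smooth_on S (\<lambda>u. matrix_inv (G u) $ i $ j)"
  by (intro smooth_on_nth open_S smooth_inv)

lemma smooth_Y_tilde:
  assumes "smooth_on S f" shows "smooth_on S (Y_tilde G lam f)"
  unfolding Y_tilde_def[abs_def] scalar_curv_def[abs_def] grad_norm_sq_def[abs_def]
  by (intro smooth_on_mult smooth_on_const smooth_on_add smooth_on_diff smooth_on_sum smooth_on_partial
      smooth_inv_entry smooth_on_nth smooth_ricci open_S assms)

lemma smooth_ric_tilde:
  assumes "smooth_on S f" shows "smooth_on S (ric_tilde G lam f)"
  unfolding ric_tilde_def[abs_def]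
  by (intro smooth_on_matrix_mult smooth_inv smooth_on_add smooth_on_diff smooth_ricci smooth_hessian
      smooth_on_linear[OF open_S bounded_linear_scaleR_right] smooth_G open_S assms)

lemma smooth_lin_coeffs:
  assumes f: "smooth_on S f"
  shows "smooth_on S (lin_coeff2 m lam G f)" "smooth_on S (lin_coeff1 m lam G f)" "smooth_on S (lin_coeff0 m lam G f)"
proof -
  have tr: "smooth_on S (\<lambda>u. trsigma m (Y_tilde G lam f u) (ric_tilde G lam f u))"
    by (intro smooth_on_trsigma open_S smooth_Y_tilde smooth_ric_tilde f)
  show 2: "smooth_on S (lin_coeff2 m lam G f)"
    unfolding lin_coeff2_def[abs_def]
    by (intro smooth_on_matrix_mult smooth_on_newton_mat open_S smooth_Y_tilde smooth_ric_tilde smooth_inv f)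
  show "smooth_on S (lin_coeff1 m lam G f)"
    unfolding lin_coeff1_def[abs_def]
    by (intro smooth_on_vec_lambda smooth_on_diff smooth_on_mult smooth_on_const smooth_on_add smooth_on_sum
        smooth_on_partial smooth_inv_entry smooth_on_nth smooth_christoffel open_S tr 2 f)
  show "smooth_on S (lin_coeff0 m lam G f)"
    unfolding lin_coeff0_def[abs_def] by (intro smooth_on_mult smooth_on_const open_S tr)
qed

lemma ric_symmetric:
  assumes "u \<in> S" "smooth_on S f"
  shows "transpose (ricci G u + hessian G f u - lam *\<^sub>R G u) = ricci G u + hessian G f u - lam *\<^sub>R G u"
proof -
  have "transpose (ricci G u) $ i $ j = ricci G u $ i $ j" "transpose (hessian G f u) $ i $ j = hessian G f u $ i $ j" for i j
    by (simp_all add: ricci_symmetric hessian_symmetric assms)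
  then show ?thesis using G_symmetric[OF assms(1)]
    by (simp add: transpose_def vec_eq_iff)
qed

lemma wsigma_end_ric_tilde:
  assumes "u \<in> S" "smooth_on S f"
  shows "wsigma_end k c (ric_tilde G lam f u) = trsigma k c (ric_tilde G lam f u)"
  unfolding ric_tilde_def by (intro wsigma_end_eq_trsigma pos_def_G ric_symmetric assms)

lemma lin_coeff2_symmetric:
  assumes "u \<in> S" "smooth_on S f"
  shows "transpose (lin_coeff2 m lam G f u) = lin_coeff2 m lam G f u"
  unfolding lin_coeff2_def ric_tilde_def by (intro newton_mat_symmetric pos_def_G ric_symmetric assms)

lemma lin_coeff2_definite:
  assumes "u \<in> S" "smooth_on S f"
    and "\<And>j. 1 \<le> j \<Longrightarrow> j \<le> Suc m \<Longrightarrow> (-1)^j * trsigma j (Y_tilde G lam f u) (ric_tilde G lam f u) > 0"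
  shows "definite_form (lin_coeff2 m lam G f u)"
  unfolding lin_coeff2_def ric_tilde_def
  by (intro newton_mat_definite pos_def_G ric_symmetric assms(1,2)) (use assms(3) in \<open>simp add: ric_tilde_def\<close>)

lemma partial_variation:
  fixes f h :: "real^'n \<Rightarrow> real"
  assumes "u \<in> S" "f differentiable (at u)" "h differentiable (at u)"
  shows "partial i (\<lambda>w. f w + t * h w) u = partial i f u + t * partial i h u"
proof -
  have th: "(\<lambda>w. t * h w) differentiable (at u)"
    by (rule differentiableI[OF bounded_linear.has_derivative[OF bounded_linear_mult_right differentiable_has_derivative[OF assms(3)]]])
  show ?thesis
    unfolding partial_add[OF assms(2) th] partial_linear[OF bounded_linear_mult_right assms(3)] ..
qed

text \<open>Along \<open>f + t h\<close> the endomorphism is affine in \<open>t\<close>, with slope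
  \<open>G^-1\<close> times the Hessian of \<open>h\<close>, and \<open>Y_tilde\<close> is
  quadratic. \<open>has_derivative_trsigma\<close> gives the derivative, which is then sorted by the
  order of the derivatives of \<open>h\<close>.\<close>

lemma trsigma_variation:
  assumes u: "u \<in> S" and f: "smooth_on S f" and h: "smooth_on S h"
  shows "((\<lambda>t. trsigma (Suc m) (Y_tilde G lam (\<lambda>w. f w + t * h w) u) (ric_tilde G lam (\<lambda>w. f w + t * h w) u)) has_real_derivative
     (\<Sum>i\<in>UNIV. \<Sum>j\<in>UNIV. lin_coeff2 m lam G f u $ i $ j * partial i (partial j h) u)
          + (\<Sum>i\<in>UNIV. lin_coeff1 m lam G f u $ i * partial i h u) + lin_coeff0 m lam G f u * h u) (at 0)"
proof -
  let ?H = "\<lambda>i j. matrix_inv (G u) $ i $ j"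
  let ?F = "trsigma m (Y_tilde G lam f u) (ric_tilde G lam f u)"
  note df = smooth_on_differentiable[OF f] and dh = smooth_on_differentiable[OF h]
  have p1: "partial i (\<lambda>w. f w + t * h w) v = partial i f v + t * partial i h v" if "v \<in> S" for i t v
    by (rule partial_variation[OF that df[OF that] dh[OF that]])
  have p2: "partial i (partial j (\<lambda>w. f w + t * h w)) u = partial i (partial j f) u + t * partial i (partial j h) u" for i j t
  proof -
    have "partial i (partial j (\<lambda>w. f w + t * h w)) u = partial i (\<lambda>v. partial j f v + t * partial j h v) u"
      by (rule partial_cong_open[OF open_S u p1])
    also have "\<dots> = partial i (partial j f) u + t * partial i (partial j h) u"
      by (intro partial_variation u smooth_on_differentiable[OF _ u] smooth_on_partial f h)
    finally show ?thesis .
  qed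
  have hess: "hessian G (\<lambda>w. f w + t * h w) u = hessian G f u + t *\<^sub>R hessian G h u" for t
    by (simp add: hessian_def vec_eq_iff p1[OF u] p2 algebra_simps sum.distrib sum_distrib_left)
  have ric: "ric_tilde G lam (\<lambda>w. f w + t * h w) u = ric_tilde G lam f u + t *\<^sub>R (matrix_inv (G u) ** hessian G h u)" for t
    by (simp add: ric_tilde_def hess mat_mult_distribs)
  have dP: "((\<lambda>t. ric_tilde G lam (\<lambda>w. f w + t * h w) u) has_vector_derivative (matrix_inv (G u) ** hessian G h u)) (at 0)"
    unfolding ric by (auto intro!: derivative_eq_intros)
  define Y' where "Y' = - (1/2) * ((\<Sum>i\<in>UNIV. \<Sum>j\<in>UNIV. ?H i j * (partial i h u * partial j f u + partial i f u * partial j h u)) - 2 * lam * h u)"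
  have dY: "((\<lambda>t. Y_tilde G lam (\<lambda>w. f w + t * h w) u) has_real_derivative Y') (at 0)"
    unfolding Y_tilde_def grad_norm_sq_def p1[OF u] Y'_def
    by (auto intro!: derivative_eq_intros sum.cong simp: algebra_simps)
  have Y'_eq: "Y' = lam * h u - (1/2) * (\<Sum>l\<in>UNIV. ((\<Sum>j\<in>UNIV. ?H l j * partial j f u) + (\<Sum>i\<in>UNIV. ?H i l * partial i f u)) * partial l h u)"
  proof -
    have "(\<Sum>i\<in>UNIV. \<Sum>j\<in>UNIV. ?H i j * (partial i f u * partial j h u)) = (\<Sum>l\<in>UNIV. (\<Sum>i\<in>UNIV. ?H i l * partial i f u) * partial l h u)"
      by (subst sum.swap) (simp add: sum_distrib_right mult.assoc)
    moreover have "(\<Sum>i\<in>UNIV. \<Sum>j\<in>UNIV. ?H i j * (partial i h u * partial j f u)) = (\<Sum>l\<in>UNIV. (\<Sum>j\<in>UNIV. ?H l j * partial j f u) * partial l h u)"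
      by (simp add: sum_distrib_left mult_ac)
    ultimately show ?thesis unfolding Y'_def distrib_left distrib_right sum.distrib by (simp add: algebra_simps)
  qed
  have tr: "trace (newton_mat m (Y_tilde G lam f u) (ric_tilde G lam f u) ** (matrix_inv (G u) ** hessian G h u))
     = (\<Sum>i\<in>UNIV. \<Sum>j\<in>UNIV. lin_coeff2 m lam G f u $ i $ j * partial i (partial j h) u)
       - (\<Sum>l\<in>UNIV. (\<Sum>i\<in>UNIV. \<Sum>j\<in>UNIV. lin_coeff2 m lam G f u $ i $ j * christoffel G l i j u) * partial l h u)"
  proof -
    have hs: "hessian G h u $ j $ i = hessian G h u $ i $ j" for i j
    proof -
      have "transpose (hessian G h u) $ i $ j = hessian G h u $ i $ j" by (simp add: hessian_symmetric[OF u h])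
      then show ?thesis by (simp add: transpose_def)
    qed
    have "trace (newton_mat m (Y_tilde G lam f u) (ric_tilde G lam f u) ** (matrix_inv (G u) ** hessian G h u))
      = (\<Sum>i\<in>UNIV. \<Sum>j\<in>UNIV. lin_coeff2 m lam G f u $ i $ j * hessian G h u $ j $ i)"
      unfolding matrix_mul_assoc lin_coeff2_def[symmetric] by (simp add: trace_def matrix_matrix_mult_def)
    also have "\<dots> = (\<Sum>i\<in>UNIV. \<Sum>j\<in>UNIV. lin_coeff2 m lam G f u $ i $ j * hessian G h u $ i $ j)"
      by (simp only: hs)
    also have "\<dots> = (\<Sum>i\<in>UNIV. \<Sum>j\<in>UNIV. lin_coeff2 m lam G f u $ i $ j * partial i (partial j h) u)
       - (\<Sum>i\<in>UNIV. \<Sum>j\<in>UNIV. \<Sum>l\<in>UNIV. lin_coeff2 m lam G f u $ i $ j * christoffel G l i j u * partial l h u)"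
      by (simp add: hessian_def right_diff_distrib sum_subtractf sum_distrib_left mult.assoc)
    also have "(\<Sum>i\<in>UNIV. \<Sum>j\<in>UNIV. \<Sum>l\<in>UNIV. lin_coeff2 m lam G f u $ i $ j * christoffel G l i j u * partial l h u)
       = (\<Sum>l\<in>UNIV. (\<Sum>i\<in>UNIV. \<Sum>j\<in>UNIV. lin_coeff2 m lam G f u $ i $ j * christoffel G l i j u) * partial l h u)"
      unfolding sum_distrib_right by (rule sum3_rotate[symmetric])
    finally show ?thesis .
  qed
  have b: "(\<Sum>i\<in>UNIV. lin_coeff1 m lam G f u $ i * partial i h u) =
     - (1/2) * ?F * (\<Sum>l\<in>UNIV. ((\<Sum>j\<in>UNIV. ?H l j * partial j f u) + (\<Sum>i\<in>UNIV. ?H i l * partial i f u)) * partial l h u)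
     - (\<Sum>l\<in>UNIV. (\<Sum>i\<in>UNIV. \<Sum>j\<in>UNIV. lin_coeff2 m lam G f u $ i $ j * christoffel G l i j u) * partial l h u)"
    unfolding lin_coeff1_def by (simp only: vec_lambda_beta left_diff_distrib sum_subtractf sum_distrib_left mult.assoc)
  have "((\<lambda>t. trsigma (Suc m) (Y_tilde G lam (\<lambda>w. f w + t * h w) u) (ric_tilde G lam (\<lambda>w. f w + t * h w) u)) has_real_derivative
     ?F * Y' + trace (newton_mat m (Y_tilde G lam f u) (ric_tilde G lam f u) ** (matrix_inv (G u) ** hessian G h u))) (at 0)"
    using has_derivative_trsigma[OF dP dY, of m] by simp
  also have "?F * Y' + trace (newton_mat m (Y_tilde G lam f u) (ric_tilde G lam f u) ** (matrix_inv (G u) ** hessian G h u))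
     = (\<Sum>i\<in>UNIV. \<Sum>j\<in>UNIV. lin_coeff2 m lam G f u $ i $ j * partial i (partial j h) u)
          + (\<Sum>i\<in>UNIV. lin_coeff1 m lam G f u $ i * partial i h u) + lin_coeff0 m lam G f u * h u"
    unfolding tr b Y'_eq lin_coeff0_def by (simp add: right_diff_distrib)
  finally show ?thesis .
qed

end

section \<open>Charts of the manifold, and the operator in a fixed chart\<close>

lemma is_chartD:
  assumes "is_chart M c"
  shows "open (chart_im c)" "inj_on (snd c) (fst c)" "openin M (fst c)"
    "\<And>p. p \<in> fst c \<Longrightarrow> chart_inv c (snd c p) = p"
    "\<And>u. u \<in> chart_im c \<Longrightarrow> chart_inv c u \<in> fst c \<and> snd c (chart_inv c u) = u"
    "\<And>U. openin M U \<Longrightarrow> open (snd c ` (fst c \<inter> U))"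
proof -
  have c: "openin M (fst c)" "open (chart_im c)" "homeomorphic_map (subtopology M (fst c)) (top_of_set (chart_im c)) (snd c)"
    using assms by (auto simp: is_chart_def)
  then have ts: "topspace (subtopology M (fst c)) = fst c"
    using openin_subset by (simp add: topspace_subtopology) blast
  show "open (chart_im c)" "openin M (fst c)" using c by auto
  show inj: "inj_on (snd c) (fst c)"
    using homeomorphic_imp_injective_map[OF c(3)] ts by simp
  show "chart_inv c (snd c p) = p" if "p \<in> fst c" for p
    using inj that by (simp add: chart_inv_def)
  show "chart_inv c u \<in> fst c \<and> snd c (chart_inv c u) = u" if "u \<in> chart_im c" for u
    using that by (auto simp: chart_inv_def chart_im_def inv_into_into f_inv_into_f)
  show "open (snd c ` (fst c \<inter> U))" if "openin M U" for U
  proof -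
    have "openin (subtopology M (fst c)) (fst c \<inter> U)"
      using that by (simp add: openin_subtopology_Int2)
    then have "openin (top_of_set (chart_im c)) (snd c ` (fst c \<inter> U))"
      using homeomorphic_imp_open_map[OF c(3)] by (simp add: open_map_def)
    then show ?thesis using c(2) by (simp add: openin_open_eq)
  qed
qed

locale riemannian =
  fixes M :: "'a topology" and A :: "('a, 'n::finite) chart set"
    and g :: "('a, 'n) chart \<Rightarrow> real^'n \<Rightarrow> real^'n^'n"
  assumes manifold: "riemannian_manifold M A g"
begin

lemma chart: "c \<in> A \<Longrightarrow> is_chart M c"
  using manifold by (simp add: riemannian_manifold_def smooth_manifold_def)

lemma metric_chart_A: "c \<in> A \<Longrightarrow> metric_chart (chart_im c) (g c)"
  using manifold is_chartD(1)[OF chart]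
  unfolding riemannian_manifold_def riemannian_metric_def metric_chart_def pos_def_mat_def by blast

lemma coord_change_A:
  assumes c: "c \<in> A" and d: "d \<in> A"
  shows "coord_change (snd c ` (fst c \<inter> fst d)) (chart_im d) (g c) (g d) (transition c d)"
proof -
  let ?W = "snd c ` (fst c \<inter> fst d)"
  note c' = is_chartD[OF chart[OF c]] and d' = is_chartD[OF chart[OF d]]
  have W: "open ?W" by (rule c'(6)[OF d'(3)])
  have sub: "?W \<subseteq> chart_im c" by (auto simp: chart_im_def)
  interpret c: metric_chart "chart_im c" "g c" by (rule metric_chart_A[OF c])
  interpret d: metric_chart "chart_im d" "g d" by (rule metric_chart_A[OF d])
  have sm: "smooth_on ?W (transition c d)"
    using manifold c d by (auto simp: riemannian_manifold_def smooth_manifold_def)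
  show ?thesis
  proof unfold_locales
    show "open ?W" by (rule W)
    show "smooth_on ?W (g c)" by (rule smooth_on_subset[OF c.smooth_G sub])
    show "pos_def_mat (g c u)" if "u \<in> ?W" for u using that sub c.pos_def_G by blast
    show "smooth_on ?W (transition c d)" by (rule sm)
    show "transition c d u \<in> chart_im d" if "u \<in> ?W" for u
      using that c'(4) by (auto simp: transition_def chart_im_def)
    show "g c u = transpose (jacobian_mat (transition c d) u) ** g d (transition c d u) ** jacobian_mat (transition c d) u"
      if u: "u \<in> ?W" for u
    proof -
      have "let J = matrix (frechet_derivative (transition c d) (at u))
        in g c u = transpose J ** g d (transition c d u) ** J"
        using manifold c d u unfolding riemannian_manifold_def riemannian_metric_def by blast
      then show ?thesis by (simp add: Let_def matrix_frechet_derivative[OF smooth_on_differentiable[OF sm u]])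
    qed
  qed
qed

text \<open>After this lemma neither the chart chosen at \<open>p\<close> nor the eigenvalue list
  chosen there is visible. Both choices may jump from point to point, so the smoothness of the
  coefficients rests on one formula valid on all of a fixed chart.\<close>

lemma sigma_tilde_in_chart:
  assumes c: "c \<in> A" and p: "p \<in> fst c" and \<phi>: "\<phi> \<in> smooth_functions A"
  shows "sigma_tilde A g lam k \<phi> p = trsigma k (Y_tilde (g c) lam (\<phi> \<circ> chart_inv c) (snd c p))
     (ric_tilde (g c) lam (\<phi> \<circ> chart_inv c) (snd c p))"
proof -
  define d where "d = chart_at A p"
  have d: "d \<in> A" "p \<in> fst d"
    using someI[of "\<lambda>c. c \<in> A \<and> p \<in> fst c" c] c p by (auto simp: d_def chart_at_def)
  note c' = is_chartD[OF chart[OF c]] and d' = is_chartD[OF chart[OF d(1)]]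
  interpret d: metric_chart "chart_im d" "g d" by (rule metric_chart_A[OF d(1)])
  interpret coord_change "snd c ` (fst c \<inter> fst d)" "chart_im d" "g c" "g d" "transition c d"
    by (rule coord_change_A[OF c d(1)])
  have fd: "smooth_on (chart_im d) (\<phi> \<circ> chart_inv d)" using \<phi> d(1) by (simp add: smooth_functions_def)
  have pd: "snd d p \<in> chart_im d" using d(2) by (simp add: chart_im_def)
  have u: "snd c p \<in> snd c ` (fst c \<inter> fst d)" using p d(2) by blast
  have Tp: "transition c d (snd c p) = snd d p" using c'(4)[OF p] by (simp add: transition_def)
  have "sigma_tilde A g lam k \<phi> p = trsigma k (Y_tilde (g d) lam (\<phi> \<circ> chart_inv d) (snd d p))
     (ric_tilde (g d) lam (\<phi> \<circ> chart_inv d) (snd d p))"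
    by (simp add: sigma_tilde_def Let_def d_def[symmetric] d.wsigma_end_ric_tilde[OF pd fd])
  also have "\<dots> = trsigma k (Y_tilde (g c) lam (\<phi> \<circ> chart_inv c) (snd c p))
     (ric_tilde (g c) lam (\<phi> \<circ> chart_inv c) (snd c p))"
    unfolding Tp[symmetric]
    by (rule trsigma_law[OF u fd, symmetric]) (auto simp: transition_def c'(4) d'(4))
  finally show ?thesis .
qed

lemma smooth_functions_variation:
  assumes "\<phi> \<in> smooth_functions A" "\<psi> \<in> smooth_functions A"
  shows "(\<lambda>q. \<phi> q + t * \<psi> q) \<in> smooth_functions A"
  unfolding smooth_functions_def
proof (safe)
  fix U x assume c: "(U, x) \<in> A"
  have S: "open (chart_im (U, x))" by (rule is_chartD(1)[OF chart[OF c]])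
  have "smooth_on (chart_im (U, x)) (\<phi> \<circ> chart_inv (U, x))" "smooth_on (chart_im (U, x)) (\<psi> \<circ> chart_inv (U, x))"
    using assms c unfolding smooth_functions_def by blast+
  then have "smooth_on (chart_im (U, x)) (\<lambda>u. (\<phi> \<circ> chart_inv (U, x)) u + t * (\<psi> \<circ> chart_inv (U, x)) u)"
    by (intro smooth_on_add smooth_on_mult smooth_on_const S)
  then show "smooth_on (chart_im (U, x)) ((\<lambda>q. \<phi> q + t * \<psi> q) \<circ> chart_inv (U, x))"
    by (simp add: o_def)
qed

lemma sigma_tilde_variation:
  assumes c: "c \<in> A" and p: "p \<in> fst c" and \<phi>: "\<phi> \<in> smooth_functions A" and \<psi>: "\<psi> \<in> smooth_functions A"
  defines "f \<equiv> \<phi> \<circ> chart_inv c" and "h \<equiv> \<psi> \<circ> chart_inv c" and "u \<equiv> snd c p"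
  shows "((\<lambda>t. sigma_tilde A g lam (Suc m) (\<lambda>q. \<phi> q + t * \<psi> q) p) has_real_derivative
     (\<Sum>i\<in>UNIV. \<Sum>j\<in>UNIV. lin_coeff2 m lam (g c) f u $ i $ j * partial i (partial j h) u)
          + (\<Sum>i\<in>UNIV. lin_coeff1 m lam (g c) f u $ i * partial i h u) + lin_coeff0 m lam (g c) f u * h u) (at 0)"
proof -
  interpret c: metric_chart "chart_im c" "g c" by (rule metric_chart_A[OF c])
  have fh: "smooth_on (chart_im c) f" "smooth_on (chart_im c) h"
    using \<phi> \<psi> c by (auto simp: smooth_functions_def f_def h_def)
  have u: "u \<in> chart_im c" using p by (simp add: chart_im_def u_def)
  have "(\<lambda>q. \<phi> q + t * \<psi> q) \<circ> chart_inv c = (\<lambda>w. f w + t * h w)" for t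
    by (simp add: f_def h_def o_def)
  then show ?thesis
    using c.trsigma_variation[OF u fh]
    by (simp only: sigma_tilde_in_chart[OF c p smooth_functions_variation[OF \<phi> \<psi>]] u_def)
qed

end

theorem proposition4p5:
  fixes M :: "'a topology"
    and A :: "('a, 'n::finite) chart set"
    and g :: "('a, 'n) chart \<Rightarrow> real^'n \<Rightarrow> real^'n^'n"
    and k :: nat and lam :: real
  assumes "riemannian_manifold M A g"
    and "k \<ge> 1"
  shows "elliptic_in M A (sigma_tilde A g lam k)
           {\<phi> \<in> smooth_functions A. (\<phi>, lam) \<in> neg_cone M A g k}"
proof -
  interpret riemannian M A g by unfold_locales (rule assms(1))
  obtain m where k: "k = Suc m" using assms(2) by (cases k) auto
  have "elliptic_at M A (sigma_tilde A g lam k) \<phi>"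
    if \<phi>: "\<phi> \<in> smooth_functions A" and cone: "(\<phi>, lam) \<in> neg_cone M A g k" for \<phi>
    unfolding elliptic_at_def
  proof (intro conjI ballI)
    fix \<psi> p assume \<psi>: "\<psi> \<in> smooth_functions A" and "p \<in> topspace M"
    then have "p \<in> (\<Union>c\<in>A. fst c)"
      using assms(1) by (simp add: riemannian_manifold_def smooth_manifold_def)
    then obtain c where "c \<in> A" "p \<in> fst c" by blast
    from sigma_tilde_variation[OF this \<phi> \<psi>, of lam m]
    show "(\<lambda>t. sigma_tilde A g lam k (\<lambda>q. \<phi> q + t * \<psi> q) p) field_differentiable (at 0)"
      unfolding k field_differentiable_def by blast
  next
    show "elliptic_diff_op2 A (linearization (sigma_tilde A g lam k) \<phi>)"
      unfolding elliptic_diff_op2_def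
    proof
      fix c assume c: "c \<in> A"
      let ?f = "\<phi> \<circ> chart_inv c"
      interpret c: metric_chart "chart_im c" "g c" by (rule metric_chart_A[OF c])
      note c' = is_chartD[OF chart[OF c]]
      have f: "smooth_on (chart_im c) ?f" using \<phi> c by (simp add: smooth_functions_def)
      have "diff_op2_in_chart A (linearization (sigma_tilde A g lam k) \<phi>) c
         (lin_coeff2 m lam (g c) ?f) (lin_coeff1 m lam (g c) ?f) (lin_coeff0 m lam (g c) ?f)"
        unfolding diff_op2_in_chart_def Let_def
      proof (intro conjI ballI c.smooth_lin_coeffs f)
        show "transpose (lin_coeff2 m lam (g c) ?f u) = lin_coeff2 m lam (g c) ?f u" if "u \<in> chart_im c" for u
          by (rule c.lin_coeff2_symmetric[OF that f])
      next
        fix \<psi> u assume \<psi>: "\<psi> \<in> smooth_functions A" and "u \<in> chart_im c"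
        then have p: "chart_inv c u \<in> fst c" "snd c (chart_inv c u) = u" using c'(5) by auto
        show "linearization (sigma_tilde A g lam k) \<phi> \<psi> (chart_inv c u) =
          (\<Sum>i\<in>UNIV. \<Sum>j\<in>UNIV. lin_coeff2 m lam (g c) ?f u $ i $ j * partial i (partial j (\<psi> \<circ> chart_inv c)) u)
          + (\<Sum>i\<in>UNIV. lin_coeff1 m lam (g c) ?f u $ i * partial i (\<psi> \<circ> chart_inv c) u)
          + lin_coeff0 m lam (g c) ?f u * (\<psi> \<circ> chart_inv c) u"
          unfolding linearization_def k
          by (rule DERIV_imp_deriv[OF sigma_tilde_variation[OF c p(1) \<phi> \<psi>, of lam m, unfolded p(2)]])
      qed
      moreover have "definite_form (lin_coeff2 m lam (g c) ?f u)" if u: "u \<in> chart_im c" for u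
      \<comment> \<open>The cone gives the signs at every point of \<open>M\<close>; they are
        transported to the coordinates \<open>u\<close> through the point
        \<open>chart_inv c u\<close>.\<close>
      proof (rule c.lin_coeff2_definite[OF u f])
        fix j assume j: "1 \<le> j" "j \<le> Suc m"
        have p: "chart_inv c u \<in> fst c" "snd c (chart_inv c u) = u" using c'(5)[OF u] by auto
        have "chart_inv c u \<in> topspace M" using p(1) openin_subset[OF c'(3)] by blast
        then have "(-1)^j * sigma_tilde A g lam j \<phi> (chart_inv c u) > 0"
          using cone j by (simp add: neg_cone_def k)
        then show "(-1)^j * trsigma j (Y_tilde (g c) lam ?f u) (ric_tilde (g c) lam ?f u) > 0"
          unfolding sigma_tilde_in_chart[OF c p(1) \<phi>] p(2) .
      qed
      ultimately show "\<exists>a b e. diff_op2_in_chart A (linearization (sigma_tilde A g lam k) \<phi>) c a b e \<and>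
          (\<forall>u\<in>chart_im c. definite_form (a u))" by blast
    qed
  qed
  then show ?thesis by (auto simp: elliptic_in_def)
qed

end
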